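(* Let $(\mathfrak G,[-,-]_{\mathfrak G})$ be a Leibniz algebra, with Leibniz kernel $\mathrm{Leib}(\mathfrak G)$, inclusion $\mathfrak i:\mathrm{Leib}(\mathfrak G)\to\mathfrak G$ and projection $\mathrm{pr}:\mathfrak G\to\mathfrak G_{\mathrm{Lie}}$. For each symmetric representation $(V;\rho_V^L,-\rho_V^L)$ of $\mathfrak G$ define $$\alpha_V:(\mathsf C_{\mathrm{Leib}(\mathfrak G)}\circ\mathcal I_s)(V;\rho_V^L,-\rho_V^L)\to\mathsf C_{\mathfrak G}(V;\rho_V^L,-\rho_V^L),\qquad \alpha_V(g)=\mathfrak i\circ g,\quad g\in\mathrm{Hom}(\otimes^nV,\mathrm{Leib}(\mathfrak G)),$$ $$\beta_V:\mathsf C_{\mathfrak G}(V;\rho_V^L,-\rho_V^L)\to(\mathsf C_{\mathfrak G_{\mathrm{Lie}}}\circ\mathcal P_s)(V;\rho_V^L,-\rho_V^L),\qquad \beta_V(f)=\mathrm{pr}\circ f,\quad f\in\mathrm{Hom}(\otimes^nV,\mathfrak G).$$ Then $\alpha$ is a natural transformation from the functor $\mathsf C_{\mathrm{Leib}(\mathfrak G)}\circ\mathcal I_s$ to $\mathsf C_{\mathfrak G}$, and $\beta$ is a natural transformation from the functor $\mathsf C_{\mathfrak G}$ to $\mathsf C_{\mathfrak G_{\mathrm{Lie}}}\circ\mathcal P_s$ (all regarded as contravariant functors from the category of symmetric representations of $\mathfrak G$ to the category of graded Lie algebras). Moreover, for any symmetric representation $(V;\rho_V^L,-\rho_V^L)$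 of $\mathfrak G$, there is a short exact sequence of graded Lie algebras $$0\to(\mathsf C_{\mathrm{Leib}(\mathfrak G)}\circ\mathcal I_s)(V;\rho_V^L,-\rho_V^L)\xrightarrow{\alpha_V}\mathsf C_{\mathfrak G}(V;\rho_V^L,-\rho_V^L)\xrightarrow{\beta_V}(\mathsf C_{\mathfrak G_{\mathrm{Lie}}}\circ\mathcal P_s)(V;\rho_V^L,-\rho_V^L)\to0.$$
   Context: All vector spaces are finite-dimensional over an algebraically closed field $\mathbb K$ of characteristic $0$. A (left) Leibniz algebra is a vector space $\mathfrak G$ with a bilinear operation $[-,-]_{\mathfrak G}$ such that $[x,[y,z]_{\mathfrak G}]_{\mathfrak G}=[[x,y]_{\mathfrak G},z]_{\mathfrak G}+[y,[x,z]_{\mathfrak G}]_{\mathfrak G}$. A representation of $\mathfrak G$ is a triple $(V;\rho^L,\rho^R)$ with $\rho^L,\rho^R:\mathfrak G\to\mathfrak{gl}(V)$ linear such that for all $x,y\in\mathfrak G$: $\rho^L([x,y]_{\mathfrak G})=[\rho^L(x),\rho^L(y)]$, $\rho^R([x,y]_{\mathfrak G})=[\rho^L(x),\rho^R(y)]$, $\rho^R(y)\circ\rho^L(x)=-\rho^R(y)\circ\rho^R(x)$. It is symmetric if $\rho^R=-\rho^L$. A homomorphism of representations $(W;\rho_W^L,\rho_W^R)\to(V;\rho_V^L,\rho_V^R)$ is a linear map $\phi:W\to V$ with $\phi(\rho_W^L(x)w)=\rho_V^L(x)\phi(w)$ and $\phi(\rho_W^R(x)w)=\rho_V^R(x)\phi(w)$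 for all $x\in\mathfrak G$, $w\in W$. The Leibniz kernel $\mathrm{Leib}(\mathfrak G)$ is the span of all $[x,x]_{\mathfrak G}$, $x\in\mathfrak G$; it is an ideal, and $\mathfrak G_{\mathrm{Lie}}:=\mathfrak G/\mathrm{Leib}(\mathfrak G)$ is a Lie algebra (the canonical Lie algebra), with projection $\mathrm{pr}$, $\mathrm{pr}(x)=\bar x$. For a representation $(V;\rho_V^L,\rho_V^R)$ of $\mathfrak G$ one has $\rho_V^L(\mathrm{Leib}(\mathfrak G))=0$, and $\theta_V:\mathfrak G_{\mathrm{Lie}}\to\mathfrak{gl}(V)$, $\theta_V(\bar x)=\rho_V^L(x)$, is a representation of the Lie algebra $\mathfrak G_{\mathrm{Lie}}$. Balavoine bracket: for a vector space $E$, on $\oplus_{n\ge1}\mathrm{Hom}(\otimes^nE,E)$, for $P\in\mathrm{Hom}(\otimes^{p+1}E,E)$, $Q\in\mathrm{Hom}(\otimes^{q+1}E,E)$, set $[P,Q]_{\mathsf B}=P\bar\circ Q-(-1)^{pq}Q\bar\circ P$, where $P\bar\circ Q=\sum_{k=1}^{p+1}P\circ_kQ$ and $$(P\circ_kQ)(x_1,\dots,x_{p+q+1})=\sum_{\sigma}(-1)^{(k-1)q}(-1)^\sigma P(x_{\sigma(1)},\dots,x_{\sigma(k-1)},Q(x_{\sigma(k)},\dots,x_{\sigma(k+q-1)},x_{k+q}),x_{k+q+1},\dots,x_{p+q+1}),$$ the sum being over $(k-1,q)$-shuffles $\sigma$ of $\{1,\dots,k+q-1\}$, and $(-1)^\sigma$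 the sign of $\sigma$. The graded Lie algebra $\mathsf C_{\mathfrak G}(V;\rho_V^L,\rho_V^R)$: for a representation $(V;\rho_V^L,\rho_V^R)$ of a Leibniz algebra $\mathfrak G$, let $\mu$ be the Leibniz multiplication on $\mathfrak G\oplus V$ given by $\mu(x+u,y+v)=[x,y]_{\mathfrak G}+\rho_V^L(x)v+\rho_V^R(y)u$. Let $C^*(V,\mathfrak G)=\oplus_{n\ge1}\mathrm{Hom}(\otimes^nV,\mathfrak G)$, with elements of $\mathrm{Hom}(\otimes^nV,\mathfrak G)$ of degree $n$. Regarding elements of $\mathrm{Hom}(\otimes^nV,\mathfrak G)$ as elements of $\mathrm{Hom}(\otimes^n(\mathfrak G\oplus V),\mathfrak G\oplus V)$ by extending by zero, the graded Lie bracket is $\{g_1,g_2\}_V=(-1)^{m-1}[[\mu,g_1]_{\mathsf B},g_2]_{\mathsf B}$ for $g_1\in\mathrm{Hom}(\otimes^mV,\mathfrak G)$, $g_2\in\mathrm{Hom}(\otimes^nV,\mathfrak G)$. It is known that this is a graded Lie algebra; set $\mathsf C_{\mathfrak G}(V;\rho_V^L,\rho_V^R)=(C^*(V,\mathfrak G),\{-,-\}_V)$. On a homomorphism $\phi:W\to V$ of representations, $\mathsf C_{\mathfrak G}(\phi):C^*(V,\mathfrak G)\to C^*(W,\mathfrak G)$ is $f\mapsto f\circ\phi^{\otimes n}$ for $f\in\mathrm{Hom}(\otimes^nV,\mathfrak G)$. This makes $\mathsf C_{\mathfrak G}$ a contravariant functor from representations of $\mathfrak G$ to graded Lie algebras;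 the same notation is used for the Leibniz algebras $\mathrm{Leib}(\mathfrak G)$ (with the restricted bracket) and $\mathfrak G_{\mathrm{Lie}}$. Functors on symmetric representations of $\mathfrak G$: $\mathcal I_s(V;\rho_V^L,-\rho_V^L)=(V;\rho_V^L\circ\mathfrak i,-\rho_V^L\circ\mathfrak i)$, a symmetric representation of $\mathrm{Leib}(\mathfrak G)$; $\mathcal P_s(V;\rho_V^L,-\rho_V^L)=(V;\theta_V,-\theta_V)$, a symmetric representation of $\mathfrak G_{\mathrm{Lie}}$; both are the identity $\phi\mapsto\phi$ on morphisms. *)

theory Defs
  imports
    "HOL-Algebra.Algebraic_Closure"
    "HOL-Combinatorics.Permutations"
    "Jordan_Normal_Form.Missing_VectorSpace"
begin

text \<open>
  Vector spaces are \<^const>\<open>vectorspace\<close>s with explicit carriers, so that the Leibniz kernel and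
  the quotient by it are objects of the same kind as the given algebra. The fields
  \<^term>\<open>monoid.mult\<close> and \<^term>\<open>one\<close> that \<^typ>\<open>('k, 'a) module\<close> inherits from rings play no role.
\<close>

definition bilinear_maps ::
  "('k, 'r) ring_scheme \<Rightarrow> ('k, 'a, 'x) module_scheme \<Rightarrow> ('k, 'b, 'y) module_scheme \<Rightarrow>
   ('k, 'c, 'z) module_scheme \<Rightarrow> ('a \<Rightarrow> 'b \<Rightarrow> 'c) set" where
  "bilinear_maps K U V W =
     {b. (\<forall>u\<in>carrier U. b u \<in> module_hom K V W) \<and>
         (\<forall>v\<in>carrier V. (\<lambda>u. b u v) \<in> module_hom K U W)}"

section \<open>Leibniz algebras and their representations\<close>

record ('k, 'g) leibniz = "('k, 'g) module" +
  bracket :: "'g \<Rightarrow> 'g \<Rightarrow> 'g"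

definition leibniz_algebra :: "'k ring \<Rightarrow> ('k, 'g) leibniz \<Rightarrow> bool" where
  "leibniz_algebra K L \<longleftrightarrow>
     vectorspace K L \<and> vectorspace.fin_dim K L \<and>
     bracket L \<in> bilinear_maps K L L L \<and>
     (\<forall>x\<in>carrier L. \<forall>y\<in>carrier L. \<forall>z\<in>carrier L.
        bracket L x (bracket L y z) =
        bracket L (bracket L x y) z \<oplus>\<^bsub>L\<^esub> bracket L y (bracket L x z))"

record ('k, 'g, 'v) repn = "('k, 'v) module" +
  lact :: "'g \<Rightarrow> 'v \<Rightarrow> 'v"
  ract :: "'g \<Rightarrow> 'v \<Rightarrow> 'v"

definition leibniz_rep :: "'k ring \<Rightarrow> ('k, 'g) leibniz \<Rightarrow> ('k, 'g, 'v) repn \<Rightarrow> bool" where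
  "leibniz_rep K L V \<longleftrightarrow>
     vectorspace K V \<and> vectorspace.fin_dim K V \<and>
     lact V \<in> bilinear_maps K L V V \<and> ract V \<in> bilinear_maps K L V V \<and>
     (\<forall>x\<in>carrier L. \<forall>y\<in>carrier L. \<forall>v\<in>carrier V.
        lact V (bracket L x y) v = lact V x (lact V y v) \<ominus>\<^bsub>V\<^esub> lact V y (lact V x v) \<and>
        ract V (bracket L x y) v = lact V x (ract V y v) \<ominus>\<^bsub>V\<^esub> ract V y (lact V x v) \<and>
        ract V y (lact V x v) = \<ominus>\<^bsub>V\<^esub> ract V y (ract V x v))"

definition symmetric_rep :: "'k ring \<Rightarrow> ('k, 'g) leibniz \<Rightarrow> ('k, 'g, 'v) repn \<Rightarrow> bool" where
  "symmetric_rep K L V \<longleftrightarrow> leibniz_rep K L V \<and>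
     (\<forall>x\<in>carrier L. \<forall>v\<in>carrier V. ract V x v = \<ominus>\<^bsub>V\<^esub> lact V x v)"

text \<open>Homomorphisms are extensional, so that equal maps on the carrier are equal morphisms.\<close>

definition rep_hom ::
  "'k ring \<Rightarrow> ('k, 'g) leibniz \<Rightarrow> ('k, 'g, 'w) repn \<Rightarrow> ('k, 'g, 'v) repn \<Rightarrow> ('w \<Rightarrow> 'v) set" where
  "rep_hom K L W V =
     {\<phi> \<in> module_hom K W V \<inter> extensional (carrier W).
        \<forall>x\<in>carrier L. \<forall>w\<in>carrier W.
          \<phi> (lact W x w) = lact V x (\<phi> w) \<and> \<phi> (ract W x w) = ract V x (\<phi> w)}"

definition leib_kernel :: "'k ring \<Rightarrow> ('k, 'g) leibniz \<Rightarrow> 'g set" where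
  "leib_kernel K L = module.span K L ((\<lambda>x. bracket L x x) ` carrier L)"

definition leib_sub :: "'k ring \<Rightarrow> ('k, 'g) leibniz \<Rightarrow> ('k, 'g) leibniz" where
  "leib_sub K L = L\<lparr>carrier := leib_kernel K L\<rparr>"

definition leib_incl :: "'g \<Rightarrow> 'g" where
  "leib_incl = (\<lambda>x. x)"

text \<open>The quotient by an ideal \<^term>\<open>I\<close>; its elements are the cosets of \<^term>\<open>I\<close>.\<close>

definition quotient_leibniz :: "('k, 'g) leibniz \<Rightarrow> 'g set \<Rightarrow> ('k, 'g set) leibniz" where
  "quotient_leibniz L I =
     \<lparr>carrier = a_rcosets\<^bsub>L\<^esub> I,
      monoid.mult = undefined, one = undefined,
      zero = I,
      add = set_add L,
      smult = (\<lambda>a C. \<Union>x\<in>C. I +>\<^bsub>L\<^esub> (a \<odot>\<^bsub>L\<^esub> x)),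
      bracket = (\<lambda>C D. \<Union>x\<in>C. \<Union>y\<in>D. I +>\<^bsub>L\<^esub> bracket L x y)\<rparr>"

definition canonical_lie :: "'k ring \<Rightarrow> ('k, 'g) leibniz \<Rightarrow> ('k, 'g set) leibniz" where
  "canonical_lie K L = quotient_leibniz L (leib_kernel K L)"

definition lie_proj :: "'k ring \<Rightarrow> ('k, 'g) leibniz \<Rightarrow> 'g \<Rightarrow> 'g set" where
  "lie_proj K L x = leib_kernel K L +>\<^bsub>L\<^esub> x"

section \<open>Multilinear maps and the Balavoine bracket\<close>

text \<open>
  \<open>Hom(\<otimes>\<^sup>nV, W)\<close> is the space of \<^term>\<open>n\<close>-linear maps, taken as functions on lists of
  length \<^term>\<open>n\<close> and extensional outside of these lists.
\<close>

definition tuples :: "('k, 'v, 'x) module_scheme \<Rightarrow> nat \<Rightarrow> 'v list set" where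
  "tuples V n = {xs. length xs = n \<and> set xs \<subseteq> carrier V}"

definition multilinear_maps ::
  "'k ring \<Rightarrow> ('k, 'v, 'x) module_scheme \<Rightarrow> ('k, 'w, 'y) module_scheme \<Rightarrow> nat \<Rightarrow> ('v list \<Rightarrow> 'w) set" where
  "multilinear_maps K V W n =
     {f \<in> tuples V n \<rightarrow>\<^sub>E carrier W.
        \<forall>xs\<in>tuples V n. \<forall>i<n. (\<lambda>v. f (xs[i := v])) \<in> module_hom K V W}"

definition hom_space ::
  "'k ring \<Rightarrow> ('k, 'v, 'x) module_scheme \<Rightarrow> ('k, 'w, 'y) module_scheme \<Rightarrow> nat \<Rightarrow>
   ('k, 'v list \<Rightarrow> 'w) module" where
  "hom_space K V W n =
     \<lparr>carrier = multilinear_maps K V W n,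
      monoid.mult = undefined, one = undefined,
      zero = (\<lambda>xs\<in>tuples V n. \<zero>\<^bsub>W\<^esub>),
      add = (\<lambda>f g. \<lambda>xs\<in>tuples V n. f xs \<oplus>\<^bsub>W\<^esub> g xs),
      smult = (\<lambda>a f. \<lambda>xs\<in>tuples V n. a \<odot>\<^bsub>W\<^esub> f xs)\<rparr>"

definition shuffle_perms :: "nat \<Rightarrow> nat \<Rightarrow> (nat \<Rightarrow> nat) set" where
  "shuffle_perms i j =
     {\<sigma>. \<sigma> permutes {1..i + j} \<and> strict_mono_on {1..i} \<sigma> \<and> strict_mono_on {i + 1..i + j} \<sigma>}"

text \<open>
  \<open>P \<circ>\<^sub>k Q\<close> for \<^term>\<open>P\<close> of arity \<open>p + 1\<close> and \<^term>\<open>Q\<close> of arity \<open>q + 1\<close>. The argument called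
  \<open>x\<^sub>i\<close> in the formula is \<open>xs ! (i - 1)\<close>, so that \<open>drop (k + q) xs\<close> is the list of
  \<open>x\<^bsub>k+q+1\<^esub>, \<dots>, x\<^bsub>p+q+1\<^esub>\<close>.
\<close>

definition insertion ::
  "('k, 'e) module \<Rightarrow> nat \<Rightarrow> nat \<Rightarrow> nat \<Rightarrow> ('e list \<Rightarrow> 'e) \<Rightarrow> ('e list \<Rightarrow> 'e) \<Rightarrow> 'e list \<Rightarrow> 'e" where
  "insertion E p q k P Q =
     (\<lambda>xs\<in>tuples E (p + q + 1).
        \<Oplus>\<^bsub>E\<^esub>\<sigma>\<in>shuffle_perms (k - 1) q.
          [((- 1) ^ ((k - 1) * q) * sign \<sigma>)] \<cdot>\<^bsub>E\<^esub>
            P (map (\<lambda>i. xs ! (\<sigma> i - 1)) [1..<k] @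
               [Q (map (\<lambda>i. xs ! (\<sigma> i - 1)) [k..<k + q] @ [xs ! (k + q - 1)])] @
               drop (k + q) xs))"

definition bar_comp ::
  "('k, 'e) module \<Rightarrow> nat \<Rightarrow> nat \<Rightarrow> ('e list \<Rightarrow> 'e) \<Rightarrow> ('e list \<Rightarrow> 'e) \<Rightarrow> 'e list \<Rightarrow> 'e" where
  "bar_comp E p q P Q =
     (\<lambda>xs\<in>tuples E (p + q + 1). \<Oplus>\<^bsub>E\<^esub>k\<in>{1..p + 1}. insertion E p q k P Q xs)"

definition balavoine ::
  "('k, 'e) module \<Rightarrow> nat \<Rightarrow> nat \<Rightarrow> ('e list \<Rightarrow> 'e) \<Rightarrow> ('e list \<Rightarrow> 'e) \<Rightarrow> 'e list \<Rightarrow> 'e" where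
  "balavoine E p q P Q =
     (\<lambda>xs\<in>tuples E (p + q + 1).
        bar_comp E p q P Q xs \<ominus>\<^bsub>E\<^esub> [((- 1 :: int) ^ (p * q))] \<cdot>\<^bsub>E\<^esub> bar_comp E q p Q P xs)"

section \<open>Graded Lie algebras\<close>

text \<open>
  A graded Lie algebra concentrated in positive degrees is given by its homogeneous components
  \<^term>\<open>component A n\<close> and the brackets between components; the index \<open>0\<close> is ignored.
\<close>

record ('k, 'a) graded_algebra =
  component :: "nat \<Rightarrow> ('k, 'a) module"
  gbracket :: "nat \<Rightarrow> nat \<Rightarrow> 'a \<Rightarrow> 'a \<Rightarrow> 'a"

definition graded_lie_algebra :: "'k ring \<Rightarrow> ('k, 'a) graded_algebra \<Rightarrow> bool" where
  "graded_lie_algebra K A \<longleftrightarrow>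
     (\<forall>n\<ge>1. vectorspace K (component A n)) \<and>
     (\<forall>m\<ge>1. \<forall>n\<ge>1. gbracket A m n \<in>
        bilinear_maps K (component A m) (component A n) (component A (m + n))) \<and>
     (\<forall>m\<ge>1. \<forall>n\<ge>1. \<forall>x\<in>carrier (component A m). \<forall>y\<in>carrier (component A n).
        gbracket A m n x y =
        \<ominus>\<^bsub>component A (m + n)\<^esub>
          ([((- 1 :: int) ^ (m * n))] \<cdot>\<^bsub>component A (m + n)\<^esub> gbracket A n m y x)) \<and>
     (\<forall>l\<ge>1. \<forall>m\<ge>1. \<forall>n\<ge>1. \<forall>x\<in>carrier (component A l). \<forall>y\<in>carrier (component A m).
        \<forall>z\<in>carrier (component A n).
          gbracket A l (m + n) x (gbracket A m n y z) =
          gbracket A (l + m) n (gbracket A l m x y) z \<oplus>\<^bsub>component A (l + m + n)\<^esub>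
          [((- 1 :: int) ^ (l * m))] \<cdot>\<^bsub>component A (l + m + n)\<^esub>
            gbracket A m (l + n) y (gbracket A l n x z))"

definition graded_lie_hom ::
  "'k ring \<Rightarrow> ('k, 'a) graded_algebra \<Rightarrow> ('k, 'b) graded_algebra \<Rightarrow> (nat \<Rightarrow> 'a \<Rightarrow> 'b) set" where
  "graded_lie_hom K A B =
     {F. (\<forall>n\<ge>1. F n \<in> module_hom K (component A n) (component B n)) \<and>
         (\<forall>m\<ge>1. \<forall>n\<ge>1. \<forall>x\<in>carrier (component A m). \<forall>y\<in>carrier (component A n).
            F (m + n) (gbracket A m n x y) = gbracket B m n (F m x) (F n y))}"

definition graded_lie_short_exact ::
  "'k ring \<Rightarrow> ('k, 'a) graded_algebra \<Rightarrow> (nat \<Rightarrow> 'a \<Rightarrow> 'b) \<Rightarrow> ('k, 'b) graded_algebra \<Rightarrow>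
   (nat \<Rightarrow> 'b \<Rightarrow> 'c) \<Rightarrow> ('k, 'c) graded_algebra \<Rightarrow> bool" where
  "graded_lie_short_exact K A F B G C \<longleftrightarrow>
     graded_lie_algebra K A \<and> graded_lie_algebra K B \<and> graded_lie_algebra K C \<and>
     F \<in> graded_lie_hom K A B \<and> G \<in> graded_lie_hom K B C \<and>
     (\<forall>n\<ge>1. inj_on (F n) (carrier (component A n)) \<and>
        F n ` carrier (component A n) =
          {x \<in> carrier (component B n). G n x = \<zero>\<^bsub>component C n\<^esub>} \<and>
        G n ` carrier (component B n) = carrier (component C n))"

section \<open>The controlling graded Lie algebra of a representation\<close>

definition semidirect_mult ::
  "('k, 'g) leibniz \<Rightarrow> ('k, 'g, 'v) repn \<Rightarrow> ('g \<times> 'v) list \<Rightarrow> 'g \<times> 'v" where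
  "semidirect_mult L V =
     (\<lambda>zs\<in>tuples (direct_sum L V) 2.
        (bracket L (fst (zs ! 0)) (fst (zs ! 1)),
         lact V (fst (zs ! 0)) (snd (zs ! 1)) \<oplus>\<^bsub>V\<^esub> ract V (fst (zs ! 1)) (snd (zs ! 0))))"

definition extend_zero ::
  "('k, 'g) leibniz \<Rightarrow> ('k, 'g, 'v) repn \<Rightarrow> nat \<Rightarrow> ('v list \<Rightarrow> 'g) \<Rightarrow> ('g \<times> 'v) list \<Rightarrow> 'g \<times> 'v" where
  "extend_zero L V n g =
     (\<lambda>zs\<in>tuples (direct_sum L V) n. (g (map snd zs), \<zero>\<^bsub>V\<^esub>))"

text \<open>
  \<open>(-1)\<^bsup>m-1\<^esup> [[\<mu>, g\<^sub>1], g\<^sub>2]\<close> is the extension by zero of a unique element of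
  \<open>Hom(\<otimes>\<^bsup>m+n\<^esup>V, L)\<close>. This element is recovered here by restricting the arguments to
  \<^term>\<open>V\<close> and projecting the value to \<^term>\<open>L\<close>.
\<close>

definition derived_bracket ::
  "('k, 'g) leibniz \<Rightarrow> ('k, 'g, 'v) repn \<Rightarrow> nat \<Rightarrow> nat \<Rightarrow>
   ('v list \<Rightarrow> 'g) \<Rightarrow> ('v list \<Rightarrow> 'g) \<Rightarrow> 'v list \<Rightarrow> 'g" where
  "derived_bracket L V m n g1 g2 =
     (\<lambda>vs\<in>tuples V (m + n).
        [((- 1 :: int) ^ (m - 1))] \<cdot>\<^bsub>L\<^esub>
          fst (balavoine (direct_sum L V) m (n - 1)
                 (balavoine (direct_sum L V) 1 (m - 1) (semidirect_mult L V) (extend_zero L V m g1))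
                 (extend_zero L V n g2)
                 (map (\<lambda>v. (\<zero>\<^bsub>L\<^esub>, v)) vs)))"

definition controlling_algebra ::
  "'k ring \<Rightarrow> ('k, 'g) leibniz \<Rightarrow> ('k, 'g, 'v) repn \<Rightarrow> ('k, 'v list \<Rightarrow> 'g) graded_algebra" where
  "controlling_algebra K L V =
     \<lparr>component = hom_space K V L, gbracket = derived_bracket L V\<rparr>"

text \<open>The action \<open>f \<mapsto> f \<circ> \<phi>\<^bsup>\<otimes>n\<^esup>\<close> on a morphism \<^term>\<open>\<phi>\<close> with source \<^term>\<open>W\<close>.\<close>

definition controlling_map ::
  "('k, 'g, 'w) repn \<Rightarrow> ('w \<Rightarrow> 'v) \<Rightarrow> nat \<Rightarrow> ('v list \<Rightarrow> 'a) \<Rightarrow> 'w list \<Rightarrow> 'a" where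
  "controlling_map W \<phi> n f = (\<lambda>ws\<in>tuples W n. f (map \<phi> ws))"

section \<open>Functors on symmetric representations\<close>

definition restrict_rep :: "('k, 'g, 'v) repn \<Rightarrow> ('k, 'g, 'v) repn" where
  "restrict_rep V =
     V\<lparr>lact := \<lambda>x. lact V (leib_incl x), ract := \<lambda>x v. \<ominus>\<^bsub>V\<^esub> lact V (leib_incl x) v\<rparr>"

text \<open>The common value of \<^term>\<open>lact V x v\<close> for all \<^term>\<open>x\<close> in the coset \<^term>\<open>C\<close>.\<close>

definition lie_act :: "('k, 'g, 'v) repn \<Rightarrow> 'g set \<Rightarrow> 'v \<Rightarrow> 'v" where
  "lie_act V C v = the_elem ((\<lambda>x. lact V x v) ` C)"

definition project_rep :: "('k, 'g, 'v) repn \<Rightarrow> ('k, 'g set, 'v) repn" where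
  "project_rep V =
     \<lparr>carrier = carrier V, monoid.mult = monoid.mult V, one = one V, zero = zero V, add = add V,
      smult = smult V, lact = lie_act V, ract = \<lambda>C v. \<ominus>\<^bsub>V\<^esub> lie_act V C v\<rparr>"

text \<open>
  Contravariant functors from the symmetric representations of \<^term>\<open>L\<close> with underlying type
  \<^typ>\<open>'v\<close> to graded Lie algebras. \<^term>\<open>Fm W V \<phi>\<close> is the image of the morphism \<open>\<phi> : W \<rightarrow> V\<close>.
\<close>

definition contravariant_functor ::
  "'k ring \<Rightarrow> ('k, 'g) leibniz \<Rightarrow> (('k, 'g, 'v) repn \<Rightarrow> ('k, 'a) graded_algebra) \<Rightarrow>
   (('k, 'g, 'v) repn \<Rightarrow> ('k, 'g, 'v) repn \<Rightarrow> ('v \<Rightarrow> 'v) \<Rightarrow> nat \<Rightarrow> 'a \<Rightarrow> 'a) \<Rightarrow> bool" where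
  "contravariant_functor K L F Fm \<longleftrightarrow>
     (\<forall>V. symmetric_rep K L V \<longrightarrow> graded_lie_algebra K (F V)) \<and>
     (\<forall>V W \<phi>. symmetric_rep K L V \<and> symmetric_rep K L W \<and> \<phi> \<in> rep_hom K L W V \<longrightarrow>
        Fm W V \<phi> \<in> graded_lie_hom K (F V) (F W)) \<and>
     (\<forall>V. symmetric_rep K L V \<longrightarrow>
        (\<forall>n\<ge>1. \<forall>f\<in>carrier (component (F V) n). Fm V V (\<lambda>v\<in>carrier V. v) n f = f)) \<and>
     (\<forall>U V W \<phi> \<psi>.
        symmetric_rep K L U \<and> symmetric_rep K L V \<and> symmetric_rep K L W \<and>
        \<psi> \<in> rep_hom K L U W \<and> \<phi> \<in> rep_hom K L W V \<longrightarrow>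
        (\<forall>n\<ge>1. \<forall>f\<in>carrier (component (F V) n).
           Fm U V (compose (carrier U) \<phi> \<psi>) n f = Fm U W \<psi> n (Fm W V \<phi> n f)))"

definition natural_transformation ::
  "'k ring \<Rightarrow> ('k, 'g) leibniz \<Rightarrow> (('k, 'g, 'v) repn \<Rightarrow> ('k, 'a) graded_algebra) \<Rightarrow>
   (('k, 'g, 'v) repn \<Rightarrow> ('k, 'g, 'v) repn \<Rightarrow> ('v \<Rightarrow> 'v) \<Rightarrow> nat \<Rightarrow> 'a \<Rightarrow> 'a) \<Rightarrow>
   (('k, 'g, 'v) repn \<Rightarrow> ('k, 'b) graded_algebra) \<Rightarrow>
   (('k, 'g, 'v) repn \<Rightarrow> ('k, 'g, 'v) repn \<Rightarrow> ('v \<Rightarrow> 'v) \<Rightarrow> nat \<Rightarrow> 'b \<Rightarrow> 'b) \<Rightarrow>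
   (('k, 'g, 'v) repn \<Rightarrow> nat \<Rightarrow> 'a \<Rightarrow> 'b) \<Rightarrow> bool" where
  "natural_transformation K L F Fm F' Fm' \<tau> \<longleftrightarrow>
     contravariant_functor K L F Fm \<and> contravariant_functor K L F' Fm' \<and>
     (\<forall>V. symmetric_rep K L V \<longrightarrow> \<tau> V \<in> graded_lie_hom K (F V) (F' V)) \<and>
     (\<forall>V W \<phi>. symmetric_rep K L V \<and> symmetric_rep K L W \<and> \<phi> \<in> rep_hom K L W V \<longrightarrow>
        (\<forall>n\<ge>1. \<forall>f\<in>carrier (component (F V) n).
           \<tau> W n (Fm W V \<phi> n f) = Fm' W V \<phi> n (\<tau> V n f)))"

text \<open>
  The restriction and projection functors are the identity on morphisms, so all three composite
  functors act on morphisms by \<^const>\<open>controlling_map\<close>.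
\<close>

definition C_leib_obj ::
  "'k ring \<Rightarrow> ('k, 'g) leibniz \<Rightarrow> ('k, 'g, 'v) repn \<Rightarrow> ('k, 'v list \<Rightarrow> 'g) graded_algebra" where
  "C_leib_obj K L V = controlling_algebra K (leib_sub K L) (restrict_rep V)"

definition C_leib_map ::
  "('k, 'g, 'v) repn \<Rightarrow> ('k, 'g, 'v) repn \<Rightarrow> ('v \<Rightarrow> 'v) \<Rightarrow> nat \<Rightarrow> ('v list \<Rightarrow> 'g) \<Rightarrow> 'v list \<Rightarrow> 'g" where
  "C_leib_map W V \<phi> = controlling_map (restrict_rep W) \<phi>"

definition C_map ::
  "('k, 'g, 'v) repn \<Rightarrow> ('k, 'g, 'v) repn \<Rightarrow> ('v \<Rightarrow> 'v) \<Rightarrow> nat \<Rightarrow> ('v list \<Rightarrow> 'g) \<Rightarrow> 'v list \<Rightarrow> 'g" where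
  "C_map W V \<phi> = controlling_map W \<phi>"

definition C_lie_obj ::
  "'k ring \<Rightarrow> ('k, 'g) leibniz \<Rightarrow> ('k, 'g, 'v) repn \<Rightarrow> ('k, 'v list \<Rightarrow> 'g set) graded_algebra" where
  "C_lie_obj K L V = controlling_algebra K (canonical_lie K L) (project_rep V)"

definition C_lie_map ::
  "('k, 'g, 'v) repn \<Rightarrow> ('k, 'g, 'v) repn \<Rightarrow> ('v \<Rightarrow> 'v) \<Rightarrow> nat \<Rightarrow>
   ('v list \<Rightarrow> 'g set) \<Rightarrow> 'v list \<Rightarrow> 'g set" where
  "C_lie_map W V \<phi> = controlling_map (project_rep W) \<phi>"

definition alpha :: "('k, 'g, 'v) repn \<Rightarrow> nat \<Rightarrow> ('v list \<Rightarrow> 'g) \<Rightarrow> 'v list \<Rightarrow> 'g" where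
  "alpha V n g = (\<lambda>vs\<in>tuples V n. leib_incl (g vs))"

definition beta ::
  "'k ring \<Rightarrow> ('k, 'g) leibniz \<Rightarrow> ('k, 'g, 'v) repn \<Rightarrow> nat \<Rightarrow> ('v list \<Rightarrow> 'g) \<Rightarrow> 'v list \<Rightarrow> 'g set" where
  "beta K L V n f = (\<lambda>vs\<in>tuples V n. lie_proj K L (f vs))"

end

theory Submission
  imports Defs
begin

text \<open>
  The sum of shuffles \<open>P \<circ> Q\<close> that defines the Balavoine bracket can be evaluated by reading the
  arguments from the left: each argument is either passed to \<open>P\<close>, with the sign \<open>(-1)\<^sup>q\<close>, or
  absorbed by \<open>Q\<close>, and the last absorbed argument completes \<open>Q\<close>. For this recursion an induction on
  the list of arguments shows that the associator \<open>(f \<circ> P) \<circ> Q - f \<circ> (P \<circ> Q)\<close> is graded symmetric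
  in \<open>P\<close> and \<open>Q\<close>, and the graded Jacobi identity of the Balavoine bracket follows.

  The representation axioms say that \<open>[\<mu>, \<mu>] = 0\<close> on \<open>L \<oplus> V\<close>, hence \<open>[\<mu>, -]\<close> is a derivation of
  square zero. Give \<open>L\<close> weight 0 and \<open>V\<close> weight 1: for weight reasons two extensions by zero have
  bracket zero, and \<open>[[\<mu>, g\<^sub>1], g\<^sub>2]\<close> is again an extension by zero. So the derived bracket makes
  \<open>C\<^sup>*(V, L)\<close> a graded Lie algebra.

  Everything is natural in the pair \<open>(L, V)\<close>, which makes \<open>\<alpha>\<close>, \<open>\<beta>\<close> and the action of morphisms
  compatible with the brackets. Exactness holds because \<open>pr\<close> has a linear section.
\<close>

section \<open>Shuffles\<close>

text \<open>The left-to-right reading works because of the factor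
  \<open>(- 1) ^ ((k - 1) * q)\<close>. If the least index goes to \<open>P\<close>, the sign of the
  shuffle does not change and the factor loses (-1)^q; if it goes to \<open>Q\<close>, bringing it
  to the front costs (-1)^(k-1), which is exactly the change of the factor. So each sign is settled
  when its argument is read and depends only on the number of slots of \<open>Q\<close> still open.
  Neither skew-symmetry nor Jacobi for the derived bracket is formal in the same way. Write d for
  [\<mu>, -]. Skew-symmetry comes from applying d to [g, h] = 0; Jacobi comes from d^2 = 0, which
  turns d[dg, h] into [dg, dh] up to sign. The Jacobi identity for \<mu>, \<mu> and x gives only 2
  d^2 x = 0, and this is where the characteristic enters. Surjectivity of \<beta> needs the section
  to be linear: preimages chosen value by value would not form a multilinear map.\<close>

text \<open>
  An \<open>(i, j)\<close>-shuffle \<open>\<sigma>\<close> has \<open>\<sigma> 1 = 1\<close> or \<open>\<sigma> (i + 1) = 1\<close>. The former are the lifts of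
  \<open>(i - 1, j)\<close>-shuffles, the latter the products \<open>lift_perm \<tau> \<circ> cycle_perm i\<close> with an
  \<open>(i, j - 1)\<close>-shuffle \<open>\<tau>\<close>.
\<close>

definition lift_perm :: "(nat \<Rightarrow> nat) \<Rightarrow> nat \<Rightarrow> nat" where
  "lift_perm \<sigma> n = (case n of 0 \<Rightarrow> 0 | Suc m \<Rightarrow> Suc (\<sigma> m))"

text \<open>Position \<open>i + 1\<close>, where the second block starts, goes to 1 and the first
  block moves up by one. The cycle is written as a product of \<open>i\<close> adjacent
  transpositions so that its sign follows by induction.\<close>

fun cycle_perm :: "nat \<Rightarrow> nat \<Rightarrow> nat" where
  "cycle_perm 0 = id"
| "cycle_perm (Suc i) = cycle_perm i \<circ> transpose (Suc i) (Suc (Suc i))"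

lemma lift_perm_simps [simp]: "lift_perm \<sigma> 0 = 0" "lift_perm \<sigma> (Suc m) = Suc (\<sigma> m)"
  by (simp_all add: lift_perm_def)

lemma inj_lift_perm: "inj lift_perm"
proof (rule injI)
  fix \<sigma> \<tau> assume eq: "lift_perm \<sigma> = lift_perm \<tau>"
  show "\<sigma> = \<tau>"
  proof
    fix n show "\<sigma> n = \<tau> n" using fun_cong[OF eq, of "Suc n"] by simp
  qed
qed

text \<open>The interval starts at 0 because \<open>\<sigma>\<close> fixes 0 and \<open>Suc\<close>
  maps \<open>{0..n}\<close> onto \<open>{1..Suc n}\<close>. In this form the lift is a conjugate,
  so its sign is known from \<open>sign_map_permutation\<close>.\<close>

lemma lift_perm_eq_map_permutation:
  assumes "\<sigma> permutes {1..n}"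
  shows "lift_perm \<sigma> = map_permutation {0..n} Suc \<sigma>"
proof
  fix m
  have p: "\<sigma> permutes {0..n}"
    by (rule permutes_subset[OF assms]) auto
  show "lift_perm \<sigma> m = map_permutation {0..n} Suc \<sigma> m"
  proof (cases m)
    case 0
    then show ?thesis by (auto simp: map_permutation_def restrict_id_def)
  next
    case (Suc k)
    then show ?thesis
      using p by (cases "k \<le> n") (auto simp: map_permutation_def restrict_id_def permutes_not_in)
  qed
qed

lemma permutes_lift_perm:
  assumes "\<sigma> permutes {1..n}"
  shows "lift_perm \<sigma> permutes {1..Suc n}"
proof (rule bij_imp_permutes)
  show "lift_perm \<sigma> x = x" if "x \<notin> {1..Suc n}" for x
  proof (cases x)
    case (Suc m)
    then show ?thesis using that permutes_not_in[OF assms, of m] by simp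
  qed simp
  have "inj_on (lift_perm \<sigma>) {1..Suc n}"
    by (rule inj_onI) (auto simp: lift_perm_def split: nat.splits dest: injD[OF permutes_inj[OF assms]])
  moreover have "lift_perm \<sigma> ` {1..Suc n} \<subseteq> {1..Suc n}"
  proof safe
    fix x assume "x \<in> {1..Suc n}"
    then obtain m where m: "x = Suc m" "m \<le> n" by (cases x) auto
    have "\<sigma> permutes {0..n}"
      by (rule permutes_subset[OF assms]) auto
    then have "\<sigma> m \<le> n" using permutes_in_image[of \<sigma> "{0..n}" m] m by auto
    then show "lift_perm \<sigma> x \<in> {1..Suc n}" using m by auto
  qed
  ultimately show "bij_betw (lift_perm \<sigma>) {1..Suc n} {1..Suc n}"
    by (simp add: bij_betw_def endo_inj_surj)
qed

lemma sign_lift_perm: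
  assumes "\<sigma> permutes {1..n}"
  shows "sign (lift_perm \<sigma>) = sign \<sigma>"
proof -
  have "\<sigma> permutes {0..n}"
    by (rule permutes_subset[OF assms]) auto
  then show ?thesis
    by (simp add: lift_perm_eq_map_permutation[OF assms] sign_map_permutation)
qed

lemma cycle_perm_apply:
  "cycle_perm i t = (if 1 \<le> t \<and> t \<le> i then Suc t else if t = Suc i then 1 else t)"
proof (induction i arbitrary: t)
  case (Suc i)
  then show ?case
    by (auto simp: transpose_def)
qed auto

lemma cycle_perm_permutes: "cycle_perm i permutes {1..Suc i}"
proof (induction i)
  case (Suc i)
  show ?case unfolding cycle_perm.simps
    by (rule permutes_compose[OF permutes_swap_id permutes_subset[OF Suc]]) auto
qed (simp only: cycle_perm.simps permutes_id)

lemma sign_cycle_perm: "sign (cycle_perm i) = (- 1) ^ i"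
proof (induction i)
  case (Suc i)
  have "permutation (cycle_perm i)"
    using cycle_perm_permutes[of i] by (auto simp: permutation_permutes)
  then show ?case
    unfolding cycle_perm.simps
    by (subst sign_compose) (simp_all add: Suc permutation_swap_id sign_swap_id)
qed (simp only: cycle_perm.simps sign_id power_0)

lemma finite_shuffle_perms: "finite (shuffle_perms i j)"
  unfolding shuffle_perms_def by (rule finite_subset[OF _ finite_permutations[of "{1..i+j}"]]) auto

lemma shuffle_perms_permutes: "\<sigma> \<in> shuffle_perms i j \<Longrightarrow> \<sigma> permutes {1..i + j}"
  by (simp add: shuffle_perms_def)

lemma shuffle_perms_0_0: "shuffle_perms 0 0 = {id}"
  by (auto simp: shuffle_perms_def)

text \<open>The truncated subtraction loses nothing: a permutation of \<open>{1..Suc n}\<close>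
  fixes 0, so its value at a successor is positive.\<close>

definition unlift_perm :: "(nat \<Rightarrow> nat) \<Rightarrow> nat \<Rightarrow> nat" where
  "unlift_perm \<sigma> n = \<sigma> (Suc n) - 1"

lemma permutes_unlift_perm:
  assumes "\<sigma> permutes {1..Suc n}" "\<sigma> 1 = 1"
  shows "unlift_perm \<sigma> permutes {1..n}" and "lift_perm (unlift_perm \<sigma>) = \<sigma>"
proof -
  have z: "\<sigma> 0 = 0"
    using permutes_not_in[OF assms(1), of 0] by simp
  have nz: "\<sigma> (Suc x) \<noteq> 0" for x
    using injD[OF permutes_inj[OF assms(1)], of "Suc x" 0] z by auto
  show eq: "lift_perm (unlift_perm \<sigma>) = \<sigma>"
  proof
    fix x
    show "lift_perm (unlift_perm \<sigma>) x = \<sigma> x"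
      using nz permutes_not_in[OF assms(1), of 0]
      by (cases x) (auto simp: unlift_perm_def Suc_diff_Suc)
  qed
  show "unlift_perm \<sigma> permutes {1..n}"
  proof (rule bij_imp_permutes)
    show "unlift_perm \<sigma> x = x" if "x \<notin> {1..n}" for x
      using that permutes_not_in[OF assms(1), of "Suc x"] assms(2)
      by (cases "x = 0") (auto simp: unlift_perm_def)
    have inj: "inj (unlift_perm \<sigma>)"
    proof (rule injI)
      fix x y assume "unlift_perm \<sigma> x = unlift_perm \<sigma> y"
      then have "\<sigma> (Suc x) = \<sigma> (Suc y)"
        using nz[of x] nz[of y] by (simp add: unlift_perm_def)
      then show "x = y" using permutes_inj[OF assms(1)] by (auto dest: injD)
    qed
    have "unlift_perm \<sigma> ` {1..n} \<subseteq> {1..n}"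
    proof safe
      fix x assume x: "x \<in> {1..n}"
      then have "\<sigma> (Suc x) \<in> {1..Suc n}"
        using permutes_in_image[OF assms(1), of "Suc x"] by auto
      moreover have "\<sigma> (Suc x) \<noteq> 1"
        using injD[OF permutes_inj[OF assms(1)], of "Suc x" 1] assms(2) x by auto
      ultimately show "unlift_perm \<sigma> x \<in> {1..n}"
        by (auto simp: unlift_perm_def)
    qed
    then show "bij_betw (unlift_perm \<sigma>) {1..n} {1..n}"
      using inj by (simp add: bij_betw_def endo_inj_surj inj_on_subset[OF _ subset_UNIV])
  qed
qed

lemma shuffle_perms_fst:
  "{\<sigma> \<in> shuffle_perms (Suc i) j. \<sigma> 1 = 1} = lift_perm ` shuffle_perms i j"
proof (intro equalityI subsetI)
  fix \<sigma> assume "\<sigma> \<in> {\<sigma> \<in> shuffle_perms (Suc i) j. \<sigma> 1 = 1}"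
  then have p: "\<sigma> permutes {1..Suc (i + j)}" "\<sigma> 1 = 1"
    and m1: "strict_mono_on {1..Suc i} \<sigma>" and m2: "strict_mono_on {Suc i + 1..Suc i + j} \<sigma>"
    by (auto simp: shuffle_perms_def)
  note u = permutes_unlift_perm[OF p]
  have l: "\<sigma> (Suc t) = Suc (unlift_perm \<sigma> t)" for t
    using fun_cong[OF u(2), of "Suc t"] by simp
  have "strict_mono_on {1..i} (unlift_perm \<sigma>)"
  proof (rule strict_mono_onI)
    fix r s assume "r \<in> {1..i}" "s \<in> {1..i}" "r < s"
    then have "\<sigma> (Suc r) < \<sigma> (Suc s)"
      using m1 by (intro strict_mono_onD[OF m1]) auto
    then show "unlift_perm \<sigma> r < unlift_perm \<sigma> s" by (simp add: l)
  qed
  moreover have "strict_mono_on {i + 1..i + j} (unlift_perm \<sigma>)"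
  proof (rule strict_mono_onI)
    fix r s assume "r \<in> {i + 1..i + j}" "s \<in> {i + 1..i + j}" "r < s"
    then have "\<sigma> (Suc r) < \<sigma> (Suc s)"
      by (intro strict_mono_onD[OF m2]) auto
    then show "unlift_perm \<sigma> r < unlift_perm \<sigma> s" by (simp add: l)
  qed
  ultimately show "\<sigma> \<in> lift_perm ` shuffle_perms i j"
    using u by (intro image_eqI[where x = "unlift_perm \<sigma>"]) (auto simp: shuffle_perms_def)
next
  fix \<sigma> assume "\<sigma> \<in> lift_perm ` shuffle_perms i j"
  then obtain \<tau> where \<tau>: "\<sigma> = lift_perm \<tau>" "\<tau> permutes {1..i + j}"
    "strict_mono_on {1..i} \<tau>" "strict_mono_on {i + 1..i + j} \<tau>"
    by (auto simp: shuffle_perms_def)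
  have z: "\<tau> 0 = 0" using permutes_not_in[OF \<tau>(2), of 0] by auto
  \<comment> \<open>Position 1 of the lift corresponds to \<open>r' = 0\<close>, outside the range
    on which \<open>\<tau>\<close> is known to increase. There it suffices that
    \<open>\<tau> 0 = 0\<close> and that all other values are positive.\<close>
  have pos: "\<tau> t > 0" if "t > 0" for t
    using z that injD[OF permutes_inj[OF \<tau>(2)], of t 0] by (cases "\<tau> t = 0") auto
  have "strict_mono_on {1..Suc i} \<sigma>"
  proof (rule strict_mono_onI)
    fix r s assume "r \<in> {1..Suc i}" "s \<in> {1..Suc i}" "r < s"
    then obtain r' s' where "r = Suc r'" "s = Suc s'" "r' < s'" "s' \<le> i"
      by (cases r; cases s) auto
    then show "\<sigma> r < \<sigma> s"
      using strict_mono_onD[OF \<tau>(3), of r' s'] pos[of s'] z by (cases "r' = 0") (auto simp: \<tau>(1))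
  qed
  moreover have "strict_mono_on {Suc i + 1..Suc i + j} \<sigma>"
  proof (rule strict_mono_onI)
    fix r s assume "r \<in> {Suc i + 1..Suc i + j}" "s \<in> {Suc i + 1..Suc i + j}" "r < s"
    then obtain r' s' where "r = Suc r'" "s = Suc s'" "r' < s'" "i + 1 \<le> r'" "s' \<le> i + j"
      by (cases r; cases s) auto
    then show "\<sigma> r < \<sigma> s"
      using strict_mono_onD[OF \<tau>(4), of r' s'] by (auto simp: \<tau>(1))
  qed
  ultimately show "\<sigma> \<in> {\<sigma> \<in> shuffle_perms (Suc i) j. \<sigma> 1 = 1}"
    using permutes_lift_perm[OF \<tau>(2)] z by (auto simp: shuffle_perms_def \<tau>(1))
qed

text \<open>Undoing the cycle moves the value 1 from position \<open>i + 1\<close> to position 1 and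
  keeps the order inside both blocks. This reduces the claim to permutations that fix 1, which are
  lifts.\<close>

lemma shuffle_perms_snd:
  "{\<sigma> \<in> shuffle_perms i (Suc j). \<sigma> (Suc i) = 1} =
     (\<lambda>\<tau>. lift_perm \<tau> \<circ> cycle_perm i) ` shuffle_perms i j"
proof (intro equalityI subsetI)
  fix \<sigma> assume "\<sigma> \<in> {\<sigma> \<in> shuffle_perms i (Suc j). \<sigma> (Suc i) = 1}"
  then have p: "\<sigma> permutes {1..Suc (i + j)}" and s1: "\<sigma> (Suc i) = 1"
    and m1: "strict_mono_on {1..i} \<sigma>" and m2: "strict_mono_on {i + 1..i + Suc j} \<sigma>"
    by (auto simp: shuffle_perms_def)
  have c: "cycle_perm i permutes {1..Suc (i + j)}"
    by (rule permutes_subset[OF cycle_perm_permutes]) auto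
  define \<rho> where "\<rho> = \<sigma> \<circ> inv_into UNIV (cycle_perm i)"
  have \<rho>: "\<rho> \<circ> cycle_perm i = \<sigma>"
    using permutes_inj[OF c] by (simp add: \<rho>_def o_assoc[symmetric])
  have p': "\<rho> permutes {1..Suc (i + j)}"
    unfolding \<rho>_def by (rule permutes_compose[OF permutes_inv[OF c] p])
  have r: "\<rho> (cycle_perm i t) = \<sigma> t" for t
    using fun_cong[OF \<rho>, of t] by simp
  have r1: "\<rho> 1 = 1"
    using r[of "Suc i"] s1 by (simp add: cycle_perm_apply)
  note u = permutes_unlift_perm[OF p' r1]
  have l: "\<rho> (Suc t) = Suc (unlift_perm \<rho> t)" for t
    using fun_cong[OF u(2), of "Suc t"] by simp
  have "strict_mono_on {1..i} (unlift_perm \<rho>)"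
  proof (rule strict_mono_onI)
    fix a b assume "a \<in> {1..i}" "b \<in> {1..i}" "a < b"
    then show "unlift_perm \<rho> a < unlift_perm \<rho> b"
      using strict_mono_onD[OF m1, of a b] r[of a] r[of b] by (simp add: l cycle_perm_apply)
  qed
  moreover have "strict_mono_on {i + 1..i + j} (unlift_perm \<rho>)"
  proof (rule strict_mono_onI)
    fix a b assume "a \<in> {i + 1..i + j}" "b \<in> {i + 1..i + j}" "a < b"
    then show "unlift_perm \<rho> a < unlift_perm \<rho> b"
      using strict_mono_onD[OF m2, of "Suc a" "Suc b"] r[of "Suc a"] r[of "Suc b"]
      by (simp add: l cycle_perm_apply)
  qed
  ultimately show "\<sigma> \<in> (\<lambda>\<tau>. lift_perm \<tau> \<circ> cycle_perm i) ` shuffle_perms i j"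
    using u \<rho> by (intro image_eqI[where x = "unlift_perm \<rho>"]) (auto simp: shuffle_perms_def)
next
  fix \<sigma> assume "\<sigma> \<in> (\<lambda>\<tau>. lift_perm \<tau> \<circ> cycle_perm i) ` shuffle_perms i j"
  then obtain \<tau> where \<tau>: "\<sigma> = lift_perm \<tau> \<circ> cycle_perm i" "\<tau> permutes {1..i + j}"
    "strict_mono_on {1..i} \<tau>" "strict_mono_on {i + 1..i + j} \<tau>"
    by (auto simp: shuffle_perms_def)
  have c: "cycle_perm i permutes {1..i + Suc j}"
    by (rule permutes_subset[OF cycle_perm_permutes]) auto
  have z: "\<tau> 0 = 0" using permutes_not_in[OF \<tau>(2), of 0] by auto
  have pos: "\<tau> t > 0" if "t > 0" for t
    using z that injD[OF permutes_inj[OF \<tau>(2)], of t 0] by (cases "\<tau> t = 0") auto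
  have "strict_mono_on {1..i} \<sigma>"
  proof (rule strict_mono_onI)
    fix a b assume "a \<in> {1..i}" "b \<in> {1..i}" "a < b"
    then show "\<sigma> a < \<sigma> b"
      using strict_mono_onD[OF \<tau>(3), of a b] by (simp add: \<tau>(1) cycle_perm_apply)
  qed
  moreover have "strict_mono_on {i + 1..i + Suc j} \<sigma>"
  proof (rule strict_mono_onI)
    fix a b assume ab: "a \<in> {i + 1..i + Suc j}" "b \<in> {i + 1..i + Suc j}" "a < b"
    then obtain b' where b': "b = Suc b'" by (cases b) auto
    show "\<sigma> a < \<sigma> b"
    proof (cases "a = Suc i")
      case True
      then show ?thesis
        using ab b' z pos[of b'] by (auto simp: \<tau>(1) cycle_perm_apply lift_perm_def)
    next
      case False
      then obtain a' where "a = Suc a'" "i + 1 \<le> a'"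
        using ab by (cases a) auto
      then show ?thesis
        using ab b' strict_mono_onD[OF \<tau>(4), of a' b'] by (auto simp: \<tau>(1) cycle_perm_apply)
    qed
  qed
  moreover have "\<sigma> permutes {1..i + Suc j}"
    unfolding \<tau>(1) using permutes_lift_perm[OF \<tau>(2)] by (intro permutes_compose[OF c]) simp
  moreover have "\<sigma> (Suc i) = 1"
    by (simp add: \<tau>(1) z cycle_perm_apply)
  ultimately show "\<sigma> \<in> {\<sigma> \<in> shuffle_perms i (Suc j). \<sigma> (Suc i) = 1}"
    by (auto simp: shuffle_perms_def)
qed

text \<open>The value 1 is attained somewhere, and since \<open>\<sigma>\<close> increases on each
  block it can only be attained at the start of a block.\<close>

lemma shuffle_perms_hit_one:
  assumes "\<sigma> \<in> shuffle_perms i j" "i + j > 0"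
  shows "(i > 0 \<and> \<sigma> 1 = 1) \<or> (j > 0 \<and> \<sigma> (Suc i) = 1)"
proof -
  from assms(1) have p: "\<sigma> permutes {1..i + j}" and m1: "strict_mono_on {1..i} \<sigma>"
    and m2: "strict_mono_on {i + 1..i + j} \<sigma>"
    by (auto simp: shuffle_perms_def)
  have "1 \<in> \<sigma> ` {1..i + j}"
    unfolding permutes_image[OF p] using assms(2) by (cases i) auto
  then obtain t where t: "\<sigma> t = 1" "1 \<le> t" "t \<le> i + j" by auto
  have ge: "1 \<le> \<sigma> s" if "s \<in> {1..i + j}" for s
    using permutes_in_image[OF p, of s] that by auto
  show ?thesis
  proof (cases "t \<le> i")
    case True
    have "t = 1"
    proof (rule ccontr)
      assume "t \<noteq> 1"
      then have "\<sigma> 1 < \<sigma> t" using t True by (intro strict_mono_onD[OF m1]) auto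
      then show False using ge[of 1] t by auto
    qed
    then show ?thesis using t True by auto
  next
    case False
    have "t = Suc i"
    proof (rule ccontr)
      assume "t \<noteq> Suc i"
      then have "\<sigma> (Suc i) < \<sigma> t" using t False by (intro strict_mono_onD[OF m2]) auto
      then show False using ge[of "Suc i"] t False by auto
    qed
    then show ?thesis using t False by auto
  qed
qed

section \<open>Signs in abelian groups and signed sums over shuffles\<close>

definition signed :: "('a, 'b) ring_scheme \<Rightarrow> nat \<Rightarrow> 'a \<Rightarrow> 'a" where
  "signed G n x = (if even n then x else \<ominus>\<^bsub>G\<^esub> x)"

context abelian_group
begin

lemma signed_closed [simp, intro]: "x \<in> carrier G \<Longrightarrow> signed G n x \<in> carrier G"
  by (simp add: signed_def)

lemma minus_zero_group [simp]: "\<ominus> \<zero> = \<zero>"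
  using r_neg[of \<zero>] by (simp add: l_zero)

lemma signed_zero [simp]: "signed G n \<zero> = \<zero>"
  by (simp add: signed_def)

lemma signed_0 [simp]: "signed G 0 x = x"
  by (simp add: signed_def)

lemma signed_add: "x \<in> carrier G \<Longrightarrow> y \<in> carrier G \<Longrightarrow> signed G n (x \<oplus> y) = signed G n x \<oplus> signed G n y"
  by (simp add: signed_def minus_add)

lemma signed_signed: "x \<in> carrier G \<Longrightarrow> signed G m (signed G n x) = signed G (m + n) x"
  by (auto simp: signed_def)

lemma signed_minus: "x \<in> carrier G \<Longrightarrow> signed G n (\<ominus> x) = \<ominus> (signed G n x)"
  by (auto simp: signed_def)

lemma add_pow_1: "x \<in> carrier G \<Longrightarrow> [(1::int)] \<cdot> x = x"
  by (simp add: add_pow_int_ge)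

lemma add_pow_minus_1: "x \<in> carrier G \<Longrightarrow> [(- 1::int)] \<cdot> x = \<ominus> x"
  by (simp add: add_pow_int_lt)

text \<open>Replaces the integer multiples of the definitions by \<open>signed\<close>, so that sign
  computations become case distinctions on parities and need no scalars.\<close>

lemma add_pow_signed: "x \<in> carrier G \<Longrightarrow> [((- 1 :: int) ^ n)] \<cdot> x = signed G n x"
  by (cases "even n") (simp_all add: signed_def add_pow_1 add_pow_minus_1)

lemma add_pow_signed_sign:
  "x \<in> carrier G \<Longrightarrow> [((- 1 :: int) ^ n * sign \<sigma>)] \<cdot> x = signed G n ([(sign \<sigma>)] \<cdot> x)"
  by (cases \<sigma> rule: sign_cases; cases "even n")
     (simp_all add: signed_def add_pow_1 add_pow_minus_1)

lemma finsum_signed: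
  assumes "f \<in> A \<rightarrow> carrier G"
  shows "(\<Oplus>x\<in>A. signed G n (f x)) = signed G n (finsum G f A)"
proof (cases "finite A")
  case True
  then show ?thesis using assms
    by (induction A) (auto simp: signed_add Pi_def finsum_insert)
next
  case False
  then show ?thesis by (simp add: finsum_infinite)
qed

text \<open>The sum in \<open>insertion\<close> with \<open>i = k - 1\<close> and
  \<open>j = q\<close>. The summand is an arbitrary function \<open>h\<close> of the values of
  \<open>\<sigma>\<close> on the two blocks, so that the recursion on shuffles can absorb an index
  by changing \<open>h\<close>.\<close>

definition shuffle_sum :: "nat \<Rightarrow> nat \<Rightarrow> (nat list \<Rightarrow> nat list \<Rightarrow> 'a) \<Rightarrow> 'a" where
  "shuffle_sum i j h = (\<Oplus>\<sigma>\<in>shuffle_perms i j.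
     [((- 1) ^ (i * j) * sign \<sigma>)] \<cdot> h (map \<sigma> [1..<Suc i]) (map \<sigma> [Suc i..<Suc (i + j)]))"

text \<open>Records of the two value lists of a shuffle just what closure and congruence arguments
  use: lengths and ranges.\<close>

definition index_blocks :: "nat \<Rightarrow> nat \<Rightarrow> (nat list \<times> nat list) set" where
  "index_blocks i j = {(a, b). length a = i \<and> length b = j \<and> set a \<union> set b \<subseteq> {1..i + j}}"

lemma shuffle_index_blocks:
  assumes "\<sigma> \<in> shuffle_perms i j"
  shows "(map \<sigma> [1..<Suc i], map \<sigma> [Suc i..<Suc (i + j)]) \<in> index_blocks i j"
proof -
  have "\<sigma> t \<in> {1..i + j}" if "t \<in> {1..i + j}" for t
    using permutes_in_image[OF shuffle_perms_permutes[OF assms], of t] that by auto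
  then show ?thesis by (force simp: index_blocks_def)
qed

lemma shuffle_sum_cong:
  assumes "\<And>a b. (a, b) \<in> index_blocks i j \<Longrightarrow> h a b = h' a b"
    and "\<And>a b. (a, b) \<in> index_blocks i j \<Longrightarrow> h a b \<in> carrier G"
  shows "shuffle_sum i j h = shuffle_sum i j h'"
  unfolding shuffle_sum_def
  by (rule finsum_cong') (use assms shuffle_index_blocks in \<open>auto simp: Pi_def\<close>)

lemma shuffle_sum_closed:
  assumes "\<And>a b. (a, b) \<in> index_blocks i j \<Longrightarrow> h a b \<in> carrier G"
  shows "shuffle_sum i j h \<in> carrier G"
  unfolding shuffle_sum_def
  by (rule finsum_closed) (use assms shuffle_index_blocks in \<open>auto simp: Pi_def\<close>)

lemma shuffle_sum_0_0: "h [] [] \<in> carrier G \<Longrightarrow> shuffle_sum 0 0 h = h [] []"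
  by (simp add: shuffle_sum_def shuffle_perms_0_0 finsum_insert add_pow_1)

lemma upt_Suc_map: "[Suc a..<Suc b] = map Suc [a..<b]"
  by (simp add: map_Suc_upt)

text \<open>Lifting a shuffle keeps its sign, while the exponent grows from \<open>i * j\<close> to
  \<open>Suc i * j\<close>. The difference \<open>j\<close> is the sign for passing the first
  argument to \<open>P\<close>.\<close>

lemma finsum_shuffles_fst:
  assumes "\<And>a b. (a, b) \<in> index_blocks (Suc i) j \<Longrightarrow> h a b \<in> carrier G"
  shows "(\<Oplus>\<sigma>\<in>{\<sigma> \<in> shuffle_perms (Suc i) j. \<sigma> 1 = 1}.
     [((- 1) ^ (Suc i * j) * sign \<sigma>)] \<cdot> h (map \<sigma> [1..<Suc (Suc i)]) (map \<sigma> [Suc (Suc i)..<Suc (Suc i + j)]))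
   = signed G j (shuffle_sum i j (\<lambda>a b. h (1 # map Suc a) (map Suc b)))"
    (is "finsum G ?F ?A = _")
proof -
  have F: "?F \<sigma> \<in> carrier G" if "\<sigma> \<in> ?A" for \<sigma>
    using assms[OF shuffle_index_blocks] that by auto
  have hc: "h (1 # map Suc (map \<tau> [1..<Suc i])) (map Suc (map \<tau> [Suc i..<Suc (i + j)])) \<in> carrier G"
    if "\<tau> \<in> shuffle_perms i j" for \<tau>
    using shuffle_index_blocks[OF that]
    by (intro assms) (force simp: index_blocks_def simp del: upt_Suc)
  have "finsum G ?F ?A = (\<Oplus>\<tau>\<in>shuffle_perms i j. ?F (lift_perm \<tau>))"
    unfolding shuffle_perms_fst using F[unfolded shuffle_perms_fst]
    by (intro finsum_reindex) (auto simp: Pi_def intro: inj_on_subset[OF inj_lift_perm])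
  also have "\<dots> = (\<Oplus>\<tau>\<in>shuffle_perms i j. signed G j
      ([((- 1) ^ (i * j) * sign \<tau>)] \<cdot> h (1 # map Suc (map \<tau> [1..<Suc i])) (map Suc (map \<tau> [Suc i..<Suc (i + j)]))))"
  proof (rule finsum_cong')
    fix \<tau> assume \<tau>: "\<tau> \<in> shuffle_perms i j"
    note p = shuffle_perms_permutes[OF \<tau>]
    have z: "\<tau> 0 = 0"
      using permutes_not_in[OF p, of 0] by simp
    have 1: "map (lift_perm \<tau>) [1..<Suc (Suc i)] = 1 # map Suc (map \<tau> [1..<Suc i])"
    proof -
      have "[1..<Suc (Suc i)] = 1 # map Suc [1..<Suc i]"
        by (simp only: map_Suc_upt) (simp add: upt_conv_Cons)
      then show ?thesis by (simp add: z del: upt_Suc)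
    qed
    have 2: "map (lift_perm \<tau>) [Suc (Suc i)..<Suc (Suc i + j)] = map Suc (map \<tau> [Suc i..<Suc (i + j)])"
      by (simp only: add_Suc upt_Suc_map[of "Suc i"] map_map) (simp del: upt_Suc)
    have "j + i * j = Suc i * j" by simp
    then show "?F (lift_perm \<tau>) = signed G j
      ([((- 1) ^ (i * j) * sign \<tau>)] \<cdot> h (1 # map Suc (map \<tau> [1..<Suc i])) (map Suc (map \<tau> [Suc i..<Suc (i + j)])))"
      unfolding 1 2 sign_lift_perm[OF p]
      by (simp only: add_pow_signed_sign[OF hc[OF \<tau>]] signed_signed[OF add.int_pow_closed[OF hc[OF \<tau>]]] \<open>j + i * j = Suc i * j\<close>)
  qed (use hc in auto)
  also have "\<dots> = signed G j (shuffle_sum i j (\<lambda>a b. h (1 # map Suc a) (map Suc b)))"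
    unfolding shuffle_sum_def
  proof (rule finsum_signed, rule Pi_I)
    fix \<tau> assume "\<tau> \<in> shuffle_perms i j"
    from hc[OF this] show "[((- 1) ^ (i * j) * sign \<tau>)] \<cdot>
        h (1 # map Suc (map \<tau> [1..<Suc i])) (map Suc (map \<tau> [Suc i..<Suc (i + j)])) \<in> carrier G"
      by simp
  qed
  finally show ?thesis .
qed

text \<open>No sign appears on the right: the cycle contributes (-1)^i, and so does the change of
  the exponent from \<open>i * Suc j\<close> to \<open>i * j\<close>.\<close>

lemma finsum_shuffles_snd:
  assumes "\<And>a b. (a, b) \<in> index_blocks i (Suc j) \<Longrightarrow> h a b \<in> carrier G"
  shows "(\<Oplus>\<sigma>\<in>{\<sigma> \<in> shuffle_perms i (Suc j). \<sigma> (Suc i) = 1}.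
     [((- 1) ^ (i * Suc j) * sign \<sigma>)] \<cdot> h (map \<sigma> [1..<Suc i]) (map \<sigma> [Suc i..<Suc (i + Suc j)]))
   = shuffle_sum i j (\<lambda>a b. h (map Suc a) (1 # map Suc b))"
    (is "finsum G ?F ?A = _")
proof -
  let ?L = "\<lambda>\<tau>. lift_perm \<tau> \<circ> cycle_perm i"
  have F: "?F \<sigma> \<in> carrier G" if "\<sigma> \<in> ?A" for \<sigma>
    using assms[OF shuffle_index_blocks] that by auto
  have surj: "surj (cycle_perm i)"
    using permutes_surj[OF cycle_perm_permutes] .
  have inj: "inj ?L"
  proof (rule injI)
    fix \<sigma> \<tau> assume eq: "?L \<sigma> = ?L \<tau>"
    have "lift_perm \<sigma> = lift_perm \<tau>"
    proof
      fix x
      obtain y where "x = cycle_perm i y" using surj by (rule surjE)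
      then show "lift_perm \<sigma> x = lift_perm \<tau> x" using fun_cong[OF eq, of y] by simp
    qed
    then show "\<sigma> = \<tau>" using inj_lift_perm by (auto dest: injD)
  qed
  have hc: "h (map Suc (map \<tau> [1..<Suc i])) (1 # map Suc (map \<tau> [Suc i..<Suc (i + j)])) \<in> carrier G"
    if "\<tau> \<in> shuffle_perms i j" for \<tau>
    using shuffle_index_blocks[OF that]
    by (intro assms) (force simp: index_blocks_def simp del: upt_Suc)
  have "finsum G ?F ?A = (\<Oplus>\<tau>\<in>shuffle_perms i j. ?F (?L \<tau>))"
    unfolding shuffle_perms_snd using F[unfolded shuffle_perms_snd]
    by (intro finsum_reindex) (auto simp: Pi_def simp del: o_apply intro: inj_on_subset[OF inj])
  also have "\<dots> = (\<Oplus>\<tau>\<in>shuffle_perms i j.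
      ([((- 1) ^ (i * j) * sign \<tau>)] \<cdot> h (map Suc (map \<tau> [1..<Suc i])) (1 # map Suc (map \<tau> [Suc i..<Suc (i + j)]))))"
  proof (rule finsum_cong')
    fix \<tau> assume \<tau>: "\<tau> \<in> shuffle_perms i j"
    note p = shuffle_perms_permutes[OF \<tau>]
    have z: "\<tau> 0 = 0"
      using permutes_not_in[OF p, of 0] by simp
    have 1: "map (?L \<tau>) [1..<Suc i] = map Suc (map \<tau> [1..<Suc i])"
      by (simp add: cycle_perm_apply del: upt_Suc)
    have 2: "map (?L \<tau>) [Suc i..<Suc (i + Suc j)] = 1 # map Suc (map \<tau> [Suc i..<Suc (i + j)])"
    proof -
      have "[Suc i..<Suc (i + Suc j)] = Suc i # map Suc [Suc i..<Suc (i + j)]"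
        by (simp only: map_Suc_upt) (simp add: upt_conv_Cons)
      then show ?thesis by (simp add: z cycle_perm_apply del: upt_Suc)
    qed
    have "permutation (lift_perm \<tau>)" "permutation (cycle_perm i)"
      using permutes_lift_perm[OF p] cycle_perm_permutes[of i] by (auto simp: permutation_permutes)
    then have s: "sign (?L \<tau>) = (- 1) ^ i * sign \<tau>"
      by (simp add: sign_compose sign_lift_perm[OF p] sign_cycle_perm del: o_apply)
    have e: "(- 1 :: int) ^ (i * Suc j) * ((- 1) ^ i * sign \<tau>) = (- 1) ^ (i * j) * sign \<tau>"
      by (cases "even i"; cases "even j") (auto simp: power_add)
    then show "?F (?L \<tau>) = [((- 1) ^ (i * j) * sign \<tau>)] \<cdot>
        h (map Suc (map \<tau> [1..<Suc i])) (1 # map Suc (map \<tau> [Suc i..<Suc (i + j)]))"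
      unfolding 1 2 s by (simp only: e)
  qed (use hc in auto)
  finally show ?thesis unfolding shuffle_sum_def .
qed

lemma finsum_split:
  assumes "finite A" "A = B \<union> C" "B \<inter> C = {}" "f \<in> A \<rightarrow> carrier G"
  shows "finsum G f A = finsum G f B \<oplus> finsum G f C"
  using assms by (auto simp: Pi_def intro!: finsum_Un_disjoint)

lemma shuffle_sum_Suc_0:
  assumes "\<And>a b. (a, b) \<in> index_blocks (Suc i) 0 \<Longrightarrow> h a b \<in> carrier G"
  shows "shuffle_sum (Suc i) 0 h = shuffle_sum i 0 (\<lambda>a b. h (1 # map Suc a) (map Suc b))"
proof -
  have eq: "shuffle_perms (Suc i) 0 = {\<sigma> \<in> shuffle_perms (Suc i) 0. \<sigma> 1 = 1}"
    using shuffle_perms_hit_one[of _ "Suc i" 0] by auto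
  then show ?thesis
    using finsum_shuffles_fst[where h = h and i = i and j = 0, OF assms, folded eq]
    unfolding shuffle_sum_def[of "Suc i"] by (simp del: upt_Suc)
qed

lemma shuffle_sum_0_Suc:
  assumes "\<And>a b. (a, b) \<in> index_blocks 0 (Suc j) \<Longrightarrow> h a b \<in> carrier G"
  shows "shuffle_sum 0 (Suc j) h = shuffle_sum 0 j (\<lambda>a b. h (map Suc a) (1 # map Suc b))"
proof -
  have eq: "shuffle_perms 0 (Suc j) = {\<sigma> \<in> shuffle_perms 0 (Suc j). \<sigma> (Suc 0) = 1}"
    using shuffle_perms_hit_one[of _ 0 "Suc j"] by auto
  then show ?thesis
    using finsum_shuffles_snd[where h = h and i = 0 and j = j, OF assms, folded eq]
    unfolding shuffle_sum_def[of 0 "Suc j"] by (simp del: upt_Suc)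
qed

text \<open>A Pascal-type recursion: the shuffles are split by the block that contains the value 1,
  and injectivity makes the two classes disjoint.\<close>

lemma shuffle_sum_Suc_Suc:
  assumes "\<And>a b. (a, b) \<in> index_blocks (Suc i) (Suc j) \<Longrightarrow> h a b \<in> carrier G"
  shows "shuffle_sum (Suc i) (Suc j) h =
    signed G (Suc j) (shuffle_sum i (Suc j) (\<lambda>a b. h (1 # map Suc a) (map Suc b))) \<oplus>
    shuffle_sum (Suc i) j (\<lambda>a b. h (map Suc a) (1 # map Suc b))"
proof -
  let ?F = "\<lambda>\<sigma>. [((- 1) ^ (Suc i * Suc j) * sign \<sigma>)] \<cdot>
    h (map \<sigma> [1..<Suc (Suc i)]) (map \<sigma> [Suc (Suc i)..<Suc (Suc i + Suc j)])"
  have "shuffle_sum (Suc i) (Suc j) h =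
      finsum G ?F {\<sigma> \<in> shuffle_perms (Suc i) (Suc j). \<sigma> 1 = 1} \<oplus>
      finsum G ?F {\<sigma> \<in> shuffle_perms (Suc i) (Suc j). \<sigma> (Suc (Suc i)) = 1}"
    unfolding shuffle_sum_def
  proof (rule finsum_split)
  show "shuffle_perms (Suc i) (Suc j) = {\<sigma> \<in> shuffle_perms (Suc i) (Suc j). \<sigma> 1 = 1} \<union>
      {\<sigma> \<in> shuffle_perms (Suc i) (Suc j). \<sigma> (Suc (Suc i)) = 1}"
    using shuffle_perms_hit_one[of _ "Suc i" "Suc j"] by auto
  show "{\<sigma> \<in> shuffle_perms (Suc i) (Suc j). \<sigma> 1 = 1} \<inter>
      {\<sigma> \<in> shuffle_perms (Suc i) (Suc j). \<sigma> (Suc (Suc i)) = 1} = {}"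
  proof -
    have "\<sigma> (Suc (Suc i)) \<noteq> 1" if "\<sigma> \<in> shuffle_perms (Suc i) (Suc j)" "\<sigma> 1 = 1" for \<sigma>
      using injD[OF permutes_inj[OF shuffle_perms_permutes[OF that(1)]], of "Suc (Suc i)" 1] that by auto
    then show ?thesis by blast
  qed
  qed (use assms[OF shuffle_index_blocks] in \<open>auto simp: finite_shuffle_perms simp del: upt_Suc\<close>)
  then show ?thesis
    by (simp only: finsum_shuffles_fst[where h = h and i = i and j = "Suc j", OF assms]
        finsum_shuffles_snd[where h = h and i = "Suc i" and j = j, OF assms])
qed

end

section \<open>Multilinear maps and insertion\<close>

lemma tuples_0 [simp]: "tuples V 0 = {[]}"
  by (auto simp: tuples_def)

lemma Cons_in_tuples [simp]: "x # xs \<in> tuples V n \<longleftrightarrow> x \<in> carrier V \<and> (\<exists>m. n = Suc m \<and> xs \<in> tuples V m)"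
  by (cases n) (auto simp: tuples_def)

lemma Nil_in_tuples [simp]: "[] \<in> tuples V n \<longleftrightarrow> n = 0"
  by (auto simp: tuples_def)

lemma tuples_Suc_cases:
  assumes "xs \<in> tuples V (Suc n)"
  obtains x ys where "xs = x # ys" "x \<in> carrier V" "ys \<in> tuples V n"
  using assms by (cases xs) auto

lemma length_tuples: "xs \<in> tuples V n \<Longrightarrow> length xs = n"
  by (simp add: tuples_def)

text \<open>Drops the extensionality of \<open>multilinear_maps\<close>, which intermediate
  functions such as \<open>ins E q f Q\<close> need not have.\<close>

definition multilinear ::
  "('k, 'r) ring_scheme \<Rightarrow> ('k, 'v, 'x) module_scheme \<Rightarrow> ('k, 'w, 'y) module_scheme \<Rightarrow> nat \<Rightarrow>
   ('v list \<Rightarrow> 'w) \<Rightarrow> bool" where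
  "multilinear K V W n f \<longleftrightarrow>
     (\<forall>xs\<in>tuples V n. f xs \<in> carrier W) \<and>
     (\<forall>xs\<in>tuples V n. \<forall>i<n. (\<lambda>v. f (xs[i := v])) \<in> module_hom K V W)"

lemma multilinear_maps_iff:
  "f \<in> multilinear_maps K V W n \<longleftrightarrow> multilinear K V W n f \<and> f \<in> extensional (tuples V n)"
  by (auto simp: multilinear_maps_def multilinear_def PiE_def)

lemma multilinear_closed: "multilinear K V W n f \<Longrightarrow> xs \<in> tuples V n \<Longrightarrow> f xs \<in> carrier W"
  by (simp add: multilinear_def)

lemma multilinear_0: "multilinear K V W 0 f \<longleftrightarrow> f [] \<in> carrier W"
  by (simp add: multilinear_def)

lemma module_hom_cong:
  assumes "\<And>x. x \<in> carrier M \<Longrightarrow> f x = g x" "module R M"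
  shows "f \<in> module_hom R M N \<longleftrightarrow> g \<in> module_hom R M N"
proof -
  interpret module R M by fact
  show ?thesis using assms(1) by (auto simp: module_hom_def Pi_def)
qed

text \<open>The inductive form of multilinearity. It matches \<open>ins\<close>, which takes its
  arguments from the front of the list.\<close>

lemma multilinear_Suc:
  "multilinear K V W (Suc n) f \<longleftrightarrow>
     (\<forall>x\<in>carrier V. multilinear K V W n (\<lambda>xs. f (x # xs))) \<and>
     (\<forall>xs\<in>tuples V n. (\<lambda>x. f (x # xs)) \<in> module_hom K V W)" (is "?L \<longleftrightarrow> ?R")
proof
  assume L: ?L
  have "multilinear K V W n (\<lambda>xs. f (x # xs))" if x: "x \<in> carrier V" for x
  proof -
    have "(\<lambda>v. f (x # xs[i := v])) \<in> module_hom K V W" if "xs \<in> tuples V n" "i < n" for xs i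
    proof -
      have "x # xs \<in> tuples V (Suc n)" "Suc i < Suc n" using that x by auto
      then have "(\<lambda>v. f ((x # xs)[Suc i := v])) \<in> module_hom K V W"
        using L by (simp only: multilinear_def)
      then show ?thesis by simp
    qed
    moreover have "f (x # xs) \<in> carrier W" if "xs \<in> tuples V n" for xs
      using L that x by (auto simp: multilinear_def)
    ultimately show ?thesis by (auto simp: multilinear_def)
  qed
  moreover have "(\<lambda>x. f (x # xs)) \<in> module_hom K V W" if xs: "xs \<in> tuples V n" for xs
  \<comment> \<open>\<open>V\<close> is not assumed to be a module here, so its carrier may be
    empty. Otherwise any element serves as a placeholder at index 0, which the list update then
    overwrites.\<close>
  proof (cases "carrier V = {}")
    case True
    then show ?thesis by (auto simp: module_hom_def)
  next
    case False
    then obtain x where "x \<in> carrier V" by auto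
    then have "x # xs \<in> tuples V (Suc n)" "0 < Suc n" using xs by auto
    then have "(\<lambda>v. f ((x # xs)[0 := v])) \<in> module_hom K V W"
      using L by (simp only: multilinear_def)
    then show ?thesis by simp
  qed
  ultimately show ?R by blast
next
  assume R: ?R
  show ?L unfolding multilinear_def
  proof (intro conjI ballI allI impI)
    fix xs assume "xs \<in> tuples V (Suc n)"
    then obtain x ys where x: "xs = x # ys" "x \<in> carrier V" "ys \<in> tuples V n"
      by (rule tuples_Suc_cases)
    then show "f xs \<in> carrier W" using R by (auto simp: multilinear_def)
    fix i assume "i < Suc n"
    then show "(\<lambda>v. f (xs[i := v])) \<in> module_hom K V W"
      using R x by (cases i) (auto simp: multilinear_def)
  qed
qed

lemma multilinear_Cons: "multilinear K V W (Suc n) f \<Longrightarrow> x \<in> carrier V \<Longrightarrow> multilinear K V W n (\<lambda>xs. f (x # xs))"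
  by (simp add: multilinear_Suc)

lemma multilinear_head: "multilinear K V W (Suc n) f \<Longrightarrow> xs \<in> tuples V n \<Longrightarrow> (\<lambda>x. f (x # xs)) \<in> module_hom K V W"
  by (simp add: multilinear_Suc)

lemma multilinear_cong:
  assumes "\<And>xs. xs \<in> tuples V n \<Longrightarrow> f xs = g xs" "module K V"
  shows "multilinear K V W n f \<longleftrightarrow> multilinear K V W n g"
  using assms(1)
proof (induction n arbitrary: f g)
  case 0
  then show ?case by (simp add: multilinear_0)
next
  case (Suc n)
  have 1: "multilinear K V W n (\<lambda>xs. f (x # xs)) \<longleftrightarrow> multilinear K V W n (\<lambda>xs. g (x # xs))"
    if "x \<in> carrier V" for x
    using that by (intro Suc.IH Suc.prems) auto
  have 2: "(\<lambda>x. f (x # xs)) \<in> module_hom K V W \<longleftrightarrow> (\<lambda>x. g (x # xs)) \<in> module_hom K V W"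
    if "xs \<in> tuples V n" for xs
    using that assms(2) by (intro module_hom_cong Suc.prems) auto
  show ?case unfolding multilinear_Suc using 1 2 by auto
qed

lemma module_hom_compose:
  assumes "f \<in> module_hom R Z Y" "g \<in> module_hom R Y M"
  shows "(\<lambda>x. g (f x)) \<in> module_hom R Z M"
  using assms by (auto simp: module_hom_def Pi_def)

text \<open>
  \<open>ins E q f Q\<close> is the sum over all \<open>k\<close> of \<open>f \<circ>\<^sub>k Q\<close>, where \<open>Q\<close> has arity \<open>q + 1\<close>. The arity \<open>p\<close> of \<open>f\<close>
  is implicit in the length \<open>p + q\<close> of the list; on lists of length at most \<open>q\<close> the value is zero.
\<close>

fun ins :: "('k, 'e, 'x) module_scheme \<Rightarrow> nat \<Rightarrow> ('e list \<Rightarrow> 'e) \<Rightarrow> ('e list \<Rightarrow> 'e) \<Rightarrow> 'e list \<Rightarrow> 'e" where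
  "ins E q f Q [] = \<zero>\<^bsub>E\<^esub>"
| "ins E 0 f Q (x # xs) = ins E 0 (\<lambda>ys. f (x # ys)) Q xs \<oplus>\<^bsub>E\<^esub> f (Q [x] # xs)"
| "ins E (Suc q) f Q (x # xs) =
     signed E (Suc q) (ins E (Suc q) (\<lambda>ys. f (x # ys)) Q xs) \<oplus>\<^bsub>E\<^esub> ins E q f (\<lambda>ys. Q (x # ys)) xs"

context module
begin

lemma ins_short: "length xs \<le> q \<Longrightarrow> ins M q f Q xs = \<zero>\<^bsub>M\<^esub>"
proof (induction xs arbitrary: q f Q)
  case (Cons x xs)
  then show ?case by (cases q) auto
qed simp

abbreviation maps_to :: "nat \<Rightarrow> ('c list \<Rightarrow> 'c) \<Rightarrow> bool" where
  "maps_to n f \<equiv> (\<forall>ys\<in>tuples M n. f ys \<in> carrier M)"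

lemma ins_closed:
  assumes "maps_to p f" "maps_to (Suc q) Q" "xs \<in> tuples M (p + q)"
  shows "ins M q f Q xs \<in> carrier M"
  using assms
proof (induction xs arbitrary: p q f Q)
  case (Cons x xs)
  show ?case
  proof (cases p)
    case 0
    then show ?thesis using Cons.prems(3) by (subst ins_short) (auto simp: tuples_def)
  next
    case (Suc p')
    show ?thesis
    proof (cases q)
      case 0
      then show ?thesis
        using Cons.prems Suc by (auto intro!: Cons.IH[of p' _ 0])
    next
      case (Suc q')
      have "ins M q (\<lambda>ys. f (x # ys)) Q xs \<in> carrier M"
        using Cons.prems \<open>p = Suc p'\<close> by (intro Cons.IH[of p' _ q]) auto
      moreover have "ins M q' f (\<lambda>ys. Q (x # ys)) xs \<in> carrier M"
        using Cons.prems Suc by (intro Cons.IH[of p _ q']) auto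
      ultimately show ?thesis using Suc by simp
    qed
  qed
qed simp

lemma ins_cong:
  assumes "\<And>ys. ys \<in> tuples M p \<Longrightarrow> f ys = g ys" "\<And>ys. ys \<in> tuples M (Suc q) \<Longrightarrow> P ys = Q ys"
    "maps_to (Suc q) Q" "xs \<in> tuples M (p + q)"
  shows "ins M q f P xs = ins M q g Q xs"
  using assms
proof (induction xs arbitrary: p q f g P Q)
  case (Cons x xs)
  show ?case
  proof (cases p)
    case 0
    then have "length (x # xs) \<le> q" using Cons.prems(4) by (auto simp: tuples_def)
    then show ?thesis by (simp only: ins_short)
  next
    case (Suc p')
    then have 1: "ins M q (\<lambda>ys. f (x # ys)) P xs = ins M q (\<lambda>ys. g (x # ys)) Q xs"
      using Cons.prems by (intro Cons.IH[of p']) auto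
    show ?thesis
    proof (cases q)
      case 0
      then show ?thesis using 1 Cons.prems Suc by auto
    next
      case (Suc q')
      then have "ins M q' f (\<lambda>ys. P (x # ys)) xs = ins M q' g (\<lambda>ys. Q (x # ys)) xs"
        using Cons.prems by (intro Cons.IH[of p]) auto
      then show ?thesis using 1 Suc by simp
    qed
  qed
qed simp

lemma smult_signed:
  "a \<in> carrier R \<Longrightarrow> x \<in> carrier M \<Longrightarrow> a \<odot>\<^bsub>M\<^esub> signed M n x = signed M n (a \<odot>\<^bsub>M\<^esub> x)"
  by (simp add: signed_def smult_r_minus)

text \<open>The combined form lets one induction serve both properties: \<open>a = \<one>\<close>
  gives additivity, and \<open>f = \<zero>\<close> gives homogeneity once additivity has shown that
  zero is preserved.\<close>

lemma ins_lincomb_left: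
  assumes "a \<in> carrier R" "maps_to p f" "maps_to p g" "maps_to (Suc q) Q" "xs \<in> tuples M (p + q)"
  shows "ins M q (\<lambda>ys. f ys \<oplus>\<^bsub>M\<^esub> a \<odot>\<^bsub>M\<^esub> g ys) Q xs = ins M q f Q xs \<oplus>\<^bsub>M\<^esub> a \<odot>\<^bsub>M\<^esub> ins M q g Q xs"
  using assms(2-5)
proof (induction xs arbitrary: p q f g Q)
  case (Cons x xs)
  show ?case
  proof (cases p)
    case 0
    then have "length (x # xs) \<le> q" using Cons.prems(4) by (auto simp: tuples_def)
    then show ?thesis using assms(1) by (simp add: ins_short del: ins.simps)
  next
    case (Suc p')
    have c: "maps_to p' (\<lambda>ys. f (x # ys))" "maps_to p' (\<lambda>ys. g (x # ys))" "xs \<in> tuples M (p' + q)"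
      using Cons.prems Suc by auto
    have 1: "ins M q (\<lambda>ys. f (x # ys) \<oplus>\<^bsub>M\<^esub> a \<odot>\<^bsub>M\<^esub> g (x # ys)) Q xs =
        ins M q (\<lambda>ys. f (x # ys)) Q xs \<oplus>\<^bsub>M\<^esub> a \<odot>\<^bsub>M\<^esub> ins M q (\<lambda>ys. g (x # ys)) Q xs"
      by (rule Cons.IH[OF c(1,2) Cons.prems(3) c(3)])
    have cl: "ins M q (\<lambda>ys. f (x # ys)) Q xs \<in> carrier M" "ins M q (\<lambda>ys. g (x # ys)) Q xs \<in> carrier M"
      using c Cons.prems(3) by (auto intro: ins_closed)
    show ?thesis
    proof (cases q)
      case 0
      then have "f (Q [x] # xs) \<in> carrier M" "g (Q [x] # xs) \<in> carrier M"
        using Cons.prems Suc by auto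
      then show ?thesis using 1 cl 0 assms(1) by (simp add: M.a_ac smult_r_distr)
    next
      case (Suc q')
      have d: "maps_to (Suc q') (\<lambda>ys. Q (x # ys))" "xs \<in> tuples M (p + q')"
        using Cons.prems Suc by auto
      note 2 = Cons.IH[OF Cons.prems(1,2) d]
      have "ins M q' f (\<lambda>ys. Q (x # ys)) xs \<in> carrier M" "ins M q' g (\<lambda>ys. Q (x # ys)) xs \<in> carrier M"
        by (rule ins_closed[OF Cons.prems(1) d] ins_closed[OF Cons.prems(2) d])+
      then show ?thesis
        using 1 2 cl Suc assms(1) by (simp add: M.signed_add M.a_ac smult_r_distr smult_signed)
    qed
  qed
qed (use assms(1) in simp)

lemma ins_add_left:
  assumes "maps_to p f" "maps_to p g" "maps_to (Suc q) Q" "xs \<in> tuples M (p + q)"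
  shows "ins M q (\<lambda>ys. f ys \<oplus>\<^bsub>M\<^esub> g ys) Q xs = ins M q f Q xs \<oplus>\<^bsub>M\<^esub> ins M q g Q xs"
proof -
  have "ins M q (\<lambda>ys. f ys \<oplus>\<^bsub>M\<^esub> g ys) Q xs = ins M q (\<lambda>ys. f ys \<oplus>\<^bsub>M\<^esub> \<one> \<odot>\<^bsub>M\<^esub> g ys) Q xs"
    using assms by (intro ins_cong[of p]) auto
  then show ?thesis
    using ins_lincomb_left[OF R.one_closed assms] ins_closed[OF assms(2-4)] by simp
qed

text \<open>Here \<open>f\<close> agrees with \<open>f + f\<close>, so by additivity the value c
  satisfies c = c + c.\<close>

lemma ins_zero_left:
  assumes "\<And>ys. ys \<in> tuples M p \<Longrightarrow> f ys = \<zero>\<^bsub>M\<^esub>" "maps_to (Suc q) Q" "xs \<in> tuples M (p + q)"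
  shows "ins M q f Q xs = \<zero>\<^bsub>M\<^esub>"
proof -
  have f: "maps_to p f" using assms(1) by simp
  note c = ins_closed[OF f assms(2,3)]
  have "ins M q f Q xs = ins M q (\<lambda>ys. f ys \<oplus>\<^bsub>M\<^esub> f ys) Q xs"
    using assms by (intro ins_cong[of p]) auto
  also have "\<dots> = ins M q f Q xs \<oplus>\<^bsub>M\<^esub> ins M q f Q xs"
    by (rule ins_add_left[OF f f assms(2,3)])
  finally show ?thesis using M.add.l_cancel_one'[OF c c] by (rule iffD1[rotated])
qed

lemma ins_smult_left:
  assumes "a \<in> carrier R" "maps_to p f" "maps_to (Suc q) Q" "xs \<in> tuples M (p + q)"
  shows "ins M q (\<lambda>ys. a \<odot>\<^bsub>M\<^esub> f ys) Q xs = a \<odot>\<^bsub>M\<^esub> ins M q f Q xs"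
proof -
  have "ins M q (\<lambda>ys. a \<odot>\<^bsub>M\<^esub> f ys) Q xs = ins M q (\<lambda>ys. \<zero>\<^bsub>M\<^esub> \<oplus>\<^bsub>M\<^esub> a \<odot>\<^bsub>M\<^esub> f ys) Q xs"
    using assms by (intro ins_cong[of p]) auto
  also have "\<dots> = ins M q (\<lambda>_. \<zero>\<^bsub>M\<^esub>) Q xs \<oplus>\<^bsub>M\<^esub> a \<odot>\<^bsub>M\<^esub> ins M q f Q xs"
    using assms by (intro ins_lincomb_left) auto
  also have "ins M q (\<lambda>_. \<zero>\<^bsub>M\<^esub>) Q xs = \<zero>\<^bsub>M\<^esub>"
    using assms by (intro ins_zero_left[of p]) auto
  finally show ?thesis using assms ins_closed[OF assms(2-4)] by simp
qed

lemma multilinear_maps_to: "multilinear R M M p f \<Longrightarrow> maps_to p f"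
  by (simp add: multilinear_closed)

text \<open>In contrast to the left argument, \<open>f\<close> has to be multilinear: for
  \<open>q = 0\<close> the value of the inserted map becomes the head argument of
  \<open>f\<close>.\<close>

lemma ins_lincomb_right:
  assumes "a \<in> carrier R" "multilinear R M M p f" "maps_to (Suc q) P" "maps_to (Suc q) Q" "xs \<in> tuples M (p + q)"
  shows "ins M q f (\<lambda>ys. P ys \<oplus>\<^bsub>M\<^esub> a \<odot>\<^bsub>M\<^esub> Q ys) xs = ins M q f P xs \<oplus>\<^bsub>M\<^esub> a \<odot>\<^bsub>M\<^esub> ins M q f Q xs"
  using assms(2-5)
proof (induction xs arbitrary: p q f P Q)
  case (Cons x xs)
  show ?case
  proof (cases p)
    case 0
    then have "length (x # xs) \<le> q" using Cons.prems(4) by (auto simp: tuples_def)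
    then show ?thesis using assms(1) by (simp add: ins_short del: ins.simps)
  next
    case (Suc p')
    have c: "multilinear R M M p' (\<lambda>ys. f (x # ys))" "xs \<in> tuples M (p' + q)"
      using Cons.prems Suc by (auto intro: multilinear_Cons)
    have 1: "ins M q (\<lambda>ys. f (x # ys)) (\<lambda>ys. P ys \<oplus>\<^bsub>M\<^esub> a \<odot>\<^bsub>M\<^esub> Q ys) xs =
        ins M q (\<lambda>ys. f (x # ys)) P xs \<oplus>\<^bsub>M\<^esub> a \<odot>\<^bsub>M\<^esub> ins M q (\<lambda>ys. f (x # ys)) Q xs"
      by (rule Cons.IH[OF c(1) Cons.prems(2,3) c(2)])
    have cl: "ins M q (\<lambda>ys. f (x # ys)) P xs \<in> carrier M" "ins M q (\<lambda>ys. f (x # ys)) Q xs \<in> carrier M"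
      using multilinear_maps_to[OF c(1)] c(2) Cons.prems(2,3) by (auto intro: ins_closed)
    show ?thesis
    proof (cases q)
      case 0
      have h: "(\<lambda>y. f (y # xs)) \<in> module_hom R M M"
        using Cons.prems Suc 0 by (intro multilinear_head[of _ _ _ p']) auto
      have PQ: "P [x] \<in> carrier M" "Q [x] \<in> carrier M"
        using Cons.prems 0 by auto
      have "f (P [x] # xs) \<in> carrier M" "f (Q [x] # xs) \<in> carrier M"
        using module_hom_closed[OF h] PQ by auto
      moreover have "f ((P [x] \<oplus>\<^bsub>M\<^esub> a \<odot>\<^bsub>M\<^esub> Q [x]) # xs) = f (P [x] # xs) \<oplus>\<^bsub>M\<^esub> a \<odot>\<^bsub>M\<^esub> f (Q [x] # xs)"
        using module_hom_add[OF h PQ(1)] module_hom_smult[OF h assms(1) PQ(2)] PQ assms(1) by simp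
      ultimately show ?thesis using 1 cl 0 assms(1) by (simp add: M.a_ac smult_r_distr)
    next
      case (Suc q')
      have d: "maps_to (Suc q') (\<lambda>ys. P (x # ys))" "maps_to (Suc q') (\<lambda>ys. Q (x # ys))" "xs \<in> tuples M (p + q')"
        using Cons.prems Suc by auto
      note 2 = Cons.IH[OF Cons.prems(1) d]
      have "ins M q' f (\<lambda>ys. P (x # ys)) xs \<in> carrier M" "ins M q' f (\<lambda>ys. Q (x # ys)) xs \<in> carrier M"
        using multilinear_maps_to[OF Cons.prems(1)] d by (auto intro: ins_closed)
      then show ?thesis
        using 1 2 cl Suc assms(1) by (simp add: M.signed_add M.a_ac smult_r_distr smult_signed)
    qed
  qed
qed (use assms(1) in simp)

lemma ins_add_right:
  assumes "multilinear R M M p f" "maps_to (Suc q) P" "maps_to (Suc q) Q" "xs \<in> tuples M (p + q)"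
  shows "ins M q f (\<lambda>ys. P ys \<oplus>\<^bsub>M\<^esub> Q ys) xs = ins M q f P xs \<oplus>\<^bsub>M\<^esub> ins M q f Q xs"
proof -
  have "ins M q f (\<lambda>ys. P ys \<oplus>\<^bsub>M\<^esub> Q ys) xs = ins M q f (\<lambda>ys. P ys \<oplus>\<^bsub>M\<^esub> \<one> \<odot>\<^bsub>M\<^esub> Q ys) xs"
    using assms by (intro ins_cong[of p]) auto
  then show ?thesis
    using ins_lincomb_right[OF R.one_closed assms] ins_closed[OF multilinear_maps_to[OF assms(1)] assms(3,4)] by simp
qed

lemma ins_zero_right:
  assumes "multilinear R M M p f" "xs \<in> tuples M (p + q)"
  shows "ins M q f (\<lambda>_. \<zero>\<^bsub>M\<^esub>) xs = \<zero>\<^bsub>M\<^esub>"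
proof -
  have c: "ins M q f (\<lambda>_. \<zero>\<^bsub>M\<^esub>) xs \<in> carrier M"
    using multilinear_maps_to[OF assms(1)] assms(2) by (intro ins_closed[of p]) auto
  have "ins M q f (\<lambda>_. \<zero>\<^bsub>M\<^esub>) xs = ins M q f (\<lambda>_. \<zero>\<^bsub>M\<^esub> \<oplus>\<^bsub>M\<^esub> \<zero>\<^bsub>M\<^esub>) xs"
    by simp
  also have "\<dots> = ins M q f (\<lambda>_. \<zero>\<^bsub>M\<^esub>) xs \<oplus>\<^bsub>M\<^esub> ins M q f (\<lambda>_. \<zero>\<^bsub>M\<^esub>) xs"
    by (rule ins_add_right[OF assms(1) _ _ assms(2)]) simp_all
  finally show ?thesis using M.add.l_cancel_one'[OF c c] by (rule iffD1[rotated])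
qed

lemma ins_smult_right:
  assumes "a \<in> carrier R" "multilinear R M M p f" "maps_to (Suc q) Q" "xs \<in> tuples M (p + q)"
  shows "ins M q f (\<lambda>ys. a \<odot>\<^bsub>M\<^esub> Q ys) xs = a \<odot>\<^bsub>M\<^esub> ins M q f Q xs"
proof -
  have "ins M q f (\<lambda>ys. a \<odot>\<^bsub>M\<^esub> Q ys) xs = ins M q f (\<lambda>ys. \<zero>\<^bsub>M\<^esub> \<oplus>\<^bsub>M\<^esub> a \<odot>\<^bsub>M\<^esub> Q ys) xs"
    using assms by (intro ins_cong[of p]) auto
  also have "\<dots> = ins M q f (\<lambda>_. \<zero>\<^bsub>M\<^esub>) xs \<oplus>\<^bsub>M\<^esub> a \<odot>\<^bsub>M\<^esub> ins M q f Q xs"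
    using assms by (intro ins_lincomb_right) auto
  finally show ?thesis
    using assms ins_zero_right[OF assms(2,4)] ins_closed[OF multilinear_maps_to[OF assms(2)] assms(3,4)] by simp
qed

text \<open>Turns a sign into a scalar, so that compatibility with signs is an instance of
  homogeneity.\<close>

lemma signed_eq_smult:
  obtains a where "a \<in> carrier R" "\<And>x. x \<in> carrier M \<Longrightarrow> signed M n x = a \<odot>\<^bsub>M\<^esub> x"
proof (cases "even n")
  case True
  then show ?thesis using that[of "\<one>"] by (simp add: signed_def)
next
  case False
  then show ?thesis using that[of "\<ominus> \<one>"] by (simp add: signed_def smult_l_minus)
qed

lemma ins_signed_left:
  assumes "maps_to p f" "maps_to (Suc q) Q" "xs \<in> tuples M (p + q)"
  shows "ins M q (\<lambda>ys. signed M n (f ys)) Q xs = signed M n (ins M q f Q xs)"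
proof -
  obtain a where a: "a \<in> carrier R" "\<And>x. x \<in> carrier M \<Longrightarrow> signed M n x = a \<odot>\<^bsub>M\<^esub> x"
    using signed_eq_smult[where n = n] by metis
  have "ins M q (\<lambda>ys. signed M n (f ys)) Q xs = ins M q (\<lambda>ys. a \<odot>\<^bsub>M\<^esub> f ys) Q xs"
    using assms a by (intro ins_cong[of p]) auto
  also have "\<dots> = signed M n (ins M q f Q xs)"
    using assms a by (simp add: ins_smult_left ins_closed)
  finally show ?thesis .
qed

lemma ins_signed_right:
  assumes "multilinear R M M p f" "maps_to (Suc q) Q" "xs \<in> tuples M (p + q)"
  shows "ins M q f (\<lambda>ys. signed M n (Q ys)) xs = signed M n (ins M q f Q xs)"
proof -
  obtain a where a: "a \<in> carrier R" "\<And>x. x \<in> carrier M \<Longrightarrow> signed M n x = a \<odot>\<^bsub>M\<^esub> x"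
    using signed_eq_smult[where n = n] by metis
  have "ins M q f (\<lambda>ys. signed M n (Q ys)) xs = ins M q f (\<lambda>ys. a \<odot>\<^bsub>M\<^esub> Q ys) xs"
    using assms a by (intro ins_cong[of p]) auto
  also have "\<dots> = signed M n (ins M q f Q xs)"
    using assms a multilinear_maps_to[OF assms(1)] by (simp add: ins_smult_right ins_closed)
  finally show ?thesis .
qed

text \<open>The parameter space \<open>Z\<close> is kept general for two uses: it is
  \<open>M\<close> when an argument in the list varies, and a Hom space when the inserted maps
  themselves vary.\<close>

lemma module_hom_ins_left:
  assumes "\<And>ys. ys \<in> tuples M p \<Longrightarrow> (\<lambda>x. F x ys) \<in> module_hom R Z M"
    and "maps_to (Suc q) Q" "xs \<in> tuples M (p + q)" "module R Z"
  shows "(\<lambda>x. ins M q (F x) Q xs) \<in> module_hom R Z M"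
proof -
  interpret Z: module R Z by fact
  have c: "maps_to p (F x)" if "x \<in> carrier Z" for x
    using module_hom_closed[OF assms(1)] that by auto
  have "ins M q (F (x \<oplus>\<^bsub>Z\<^esub> y)) Q xs = ins M q (F x) Q xs \<oplus>\<^bsub>M\<^esub> ins M q (F y) Q xs"
    if "x \<in> carrier Z" "y \<in> carrier Z" for x y
    unfolding ins_add_left[OF c[OF that(1)] c[OF that(2)] assms(2,3), symmetric]
    by (rule ins_cong[OF _ _ assms(2,3)]) (use module_hom_add[OF assms(1)] that in auto)
  moreover have "ins M q (F (a \<odot>\<^bsub>Z\<^esub> x)) Q xs = a \<odot>\<^bsub>M\<^esub> ins M q (F x) Q xs"
    if "x \<in> carrier Z" "a \<in> carrier R" for x a
    unfolding ins_smult_left[OF that(2) c[OF that(1)] assms(2,3), symmetric]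
    by (rule ins_cong[OF _ _ assms(2,3)]) (use module_hom_smult[OF assms(1)] that in auto)
  ultimately show ?thesis
    using ins_closed[OF c assms(2,3)] by (auto simp: module_hom_def)
qed

lemma module_hom_ins_right:
  assumes "multilinear R M M p f" and "\<And>ys. ys \<in> tuples M (Suc q) \<Longrightarrow> (\<lambda>x. G x ys) \<in> module_hom R Z M"
    and "xs \<in> tuples M (p + q)" "module R Z"
  shows "(\<lambda>x. ins M q f (G x) xs) \<in> module_hom R Z M"
proof -
  interpret Z: module R Z by fact
  note f = multilinear_maps_to[OF assms(1)]
  have c: "maps_to (Suc q) (G x)" if "x \<in> carrier Z" for x
    using module_hom_closed[OF assms(2)] that by auto
  have "ins M q f (G (x \<oplus>\<^bsub>Z\<^esub> y)) xs = ins M q f (G x) xs \<oplus>\<^bsub>M\<^esub> ins M q f (G y) xs"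
    if "x \<in> carrier Z" "y \<in> carrier Z" for x y
    unfolding ins_add_right[OF assms(1) c[OF that(1)] c[OF that(2)] assms(3), symmetric]
    by (rule ins_cong[OF _ _ _ assms(3)])
       (use module_hom_add[OF assms(2)] that c[OF that(1)] c[OF that(2)] in auto)
  moreover have "ins M q f (G (a \<odot>\<^bsub>Z\<^esub> x)) xs = a \<odot>\<^bsub>M\<^esub> ins M q f (G x) xs"
    if "x \<in> carrier Z" "a \<in> carrier R" for x a
    unfolding ins_smult_right[OF that(2) assms(1) c[OF that(1)] assms(3), symmetric]
    by (rule ins_cong[OF _ _ _ assms(3)])
       (use module_hom_smult[OF assms(2)] that c[OF that(1)] in auto)
  ultimately show ?thesis
    using ins_closed[OF f c assms(3)] by (auto simp: module_hom_def)
qed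

lemma module_hom_add_fun:
  assumes "f \<in> module_hom R Z M" "g \<in> module_hom R Z M"
  shows "(\<lambda>x. f x \<oplus>\<^bsub>M\<^esub> g x) \<in> module_hom R Z M"
  using assms by (auto simp: module_hom_def Pi_def M.a_ac smult_r_distr)

lemma module_hom_signed:
  assumes "f \<in> module_hom R Z M"
  shows "(\<lambda>x. signed M n (f x)) \<in> module_hom R Z M"
  using assms by (auto simp: module_hom_def Pi_def M.signed_add smult_signed)

lemma multilinear_add:
  assumes "multilinear R V M n f" "multilinear R V M n g"
  shows "multilinear R V M n (\<lambda>xs. f xs \<oplus>\<^bsub>M\<^esub> g xs)"
  using assms by (auto simp: multilinear_def intro: module_hom_add_fun)

lemma multilinear_signed:
  assumes "multilinear R V M n f"
  shows "multilinear R V M n (\<lambda>xs. signed M k (f xs))"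
  using assms by (auto simp: multilinear_def intro: module_hom_signed)

text \<open>The induction is on \<open>p + q\<close>, since a recursive call lowers either the arity
  of \<open>f\<close> or that of \<open>Q\<close> by one. Linearity in the head comes from the two
  lemmas on linear parameters, and for \<open>q = 0\<close> also from composing \<open>f\<close>
  with \<open>Q\<close>.\<close>

lemma multilinear_ins:
  assumes "multilinear R M M p f" "multilinear R M M (Suc q) Q"
  shows "multilinear R M M (p + q) (ins M q f Q)"
  using assms
proof (induction "p + q" arbitrary: p q f Q)
  case 0
  then show ?case by (simp add: multilinear_0)
next
  case (Suc n)
  note f = multilinear_maps_to[OF Suc.prems(1)] and Q = multilinear_maps_to[OF Suc.prems(2)]
  show ?case
  proof (cases p)
    case 0
    have "multilinear R M M (p + q) (\<lambda>_. \<zero>\<^bsub>M\<^esub>)"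
      by (auto simp: multilinear_def module_hom_def)
    then show ?thesis
      by (subst multilinear_cong[where g = "\<lambda>_. \<zero>\<^bsub>M\<^esub>"])
         (auto simp: 0 module_axioms dest: length_tuples intro!: ins_short)
  next
    case (Suc p')
    have n: "n = p' + q" using \<open>Suc n = p + q\<close> Suc by simp
    have f': "multilinear R M M p' (\<lambda>ys. f (x # ys))" if "x \<in> carrier M" for x
      using multilinear_Cons[of R M M p' f x] Suc.prems(1) Suc that by simp
    have 1: "multilinear R M M n (ins M q (\<lambda>ys. f (x # ys)) Q)" if "x \<in> carrier M" for x
      using Suc.hyps(1)[OF n f'[OF that] Suc.prems(2)] n by simp
    have h1: "(\<lambda>x. ins M q (\<lambda>ys. f (x # ys)) Q xs) \<in> module_hom R M M" if "xs \<in> tuples M n" for xs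
      using that Suc.prems(1) Q by (intro module_hom_ins_left[of p'] module_axioms) (auto simp: n Suc intro: multilinear_head)
    show ?thesis
    proof (cases q)
      case 0
      have Q1: "(\<lambda>x. Q [x]) \<in> module_hom R M M"
        using multilinear_head[of R M M 0 Q "[]"] Suc.prems(2) 0 by simp
      have Qx: "Q [x] \<in> carrier M" if "x \<in> carrier M" for x
        using Q that 0 by auto
      have "multilinear R M M n (\<lambda>xs. ins M 0 (\<lambda>ys. f (x # ys)) Q xs \<oplus>\<^bsub>M\<^esub> f (Q [x] # xs))"
        if "x \<in> carrier M" for x
        using 1[OF that] f'[OF Qx[OF that]] 0 n by (intro multilinear_add) auto
      moreover have "(\<lambda>x. ins M 0 (\<lambda>ys. f (x # ys)) Q xs \<oplus>\<^bsub>M\<^esub> f (Q [x] # xs)) \<in> module_hom R M M"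
        if "xs \<in> tuples M n" for xs
      proof -
        have "(\<lambda>y. f (y # xs)) \<in> module_hom R M M"
          using Suc.prems(1) Suc that n 0 by (intro multilinear_head[of _ _ _ p']) auto
        from module_hom_compose[OF Q1 this] h1[OF that] show ?thesis
          using 0 by (intro module_hom_add_fun) auto
      qed
      ultimately show ?thesis
        using \<open>Suc n = p + q\<close>[symmetric] 0 by (simp add: multilinear_Suc)
    next
      case (Suc q')
      have n': "n = p + q'" using \<open>Suc n = p + q\<close> Suc by simp
      have "multilinear R M M n (\<lambda>xs. signed M q (ins M q (\<lambda>ys. f (x # ys)) Q xs) \<oplus>\<^bsub>M\<^esub> ins M q' f (\<lambda>ys. Q (x # ys)) xs)"
        if "x \<in> carrier M" for x
      proof -
        have "multilinear R M M (p + q') (ins M q' f (\<lambda>ys. Q (x # ys)))"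
          using Suc.prems(1,2) that \<open>q = Suc q'\<close>
          by (intro Suc.hyps(1)[OF n']) (auto intro: multilinear_Cons)
        then show ?thesis using 1[OF that] n' by (intro multilinear_add multilinear_signed) auto
      qed
      moreover have "(\<lambda>x. signed M q (ins M q (\<lambda>ys. f (x # ys)) Q xs) \<oplus>\<^bsub>M\<^esub> ins M q' f (\<lambda>ys. Q (x # ys)) xs) \<in> module_hom R M M"
        if "xs \<in> tuples M n" for xs
        using Suc.prems(1,2) that h1[OF that] n' \<open>q = Suc q'\<close>
        by (intro module_hom_add_fun module_hom_signed module_hom_ins_right[of p] module_axioms)
           (auto intro: multilinear_head)
      ultimately show ?thesis
        using \<open>Suc n = p + q\<close>[symmetric] Suc by (simp add: multilinear_Suc)
    qed
  qed
qed

end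

lemma (in abelian_group) add_diff_add_right:
  assumes "x \<in> carrier G" "y \<in> carrier G" "z \<in> carrier G"
  shows "(x \<oplus> z) \<ominus> (y \<oplus> z) = x \<ominus> y"
proof -
  have "(x \<oplus> z) \<ominus> (y \<oplus> z) = x \<oplus> (z \<oplus> (\<ominus> z \<oplus> \<ominus> y))"
    using assms by (simp add: minus_eq minus_add a_ac)
  then show ?thesis using assms by (simp add: r_neg2 minus_eq)
qed

section \<open>The recursion \<open>ins\<close> computes the sum over shuffles\<close>

context module
begin

lemma finsum_lessThan_Suc_shift:
  assumes "\<And>i. i < Suc n \<Longrightarrow> f i \<in> carrier M"
  shows "(\<Oplus>\<^bsub>M\<^esub>i\<in>{..<Suc n}. f i) = f 0 \<oplus>\<^bsub>M\<^esub> (\<Oplus>\<^bsub>M\<^esub>i\<in>{..<n}. f (Suc i))"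
proof -
  have "(\<Oplus>\<^bsub>M\<^esub>i\<in>{..<Suc n}. f i) = f 0 \<oplus>\<^bsub>M\<^esub> (\<Oplus>\<^bsub>M\<^esub>i\<in>Suc ` {..<n}. f i)"
    unfolding lessThan_Suc_eq_insert_0 using assms by (intro M.finsum_insert) auto
  also have "(\<Oplus>\<^bsub>M\<^esub>i\<in>Suc ` {..<n}. f i) = (\<Oplus>\<^bsub>M\<^esub>i\<in>{..<n}. f (Suc i))"
    using assms by (intro M.finsum_reindex) auto
  finally show ?thesis .
qed

text \<open>One summand of \<open>insertion\<close> without its sign, for \<open>i = k - 1\<close>.
  The lists \<open>a\<close> and \<open>b\<close> hold positions counted from 1, hence
  \<open>t - 1\<close>, whereas \<open>i + q\<close> counts from 0 and is the last argument of
  \<open>Q\<close>.\<close>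

definition block_insert ::
  "('c list \<Rightarrow> 'c) \<Rightarrow> ('c list \<Rightarrow> 'c) \<Rightarrow> nat \<Rightarrow> nat \<Rightarrow> 'c list \<Rightarrow> nat list \<Rightarrow> nat list \<Rightarrow> 'c" where
  "block_insert f Q i q xs a b =
     f (map (\<lambda>t. xs ! (t - 1)) a @ [Q (map (\<lambda>t. xs ! (t - 1)) b @ [xs ! (i + q)])] @ drop (Suc (i + q)) xs)"

lemma nth_tuples: "xs \<in> tuples M n \<Longrightarrow> i < n \<Longrightarrow> xs ! i \<in> carrier M"
  by (auto simp: tuples_def)

lemma block_insert_closed:
  assumes "maps_to p f" "maps_to (Suc q) Q" "xs \<in> tuples M (p + q)" "i < p" "(a, b) \<in> M.index_blocks i q"
  shows "block_insert f Q i q xs a b \<in> carrier M"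
proof -
  have n: "xs ! (t - 1) \<in> carrier M" if "t \<in> set a \<union> set b" for t
  proof (rule nth_tuples[OF assms(3)])
    have "t \<in> {1..i + q}" using that assms(5) by (auto simp: M.index_blocks_def)
    then show "t - 1 < p + q" using assms(4) by auto
  qed
  have "map (\<lambda>t. xs ! (t - 1)) b @ [xs ! (i + q)] \<in> tuples M (Suc q)"
    using n nth_tuples[OF assms(3), of "i + q"] assms(4,5) by (auto simp: tuples_def M.index_blocks_def)
  then have "Q (map (\<lambda>t. xs ! (t - 1)) b @ [xs ! (i + q)]) \<in> carrier M"
    using assms(2) by blast
  then have "map (\<lambda>t. xs ! (t - 1)) a @ [Q (map (\<lambda>t. xs ! (t - 1)) b @ [xs ! (i + q)])] @ drop (Suc (i + q)) xs \<in> tuples M p"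
    using n assms(3,4,5) by (auto simp: tuples_def M.index_blocks_def dest: in_set_dropD)
  then show ?thesis unfolding block_insert_def using assms(1) by blast
qed

lemma block_insert_fst:
  assumes "(a, b) \<in> M.index_blocks i q"
  shows "block_insert f Q (Suc i) q (x # xs) (1 # map Suc a) (map Suc b) = block_insert (\<lambda>ys. f (x # ys)) Q i q xs a b"
proof -
  have *: "(x # xs) ! t = xs ! (t - 1)" if "t \<in> set a \<union> set b" for t
    using that assms by (cases t) (auto simp: M.index_blocks_def)
  then have m: "map ((!) (x # xs)) a = map (\<lambda>t. xs ! (t - Suc 0)) a"
      "map ((!) (x # xs)) b = map (\<lambda>t. xs ! (t - Suc 0)) b"
    by simp_all
  show ?thesis by (simp add: block_insert_def o_def m)
qed

lemma block_insert_snd: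
  assumes "(a, b) \<in> M.index_blocks i q"
  shows "block_insert f Q i (Suc q) (x # xs) (map Suc a) (1 # map Suc b) = block_insert f (\<lambda>ys. Q (x # ys)) i q xs a b"
proof -
  have *: "(x # xs) ! t = xs ! (t - 1)" if "t \<in> set a \<union> set b" for t
    using that assms by (cases t) (auto simp: M.index_blocks_def)
  then have m: "map ((!) (x # xs)) a = map (\<lambda>t. xs ! (t - Suc 0)) a"
      "map ((!) (x # xs)) b = map (\<lambda>t. xs ! (t - Suc 0)) b"
    by simp_all
  show ?thesis by (simp add: block_insert_def o_def m)
qed

text \<open>For \<open>i = 0\<close> nothing precedes \<open>Q\<close>, so the first argument must
  enter \<open>Q\<close>; for larger \<open>i\<close> both options occur. The terms that pass the
  argument on add up to the first recursive call after an index shift. For positive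
  \<open>q\<close>, the absorbing terms, together with the one for \<open>i = 0\<close>, add up to
  the second.\<close>

lemma shuffle_sum_ins:
  assumes "maps_to p f" "maps_to (Suc q) Q" "xs \<in> tuples M (p + q)"
  shows "(\<Oplus>\<^bsub>M\<^esub>i\<in>{..<p}. M.shuffle_sum i q (block_insert f Q i q xs)) = ins M q f Q xs"
  using assms
proof (induction xs arbitrary: p q f Q)
  case Nil
  then show ?case by simp
next
  case (Cons x xs)
  show ?case
  proof (cases p)
    case 0
    then show ?thesis using Cons.prems(3) by (subst ins_short) (auto simp: tuples_def)
  next
    case (Suc p')
    let ?S = "\<lambda>f Q i q xs. M.shuffle_sum i q (block_insert f Q i q xs)"
    let ?fx = "\<lambda>ys. f (x # ys)"
    have c: "maps_to p' ?fx" "xs \<in> tuples M (p' + q)" and x: "x \<in> carrier M"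
      using Cons.prems Suc by auto
    have bc: "block_insert f Q i q (x # xs) a b \<in> carrier M" if "i < p" "(a, b) \<in> M.index_blocks i q" for i a b
      using block_insert_closed[OF Cons.prems that] .
    have bc1: "block_insert ?fx Q i q xs a b \<in> carrier M" if "i < p'" "(a, b) \<in> M.index_blocks i q" for i a b
      using block_insert_closed[OF c(1) Cons.prems(2) c(2) that] .
    have sc: "?S f Q i q (x # xs) \<in> carrier M" if "i < p" for i
      using bc[OF that] by (intro M.shuffle_sum_closed) auto
    have sc1: "?S ?fx Q i q xs \<in> carrier M" if "i < p'" for i
      using bc1[OF that] by (intro M.shuffle_sum_closed) auto
    note IH1 = Cons.IH[OF c(1) Cons.prems(2) c(2)]
    have fst_eq: "M.shuffle_sum i q (\<lambda>a b. block_insert f Q (Suc i) q (x # xs) (1 # map Suc a) (map Suc b)) = ?S ?fx Q i q xs"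
      if "i < p'" for i
      using bc1[OF that] block_insert_fst[where f = f and Q = Q and x = x and xs = xs] by (intro M.shuffle_sum_cong) auto
    show ?thesis
    proof (cases q)
      case 0
      have "?S f Q 0 0 (x # xs) = block_insert f Q 0 0 (x # xs) [] []"
        using bc[of 0 "[]" "[]"] 0 Suc by (intro M.shuffle_sum_0_0) (auto simp: M.index_blocks_def)
      then have z: "?S f Q 0 0 (x # xs) = f (Q [x] # xs)"
        by (simp add: block_insert_def)
      have s: "?S f Q (Suc i) 0 (x # xs) = ?S ?fx Q i 0 xs" if "i < p'" for i
        using fst_eq[OF that] bc[of "Suc i"] that 0 Suc
        by (subst M.shuffle_sum_Suc_0) auto
      have "(\<Oplus>\<^bsub>M\<^esub>i\<in>{..<p}. ?S f Q i q (x # xs)) = ?S f Q 0 0 (x # xs) \<oplus>\<^bsub>M\<^esub> (\<Oplus>\<^bsub>M\<^esub>i\<in>{..<p'}. ?S f Q (Suc i) 0 (x # xs))"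
        unfolding Suc 0 using sc Suc 0 by (intro finsum_lessThan_Suc_shift) auto
      also have "(\<Oplus>\<^bsub>M\<^esub>i\<in>{..<p'}. ?S f Q (Suc i) 0 (x # xs)) = (\<Oplus>\<^bsub>M\<^esub>i\<in>{..<p'}. ?S ?fx Q i 0 xs)"
        using s sc1 0 by (intro M.finsum_cong') auto
      also have "\<dots> = ins M 0 ?fx Q xs"
        using IH1 0 by simp
      finally show ?thesis
        using z sc[of 0] Suc 0 ins_closed[OF c(1) Cons.prems(2) c(2)] by (simp add: M.a_ac)
    next
      case (Suc q')
      let ?Qx = "\<lambda>ys. Q (x # ys)"
      have d: "maps_to (Suc q') ?Qx" "xs \<in> tuples M (p + q')"
        using Cons.prems Suc by auto
      have bc2: "block_insert f ?Qx i q' xs a b \<in> carrier M" if "i < p" "(a, b) \<in> M.index_blocks i q'" for i a b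
        using block_insert_closed[OF Cons.prems(1) d that] .
      have sc2: "?S f ?Qx i q' xs \<in> carrier M" if "i < p" for i
        using bc2[OF that] by (intro M.shuffle_sum_closed) auto
      note IH2 = Cons.IH[OF Cons.prems(1) d]
      have snd_eq: "M.shuffle_sum i q' (\<lambda>a b. block_insert f Q i (Suc q') (x # xs) (map Suc a) (1 # map Suc b)) = ?S f ?Qx i q' xs"
        if "i < p" for i
        using bc2[OF that] block_insert_snd[where f = f and Q = Q and x = x and xs = xs] by (intro M.shuffle_sum_cong) auto
      have z: "?S f Q 0 q (x # xs) = ?S f ?Qx 0 q' xs"
        using snd_eq[of 0] bc[of 0] \<open>p = Suc p'\<close> unfolding Suc by (subst M.shuffle_sum_0_Suc) auto
      have s: "?S f Q (Suc i) q (x # xs) = signed M q (?S ?fx Q i q xs) \<oplus>\<^bsub>M\<^esub> ?S f ?Qx (Suc i) q' xs"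
        if "i < p'" for i
        using snd_eq[of "Suc i"] fst_eq[of i] bc[of "Suc i"] that \<open>p = Suc p'\<close> unfolding Suc
        by (subst M.shuffle_sum_Suc_Suc) auto
      have "(\<Oplus>\<^bsub>M\<^esub>i\<in>{..<p}. ?S f Q i q (x # xs)) = ?S f Q 0 q (x # xs) \<oplus>\<^bsub>M\<^esub> (\<Oplus>\<^bsub>M\<^esub>i\<in>{..<p'}. ?S f Q (Suc i) q (x # xs))"
        unfolding \<open>p = Suc p'\<close> using sc \<open>p = Suc p'\<close> by (intro finsum_lessThan_Suc_shift) auto
      also have "(\<Oplus>\<^bsub>M\<^esub>i\<in>{..<p'}. ?S f Q (Suc i) q (x # xs)) =
          (\<Oplus>\<^bsub>M\<^esub>i\<in>{..<p'}. signed M q (?S ?fx Q i q xs) \<oplus>\<^bsub>M\<^esub> ?S f ?Qx (Suc i) q' xs)"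
        using s sc1 sc2 \<open>p = Suc p'\<close> by (intro M.finsum_cong') auto
      also have "\<dots> = (\<Oplus>\<^bsub>M\<^esub>i\<in>{..<p'}. signed M q (?S ?fx Q i q xs)) \<oplus>\<^bsub>M\<^esub> (\<Oplus>\<^bsub>M\<^esub>i\<in>{..<p'}. ?S f ?Qx (Suc i) q' xs)"
        using sc1 sc2 \<open>p = Suc p'\<close> by (intro M.finsum_addf) auto
      also have "(\<Oplus>\<^bsub>M\<^esub>i\<in>{..<p'}. signed M q (?S ?fx Q i q xs)) = signed M q (ins M q ?fx Q xs)"
        using sc1 by (subst M.finsum_signed) (auto simp: IH1)
      finally have "(\<Oplus>\<^bsub>M\<^esub>i\<in>{..<p}. ?S f Q i q (x # xs)) =
          ?S f ?Qx 0 q' xs \<oplus>\<^bsub>M\<^esub> (signed M q (ins M q ?fx Q xs) \<oplus>\<^bsub>M\<^esub> (\<Oplus>\<^bsub>M\<^esub>i\<in>{..<p'}. ?S f ?Qx (Suc i) q' xs))"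
        unfolding z .
      moreover have "ins M q' f ?Qx xs = ?S f ?Qx 0 q' xs \<oplus>\<^bsub>M\<^esub> (\<Oplus>\<^bsub>M\<^esub>i\<in>{..<p'}. ?S f ?Qx (Suc i) q' xs)"
        unfolding IH2[symmetric] \<open>p = Suc p'\<close> using sc2 \<open>p = Suc p'\<close> by (intro finsum_lessThan_Suc_shift) auto
      moreover have "ins M q ?fx Q xs \<in> carrier M"
        by (rule ins_closed[OF c(1) Cons.prems(2) c(2)])
      moreover have "?S f ?Qx 0 q' xs \<in> carrier M" "(\<Oplus>\<^bsub>M\<^esub>i\<in>{..<p'}. ?S f ?Qx (Suc i) q' xs) \<in> carrier M"
        using sc2 \<open>p = Suc p'\<close> by (auto intro!: M.finsum_closed)
      ultimately show ?thesis using Suc by (simp add: M.a_ac)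
    qed
  qed
qed

end

text \<open>Here \<open>p\<close> is a degree and \<open>f\<close> has arity \<open>Suc p\<close>,
  whereas the lemmas on \<open>ins\<close> count the arity of \<open>f\<close> itself.\<close>

lemma bar_comp_eq_ins:
  fixes E :: "('k, 'e) module"
  assumes "module K E" and f: "\<And>ys. ys \<in> tuples E (Suc p) \<Longrightarrow> f ys \<in> carrier E"
    and Q: "\<And>ys. ys \<in> tuples E (Suc q) \<Longrightarrow> Q ys \<in> carrier E" and xs: "xs \<in> tuples E (p + q + 1)"
  shows "bar_comp E p q f Q xs = ins E q f Q xs"
proof -
  interpret module K E by fact
  have xs': "xs \<in> tuples E (Suc p + q)" using xs by simp
  have i: "insertion E p q (Suc i) f Q xs = M.shuffle_sum i q (block_insert f Q i q xs)" for i
    using xs by (simp add: insertion_def M.shuffle_sum_def block_insert_def o_def del: upt_Suc)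
  have c: "M.shuffle_sum i q (block_insert f Q i q xs) \<in> carrier E" if "i < Suc p" for i
    using f Q by (intro M.shuffle_sum_closed block_insert_closed[OF _ _ xs' that]) auto
  have "bar_comp E p q f Q xs = (\<Oplus>\<^bsub>E\<^esub>k\<in>Suc ` {..<Suc p}. insertion E p q k f Q xs)"
    using xs by (simp add: bar_comp_def image_Suc_lessThan)
  also have "\<dots> = (\<Oplus>\<^bsub>E\<^esub>i\<in>{..<Suc p}. insertion E p q (Suc i) f Q xs)"
    using c by (intro M.finsum_reindex) (auto simp: i)
  also have "\<dots> = ins E q f Q xs"
    unfolding i by (rule shuffle_sum_ins[OF _ _ xs']) (use f Q in auto)
  finally show ?thesis .
qed

section \<open>Graded symmetry of the associator\<close>

context module
begin

text \<open>\<open>a\<close> and \<open>b\<close> are the degrees of \<open>P\<close> and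
  \<open>Q\<close>. The terms with \<open>Q\<close> nested inside \<open>P\<close> occur in both
  compositions and cancel; what is left inserts \<open>P\<close> and \<open>Q\<close> into separate
  slots of \<open>f\<close>, which is why a symmetry can be expected.\<close>

definition associator ::
  "nat \<Rightarrow> nat \<Rightarrow> ('c list \<Rightarrow> 'c) \<Rightarrow> ('c list \<Rightarrow> 'c) \<Rightarrow> ('c list \<Rightarrow> 'c) \<Rightarrow> 'c list \<Rightarrow> 'c" where
  "associator a b f P Q xs = ins M b (ins M a f P) Q xs \<ominus>\<^bsub>M\<^esub> ins M (a + b) f (ins M b P Q) xs"

lemma associator_closed:
  assumes "multilinear R M M p f" "multilinear R M M (Suc a) P" "multilinear R M M (Suc b) Q"
    "xs \<in> tuples M (p + a + b)"
  shows "ins M b (ins M a f P) Q xs \<in> carrier M" "ins M (a + b) f (ins M b P Q) xs \<in> carrier M"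
    "associator a b f P Q xs \<in> carrier M"
proof -
  have 1: "multilinear R M M (p + a + b) (ins M b (ins M a f P) Q)"
    using assms by (intro multilinear_ins)
  have "multilinear R M M (Suc (a + b)) (ins M b P Q)"
    using multilinear_ins[OF assms(2,3)] by simp
  then have 2: "multilinear R M M (p + a + b) (ins M (a + b) f (ins M b P Q))"
    using multilinear_ins[OF assms(1)] by (simp add: add.assoc)
  show "ins M b (ins M a f P) Q xs \<in> carrier M" "ins M (a + b) f (ins M b P Q) xs \<in> carrier M"
    using multilinear_closed[OF 1 assms(4)] multilinear_closed[OF 2 assms(4)] .
  then show "associator a b f P Q xs \<in> carrier M" by (simp add: associator_def)
qed

text \<open>
  The contributions of the lists that start with \<open>x\<close> in which \<open>x\<close> is absorbed by \<open>P\<close>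
  (\<open>head_term\<close>) or by \<open>Q\<close> (\<open>tail_term\<close>); the two are exchanged when \<open>P\<close> and \<open>Q\<close> are.
\<close>

definition head_term :: "nat \<Rightarrow> nat \<Rightarrow> ('c list \<Rightarrow> 'c) \<Rightarrow> ('c list \<Rightarrow> 'c) \<Rightarrow> ('c list \<Rightarrow> 'c) \<Rightarrow> 'c \<Rightarrow> 'c list \<Rightarrow> 'c" where
  "head_term a b f P Q x xs = (case a of
     0 \<Rightarrow> ins M b (\<lambda>ys. f (P [x] # ys)) Q xs
   | Suc a' \<Rightarrow> associator a' b f (\<lambda>ys. P (x # ys)) Q xs)"

definition tail_term :: "nat \<Rightarrow> nat \<Rightarrow> ('c list \<Rightarrow> 'c) \<Rightarrow> ('c list \<Rightarrow> 'c) \<Rightarrow> ('c list \<Rightarrow> 'c) \<Rightarrow> 'c \<Rightarrow> 'c list \<Rightarrow> 'c" where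
  "tail_term a b f P Q x xs = (case b of
     0 \<Rightarrow> signed M a (ins M a (\<lambda>ys. f (Q [x] # ys)) P xs)
   | Suc b' \<Rightarrow> associator a b' f P (\<lambda>ys. Q (x # ys)) xs)"

text \<open>The signs record what \<open>x\<close> has to pass. To reach \<open>f\<close> it passes
  the open slots of both \<open>P\<close> and \<open>Q\<close>, to reach \<open>P\<close> only those
  of \<open>Q\<close>, and to reach \<open>Q\<close> none.\<close>

lemma associator_Cons:
  assumes f: "multilinear R M M (Suc p) f" and P: "multilinear R M M (Suc a) P" and Q: "multilinear R M M (Suc b) Q"
    and x: "x \<in> carrier M" and xs: "xs \<in> tuples M (p + a + b)"
  shows "associator a b f P Q (x # xs) =
    signed M (a + b) (associator a b (\<lambda>ys. f (x # ys)) P Q xs) \<oplus>\<^bsub>M\<^esub>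
    (signed M b (head_term a b f P Q x xs) \<oplus>\<^bsub>M\<^esub> tail_term a b f P Q x xs)"
proof -
  let ?fx = "\<lambda>ys. f (x # ys)" and ?Px = "\<lambda>ys. P (x # ys)" and ?Qx = "\<lambda>ys. Q (x # ys)"
  note fx = multilinear_Cons[OF f x] and Px = multilinear_Cons[OF P x] and Qx = multilinear_Cons[OF Q x]
  note mt = multilinear_maps_to
  note U = associator_closed[OF fx P Q xs]
  have PQ: "multilinear R M M (Suc (a + b)) (ins M b P Q)"
    using multilinear_ins[OF P Q] by simp
  have fxP: "multilinear R M M (p + a) (ins M a ?fx P)"
    by (rule multilinear_ins[OF fx P])
  note group = M.minus_eq M.minus_add M.signed_add M.signed_signed M.signed_minus M.a_ac M.minus_minus
  define U1 where "U1 = ins M b (ins M a ?fx P) Q xs"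
  define U2 where "U2 = ins M (a + b) ?fx (ins M b P Q) xs"
  have U12: "U1 \<in> carrier M" "U2 \<in> carrier M" using U by (auto simp: U1_def U2_def)
  have assocU: "associator a b ?fx P Q xs = U1 \<ominus>\<^bsub>M\<^esub> U2"
    by (simp add: associator_def U1_def U2_def)
  \<comment> \<open>\<open>V\<close> and \<open>V'\<close> are the shares of
    \<open>head_term\<close> in the two compositions. For \<open>a = 0\<close> the argument
    completes \<open>P\<close>, and the second composition has no share.\<close>
  define V where "V = (case a of 0 \<Rightarrow> ins M b (\<lambda>ys. f (P [x] # ys)) Q xs | Suc a' \<Rightarrow> ins M b (ins M a' f ?Px) Q xs)"
  define V' where "V' = (case a of 0 \<Rightarrow> \<zero>\<^bsub>M\<^esub> | Suc a' \<Rightarrow> ins M (a' + b) f (ins M b ?Px Q) xs)"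
  have head: "head_term a b f P Q x xs = V \<ominus>\<^bsub>M\<^esub> V'" and VV': "V \<in> carrier M" "V' \<in> carrier M"
    and L1: "ins M b (\<lambda>ys. ins M a f P (x # ys)) Q xs = signed M a U1 \<oplus>\<^bsub>M\<^esub> V"
  proof -
    have "V \<in> carrier M \<and> V' \<in> carrier M \<and> head_term a b f P Q x xs = V \<ominus>\<^bsub>M\<^esub> V' \<and>
      ins M b (\<lambda>ys. ins M a f P (x # ys)) Q xs = signed M a U1 \<oplus>\<^bsub>M\<^esub> V"
    proof (cases a)
      case 0
      have "P [x] \<in> carrier M" using mt[OF P] x 0 by simp
      then have fP: "maps_to p (\<lambda>ys. f (P [x] # ys))" by (intro mt multilinear_Cons[OF f])
      have "ins M b (\<lambda>ys. ins M 0 f P (x # ys)) Q xs = U1 \<oplus>\<^bsub>M\<^esub> ins M b (\<lambda>ys. f (P [x] # ys)) Q xs"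
        using ins_add_left[of p "ins M 0 ?fx P" "\<lambda>ys. f (P [x] # ys)" b Q xs] mt[OF fxP] fP mt[OF Q] xs 0
        by (simp add: U1_def)
      moreover have "ins M b (\<lambda>ys. f (P [x] # ys)) Q xs \<in> carrier M"
        using fP mt[OF Q] xs 0 by (intro ins_closed) auto
      ultimately show ?thesis using 0 by (simp add: V_def V'_def head_term_def M.minus_eq)
    next
      case (Suc a')
      have Px': "multilinear R M M (Suc a') ?Px" using Px Suc by simp
      have xs': "xs \<in> tuples M (Suc p + a' + b)" using xs Suc by simp
      note c = associator_closed[OF f Px' Q xs']
      have m: "maps_to (p + a) (ins M a ?fx P)" "maps_to (p + a) (ins M a' f ?Px)"
        using mt[OF fxP] mt[OF multilinear_ins[OF f Px']] Suc by auto
      have "ins M b (\<lambda>ys. ins M a f P (x # ys)) Q xs =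
          ins M b (\<lambda>ys. signed M a (ins M a ?fx P ys)) Q xs \<oplus>\<^bsub>M\<^esub> ins M b (ins M a' f ?Px) Q xs"
        using ins_add_left[of "p + a" "\<lambda>ys. signed M a (ins M a ?fx P ys)" "ins M a' f ?Px" b Q xs] m mt[OF Q] xs Suc
        by simp
      also have "ins M b (\<lambda>ys. signed M a (ins M a ?fx P ys)) Q xs = signed M a U1"
        unfolding U1_def by (rule ins_signed_left[OF m(1) mt[OF Q] xs])
      finally show ?thesis using c Suc by (simp add: V_def V'_def head_term_def associator_def)
    qed
    then show "head_term a b f P Q x xs = V \<ominus>\<^bsub>M\<^esub> V'" "V \<in> carrier M" "V' \<in> carrier M"
      "ins M b (\<lambda>ys. ins M a f P (x # ys)) Q xs = signed M a U1 \<oplus>\<^bsub>M\<^esub> V" by blast+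
  qed
  \<comment> \<open>\<open>c\<close> is the index left after \<open>ins M (a + b)\<close> has
    absorbed \<open>x\<close>. For \<open>a = 0\<close> the map \<open>?Px\<close> has no arguments
    left, so nothing can be inserted into it and the inner composition vanishes.\<close>
  have L2: "ins M c f (ins M b ?Px Q) xs = V'" if "a + b = Suc c" for c
  proof (cases a)
    case 0
    have "ins M c f (ins M b ?Px Q) xs = ins M c f (\<lambda>_. \<zero>\<^bsub>M\<^esub>) xs"
      using xs that 0 by (intro ins_cong[of "Suc p"]) (auto simp: tuples_def intro!: ins_short)
    also have "\<dots> = \<zero>\<^bsub>M\<^esub>"
      using xs that 0 by (intro ins_zero_right[OF f]) auto
    finally show ?thesis using 0 by (simp add: V'_def)
  next
    case (Suc a')
    then show ?thesis using that by (simp add: V'_def)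
  qed
  have PxQ: "maps_to (a + b) (ins M b ?Px Q)"
    by (rule mt[OF multilinear_ins[OF Px Q]])
  show ?thesis
  proof (cases b)
    case 0
    have Qx0: "Q [x] \<in> carrier M" using mt[OF Q] x 0 by simp
    note fQ = multilinear_Cons[OF f Qx0]
    define W where "W = ins M a (\<lambda>ys. f (Q [x] # ys)) P xs"
    have W: "W \<in> carrier M" unfolding W_def using mt[OF fQ] mt[OF P] xs 0 by (intro ins_closed) auto
    have tail: "tail_term a b f P Q x xs = signed M a W" using 0 by (simp add: tail_term_def W_def)
    have l: "ins M b (ins M a f P) Q (x # xs) = (signed M a U1 \<oplus>\<^bsub>M\<^esub> V) \<oplus>\<^bsub>M\<^esub> ins M a f P (Q [x] # xs)"
      using L1 0 by simp
    show ?thesis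
    proof (cases a)
      case a0: 0
      have PQx: "P [Q [x]] \<in> carrier M" using mt[OF P] Qx0 a0 by simp
      \<comment> \<open>\<open>T\<close> is the term in which \<open>Q [x]\<close> is fed to
        \<open>P\<close>. It appears in both compositions and cancels; the same happens with the
        \<open>T\<close> for positive \<open>a\<close> below.\<close>
      define T where "T = f (P [Q [x]] # xs)"
      have T: "T \<in> carrier M"
        unfolding T_def using mt[OF f] PQx xs 0 a0 by simp
      have "ins M a f P (Q [x] # xs) = W \<oplus>\<^bsub>M\<^esub> T"
        using a0 by (simp add: W_def T_def)
      moreover have "ins M (a + b) f (ins M b P Q) (x # xs) = U2 \<oplus>\<^bsub>M\<^esub> T"
        using a0 0 PQx by (simp add: U2_def T_def)
      ultimately have "associator a b f P Q (x # xs) = (signed M a U1 \<oplus>\<^bsub>M\<^esub> V \<oplus>\<^bsub>M\<^esub> (W \<oplus>\<^bsub>M\<^esub> T)) \<ominus>\<^bsub>M\<^esub> (U2 \<oplus>\<^bsub>M\<^esub> T)"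
        unfolding associator_def[of a b f] l by simp
      also have "\<dots> = (signed M a U1 \<oplus>\<^bsub>M\<^esub> V \<oplus>\<^bsub>M\<^esub> W) \<ominus>\<^bsub>M\<^esub> U2"
        using U12 VV' W T by (subst M.a_assoc[symmetric]) (auto intro!: M.add_diff_add_right)
      finally show ?thesis
        unfolding assocU head tail using U12 VV' W a0 0 by (simp add: group V'_def)
    next
      case (Suc a')
      have PQx: "multilinear R M M (Suc a') (\<lambda>ys. P (Q [x] # ys))"
        using multilinear_Cons[OF P Qx0] Suc by simp
      define T where "T = ins M a' f (\<lambda>ys. P (Q [x] # ys)) xs"
      have T: "T \<in> carrier M"
        unfolding T_def using mt[OF f] mt[OF PQx] xs Suc 0 by (intro ins_closed) auto
      have 1: "ins M a f P (Q [x] # xs) = signed M a W \<oplus>\<^bsub>M\<^esub> T"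
        using Suc by (simp add: W_def T_def)
      have "ins M a' f (\<lambda>ys. ins M b P Q (x # ys)) xs = ins M a' f (ins M b ?Px Q) xs \<oplus>\<^bsub>M\<^esub> T"
        using ins_add_right[OF f, of a' "ins M b ?Px Q" "\<lambda>ys. P (Q [x] # ys)" xs] PxQ mt[OF PQx] xs Suc 0
        by (simp add: T_def)
      then have 2: "ins M (a + b) f (ins M b P Q) (x # xs) = signed M a U2 \<oplus>\<^bsub>M\<^esub> (V' \<oplus>\<^bsub>M\<^esub> T)"
        using Suc 0 L2[of a'] by (simp add: U2_def)
      have "associator a b f P Q (x # xs) =
          (signed M a U1 \<oplus>\<^bsub>M\<^esub> V \<oplus>\<^bsub>M\<^esub> (signed M a W \<oplus>\<^bsub>M\<^esub> T)) \<ominus>\<^bsub>M\<^esub> (signed M a U2 \<oplus>\<^bsub>M\<^esub> (V' \<oplus>\<^bsub>M\<^esub> T))"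
        unfolding associator_def[of a b f] l 1 2 ..
      also have "\<dots> = (signed M a U1 \<oplus>\<^bsub>M\<^esub> V \<oplus>\<^bsub>M\<^esub> signed M a W) \<ominus>\<^bsub>M\<^esub> (signed M a U2 \<oplus>\<^bsub>M\<^esub> V')"
        using U12 VV' W T by (subst (1 2) M.a_assoc[symmetric]) (auto intro!: M.add_diff_add_right)
      finally show ?thesis
        unfolding assocU head tail using U12 VV' W 0 by (simp add: group)
    qed
  next
    case (Suc b')
    have Qx': "multilinear R M M (Suc b') ?Qx" using Qx Suc by simp
    have xs': "xs \<in> tuples M (Suc p + a + b')" using xs Suc by simp
    define W where "W = ins M b' (ins M a f P) ?Qx xs"
    define W' where "W' = ins M (a + b') f (ins M b' P ?Qx) xs"
    have W: "W \<in> carrier M" "W' \<in> carrier M"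
      using associator_closed[OF f P Qx' xs'] by (auto simp: W_def W'_def)
    have tail: "tail_term a b f P Q x xs = W \<ominus>\<^bsub>M\<^esub> W'"
      using Suc by (simp add: tail_term_def associator_def W_def W'_def)
    have l: "ins M b (ins M a f P) Q (x # xs) = signed M b (signed M a U1 \<oplus>\<^bsub>M\<^esub> V) \<oplus>\<^bsub>M\<^esub> W"
      using L1 Suc by (simp add: W_def)
    have m: "maps_to (Suc (a + b')) (\<lambda>ys. signed M b (ins M b ?Px Q ys))" "maps_to (Suc (a + b')) (ins M b ?Px Q)"
      "maps_to (Suc (a + b')) (ins M b' P ?Qx)"
      using PxQ mt[OF multilinear_ins[OF P Qx']] Suc by auto
    have "ins M (a + b') f (\<lambda>ys. ins M b P Q (x # ys)) xs =
        ins M (a + b') f (\<lambda>ys. signed M b (ins M b ?Px Q ys)) xs \<oplus>\<^bsub>M\<^esub> W'"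
      using ins_add_right[OF f, of "a + b'" "\<lambda>ys. signed M b (ins M b ?Px Q ys)" "ins M b' P ?Qx" xs] m xs Suc
      by (simp add: W'_def add.assoc)
    also have "ins M (a + b') f (\<lambda>ys. signed M b (ins M b ?Px Q ys)) xs = signed M b V'"
      using ins_signed_right[OF f m(2), of xs b] xs Suc L2[of "a + b'"] by (simp add: add.assoc)
    finally have 2: "ins M (a + b) f (ins M b P Q) (x # xs) = signed M (a + b) U2 \<oplus>\<^bsub>M\<^esub> (signed M b V' \<oplus>\<^bsub>M\<^esub> W')"
      using Suc by (simp add: U2_def)
    show ?thesis
      unfolding associator_def[of a b f] l assocU head tail 2 using U12 VV' W
      by (simp add: group add.commute[of b a])
  qed
qed

lemma associator_zero:
  assumes "multilinear R M M 0 f" "multilinear R M M (Suc a) P" "multilinear R M M (Suc b) Q" "xs \<in> tuples M (a + b)"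
  shows "associator a b f P Q xs = \<zero>\<^bsub>M\<^esub>"
proof -
  have "ins M b (ins M a f P) Q xs = \<zero>\<^bsub>M\<^esub>"
    by (rule ins_zero_left[OF _ multilinear_maps_to[OF assms(3)] assms(4)]) (simp add: ins_short length_tuples)
  moreover have "ins M (a + b) f (ins M b P Q) xs = \<zero>\<^bsub>M\<^esub>"
    using assms by (intro ins_short) (simp add: tuples_def)
  ultimately show ?thesis by (simp add: associator_def M.minus_eq)
qed

text \<open>In \<open>associator_Cons\<close> the first term is symmetric by induction, and
  exchanging \<open>P\<close> and \<open>Q\<close> exchanges the other two. If \<open>P\<close>
  absorbs \<open>x\<close>, the induction supplies the exponent \<open>(a - 1) * b\<close>, and the
  sign \<open>b\<close> in front of \<open>head_term\<close> completes it to
  \<open>a * b\<close>.\<close>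

lemma associator_symmetric:
  assumes "multilinear R M M p f" "multilinear R M M (Suc a) P" "multilinear R M M (Suc b) Q"
    "xs \<in> tuples M (p + a + b)"
  shows "associator a b f P Q xs = signed M (a * b) (associator b a f Q P xs)"
  using assms
proof (induction xs arbitrary: p a b f P Q)
  case Nil
  then have "p = 0" "a = 0" "b = 0" by auto
  then show ?case using associator_zero[of f 0 P 0 Q "[]"] associator_zero[of f 0 Q 0 P "[]"] Nil.prems by simp
next
  case (Cons x xs)
  show ?case
  proof (cases p)
    case 0
    then show ?thesis
      using associator_zero[of f a P b Q "x # xs"] associator_zero[of f b Q a P "x # xs"] Cons.prems
      by (simp add: add.commute)
  next
    case (Suc p')
    note f = Cons.prems(1)[unfolded Suc] and P = Cons.prems(2) and Q = Cons.prems(3)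
    have x: "x \<in> carrier M" and xs: "xs \<in> tuples M (p' + a + b)"
      using Cons.prems(4) Suc by auto
    have xs': "xs \<in> tuples M (p' + b + a)"
      using xs by (simp add: add.commute add.left_commute)

    note fx = multilinear_Cons[OF f x] and Px = multilinear_Cons[OF P x] and Qx = multilinear_Cons[OF Q x]
    note mt = multilinear_maps_to
    let ?fx = "\<lambda>ys. f (x # ys)"
    have IH0: "associator a b ?fx P Q xs = signed M (a * b) (associator b a ?fx Q P xs)"
      by (rule Cons.IH[OF fx P Q xs])
    have c0: "associator b a ?fx Q P xs \<in> carrier M"
      by (rule associator_closed[OF fx Q P xs'])
    \<comment> \<open>Stated for fresh \<open>a\<close>, \<open>b\<close>, \<open>P\<close> and
      \<open>Q\<close> because it is applied a second time with the roles exchanged.\<close>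
    have ht: "signed M b (head_term a b f P Q x xs) = signed M (a * b) (tail_term b a f Q P x xs)"
      and tc: "tail_term b a f Q P x xs \<in> carrier M"
      if P: "multilinear R M M (Suc a) P" and Q: "multilinear R M M (Suc b) Q"
        and xs: "xs \<in> tuples M (p' + a + b)"
        and IH: "\<And>a'. a = Suc a' \<Longrightarrow> associator a' b f (\<lambda>ys. P (x # ys)) Q xs =
          signed M (a' * b) (associator b a' f Q (\<lambda>ys. P (x # ys)) xs)"
      for a b P Q
    proof -
      have "signed M b (head_term a b f P Q x xs) = signed M (a * b) (tail_term b a f Q P x xs) \<and>
        tail_term b a f Q P x xs \<in> carrier M"
      proof (cases a)
        case 0
        have "P [x] \<in> carrier M" using mt[OF P] x 0 by simp
        then have "maps_to p' (\<lambda>ys. f (P [x] # ys))" by (intro mt multilinear_Cons[OF f])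
        then have "ins M b (\<lambda>ys. f (P [x] # ys)) Q xs \<in> carrier M"
          using mt[OF Q] xs 0 by (intro ins_closed) auto
        then show ?thesis using 0 by (simp add: head_term_def tail_term_def)
      next
        case (Suc a')
        have P': "multilinear R M M (Suc a') (\<lambda>ys. P (x # ys))"
          using multilinear_Cons[OF P x] Suc by simp
        have "associator b a' f Q (\<lambda>ys. P (x # ys)) xs \<in> carrier M"
          using xs Suc by (intro associator_closed(3)[OF f Q P']) (simp add: add.commute add.left_commute)
        then show ?thesis
          using Suc IH[OF Suc] by (simp add: head_term_def tail_term_def M.signed_signed)
      qed
      then show "signed M b (head_term a b f P Q x xs) = signed M (a * b) (tail_term b a f Q P x xs)"
        "tail_term b a f Q P x xs \<in> carrier M" by blast+
    qed
    have IH1: "associator a' b f (\<lambda>ys. P (x # ys)) Q xs =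
          signed M (a' * b) (associator b a' f Q (\<lambda>ys. P (x # ys)) xs)" if "a = Suc a'" for a'
      using xs that Px by (intro Cons.IH[OF f _ Q]) auto
    have IH2: "associator b' a f (\<lambda>ys. Q (x # ys)) P xs =
          signed M (b' * a) (associator a b' f P (\<lambda>ys. Q (x # ys)) xs)" if "b = Suc b'" for b'
      using xs' that Qx by (intro Cons.IH[OF f _ P]) auto
    have h1: "signed M b (head_term a b f P Q x xs) = signed M (a * b) (tail_term b a f Q P x xs)"
      "tail_term b a f Q P x xs \<in> carrier M"
      by (rule ht[OF P Q xs IH1] tc[OF P Q xs IH1]; assumption)+
    have h2: "signed M a (head_term b a f Q P x xs) = signed M (b * a) (tail_term a b f P Q x xs)"
      "tail_term a b f P Q x xs \<in> carrier M"
      by (rule ht[OF Q P xs' IH2] tc[OF Q P xs' IH2]; assumption)+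
    define H where "H = head_term b a f Q P x xs"
    have Hc: "signed M a H \<in> carrier M" using h2 by (simp add: H_def)
    have "signed M (a * b) (signed M a H) = signed M (a * b) (signed M (b * a) (tail_term a b f P Q x xs))"
      using h2 by (simp add: H_def)
    also have "\<dots> = tail_term a b f P Q x xs"
      using h2(2) by (simp add: M.signed_signed mult.commute signed_def)
    finally have t: "tail_term a b f P Q x xs = signed M (a * b) (signed M a H)" by simp
    have "associator a b f P Q (x # xs) =
      signed M (a + b) (signed M (a * b) (associator b a ?fx Q P xs)) \<oplus>\<^bsub>M\<^esub>
      (signed M (a * b) (tail_term b a f Q P x xs) \<oplus>\<^bsub>M\<^esub> signed M (a * b) (signed M a H))"
      unfolding associator_Cons[OF f P Q x xs] IH0 h1(1) t ..
    also have "\<dots> = signed M (a * b) (signed M (b + a) (associator b a ?fx Q P xs) \<oplus>\<^bsub>M\<^esub>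
      (signed M a H \<oplus>\<^bsub>M\<^esub> tail_term b a f Q P x xs))"
      using c0 h1(2) Hc by (simp add: M.signed_add M.signed_signed[of "associator b a ?fx Q P xs"] M.a_ac ac_simps)
    also have "\<dots> = signed M (a * b) (associator b a f Q P (x # xs))"
      unfolding associator_Cons[OF f Q P x xs'] H_def ..
    finally show ?thesis .
  qed
qed

end

section \<open>The Balavoine bracket\<close>

text \<open>
  The library sets up the method \<open>algebra\<close> for rings only. These rules make it prove identities in
  abelian groups.
\<close>

lemmas (in abelian_group) abelian_group_simprules
  [algebra abelian_group "zero G" "add G" "a_inv G" "a_minus G"] =
  a_closed zero_closed a_inv_closed minus_closed
  a_assoc l_zero l_neg a_comm minus_eq
  r_zero r_neg r_neg2 r_neg1 minus_add minus_minus minus_zero_group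
  a_lcomm

lemma (in abelian_group) signed_skew:
  assumes "x \<in> carrier G" "y \<in> carrier G"
  shows "x \<ominus> signed G n y = \<ominus> (signed G n (y \<ominus> signed G n x))"
  using assms by (cases "even n"; simp only: signed_def if_True if_False; algebra)

text \<open>The Jacobi identity with its twelve double compositions as group elements:
  \<open>a\<close> to \<open>f\<close> are those of the form A(BC), and the six letters at the end
  of the alphabet are those of the form (AB)C. The equations for \<open>x\<close>, \<open>y\<close>
  and \<open>z\<close> are the three associator symmetries; after eliminating these letters,
  everything cancels for each of the eight parity patterns.\<close>

lemma (in abelian_group) signed_jacobi:
  assumes "a \<in> carrier G" "b \<in> carrier G" "c \<in> carrier G" "d \<in> carrier G" "e \<in> carrier G" "f \<in> carrier G"
    "x' \<in> carrier G" "y' \<in> carrier G" "z' \<in> carrier G"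
  assumes "x = a \<oplus> signed G (q * r) (x' \<ominus> b)" "y = c \<oplus> signed G (p * r) (y' \<ominus> d)"
    "z = e \<oplus> signed G (p * q) (z' \<ominus> f)"
  shows "(a \<ominus> signed G (q * r) b) \<ominus> signed G (p * (q + r)) (y' \<ominus> signed G (q * r) z') =
    \<ominus> (signed G ((p + q) * r) ((e \<ominus> signed G (p * q) f) \<ominus> signed G (r * (p + q)) (x \<ominus> signed G (p * q) y))) \<oplus>
    signed G (p * q) ((c \<ominus> signed G (p * r) d) \<ominus> signed G (q * (p + r)) (x' \<ominus> signed G (p * r) z))"
  unfolding assms(10-12) using assms(1-9)
  by (cases "even p"; cases "even q"; cases "even r";
      simp only: signed_def even_mult_iff even_add if_True if_False simp_thms; algebra)

context module
begin

lemma module_hom_smult_fun: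
  assumes "f \<in> module_hom R Z M" "a \<in> carrier R"
  shows "(\<lambda>x. a \<odot>\<^bsub>M\<^esub> f x) \<in> module_hom R Z M"
proof -
  have "a \<odot>\<^bsub>M\<^esub> (b \<odot>\<^bsub>M\<^esub> x) = b \<odot>\<^bsub>M\<^esub> (a \<odot>\<^bsub>M\<^esub> x)" if "b \<in> carrier R" "x \<in> carrier M" for b x
    using that assms(2) by (simp add: smult_assoc1[symmetric] R.m_comm)
  then show ?thesis
    using assms by (auto simp: module_hom_def Pi_def smult_r_distr)
qed

lemma multilinear_smult:
  assumes "multilinear R V M n f" "a \<in> carrier R"
  shows "multilinear R V M n (\<lambda>xs. a \<odot>\<^bsub>M\<^esub> f xs)"
  using assms by (auto simp: multilinear_def intro: module_hom_smult_fun)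

lemma multilinear_zero: "multilinear R V M n (\<lambda>_. \<zero>\<^bsub>M\<^esub>)"
  by (auto simp: multilinear_def module_hom_def)

lemma multilinear_minus:
  assumes "multilinear R V M n f"
  shows "multilinear R V M n (\<lambda>xs. \<ominus>\<^bsub>M\<^esub> f xs)"
  using multilinear_signed[OF assms, of 1] by (simp add: signed_def)

lemma multilinear_diff:
  assumes "multilinear R V M n f" "multilinear R V M n g"
  shows "multilinear R V M n (\<lambda>xs. f xs \<ominus>\<^bsub>M\<^esub> g xs)"
  unfolding M.minus_eq using assms by (intro multilinear_add multilinear_minus)

end

section \<open>Hom spaces and the axioms of the Balavoine bracket\<close>

lemma multilinear_mapsI:
  assumes "multilinear K V W n f" "module K V"
  shows "restrict f (tuples V n) \<in> multilinear_maps K V W n"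
  using assms(1) multilinear_cong[of V n "restrict f (tuples V n)" f K W] assms(2)
  by (simp add: multilinear_maps_iff)

lemma restrict_eqI: "f \<in> extensional A \<Longrightarrow> (\<And>x. x \<in> A \<Longrightarrow> g x = f x) \<Longrightarrow> restrict g A = f"
  by (rule extensionalityI[of _ A]) auto

lemma multilinear_maps_ext:
  assumes "f \<in> multilinear_maps K V W n" "g \<in> multilinear_maps K V W n"
    "\<And>xs. xs \<in> tuples V n \<Longrightarrow> f xs = g xs"
  shows "f = g"
  using assms by (auto simp: multilinear_maps_iff intro: extensionalityI)

lemma hom_space_simps [simp]:
  "carrier (hom_space K V W n) = multilinear_maps K V W n"
  "\<zero>\<^bsub>hom_space K V W n\<^esub> = (\<lambda>xs\<in>tuples V n. \<zero>\<^bsub>W\<^esub>)"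
  "f \<oplus>\<^bsub>hom_space K V W n\<^esub> g = (\<lambda>xs\<in>tuples V n. f xs \<oplus>\<^bsub>W\<^esub> g xs)"
  "a \<odot>\<^bsub>hom_space K V W n\<^esub> f = (\<lambda>xs\<in>tuples V n. a \<odot>\<^bsub>W\<^esub> f xs)"
  by (simp_all add: hom_space_def)

lemma multilinear_maps_closed:
  "f \<in> multilinear_maps K V W n \<Longrightarrow> xs \<in> tuples V n \<Longrightarrow> f xs \<in> carrier W"
  unfolding multilinear_maps_iff by (blast intro: multilinear_closed)

lemma module_hom_space:
  assumes "module K V" "module K W"
  shows "module K (hom_space K V W n)"
proof -
  interpret W: module K W by fact
  note c = multilinear_maps_closed[of _ K V W n]
  have ml: "multilinear K V W n f" if "f \<in> multilinear_maps K V W n" for f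
    using that by (simp add: multilinear_maps_iff)
  show ?thesis
  proof (rule module_criteria)
    show "cring K" by (rule W.R.is_cring)
    let ?H = "hom_space K V W n"
    show "\<zero>\<^bsub>?H\<^esub> \<in> carrier ?H"
      using multilinear_mapsI[OF W.multilinear_zero assms(1)] by simp
    show "\<forall>v w. v \<in> carrier ?H \<and> w \<in> carrier ?H \<longrightarrow> v \<oplus>\<^bsub>?H\<^esub> w \<in> carrier ?H"
      using multilinear_mapsI[OF W.multilinear_add[OF ml ml] assms(1)] by simp
    show "\<forall>v\<in>carrier ?H. \<exists>u\<in>carrier ?H. v \<oplus>\<^bsub>?H\<^esub> u = \<zero>\<^bsub>?H\<^esub>"
    proof
      fix v assume v: "v \<in> carrier ?H"
      then show "\<exists>u\<in>carrier ?H. v \<oplus>\<^bsub>?H\<^esub> u = \<zero>\<^bsub>?H\<^esub>"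
        using multilinear_mapsI[OF W.multilinear_minus[OF ml] assms(1), of v] c[of v]
        by (intro bexI[of _ "\<lambda>xs\<in>tuples V n. \<ominus>\<^bsub>W\<^esub> v xs"]) (auto simp: W.M.r_neg)
    qed
    show "\<forall>a v. a \<in> carrier K \<and> v \<in> carrier ?H \<longrightarrow> a \<odot>\<^bsub>?H\<^esub> v \<in> carrier ?H"
      using multilinear_mapsI[OF W.multilinear_smult[OF ml] assms(1)] by simp
    show "\<forall>v w. v \<in> carrier ?H \<and> w \<in> carrier ?H \<longrightarrow> v \<oplus>\<^bsub>?H\<^esub> w = w \<oplus>\<^bsub>?H\<^esub> v"
      using c by (auto simp: W.M.a_comm)
    show "\<forall>v w x. v \<in> carrier ?H \<and> w \<in> carrier ?H \<and> x \<in> carrier ?H \<longrightarrow>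
        v \<oplus>\<^bsub>?H\<^esub> w \<oplus>\<^bsub>?H\<^esub> x = v \<oplus>\<^bsub>?H\<^esub> (w \<oplus>\<^bsub>?H\<^esub> x)"
      using c by (auto simp: W.M.a_assoc)
    show "\<forall>v\<in>carrier ?H. v \<oplus>\<^bsub>?H\<^esub> \<zero>\<^bsub>?H\<^esub> = v"
    proof
      fix v assume v: "v \<in> carrier ?H"
      then show "v \<oplus>\<^bsub>?H\<^esub> \<zero>\<^bsub>?H\<^esub> = v"
        using c[of v] by (auto simp: multilinear_maps_iff intro!: restrict_eqI)
    qed
    show "\<forall>a b v. a \<in> carrier K \<and> b \<in> carrier K \<and> v \<in> carrier ?H \<longrightarrow>
        (a \<otimes>\<^bsub>K\<^esub> b) \<odot>\<^bsub>?H\<^esub> v = a \<odot>\<^bsub>?H\<^esub> (b \<odot>\<^bsub>?H\<^esub> v)"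
      using c by (auto simp: W.smult_assoc1)
    show "\<forall>v\<in>carrier ?H. \<one>\<^bsub>K\<^esub> \<odot>\<^bsub>?H\<^esub> v = v"
    proof
      fix v assume v: "v \<in> carrier ?H"
      then show "\<one>\<^bsub>K\<^esub> \<odot>\<^bsub>?H\<^esub> v = v"
        using c[of v] by (auto simp: multilinear_maps_iff intro!: restrict_eqI)
    qed
    show "\<forall>a b v. a \<in> carrier K \<and> b \<in> carrier K \<and> v \<in> carrier ?H \<longrightarrow>
        (a \<oplus>\<^bsub>K\<^esub> b) \<odot>\<^bsub>?H\<^esub> v = a \<odot>\<^bsub>?H\<^esub> v \<oplus>\<^bsub>?H\<^esub> b \<odot>\<^bsub>?H\<^esub> v"
      using c by (auto simp: W.smult_l_distr)
    show "\<forall>a v w. a \<in> carrier K \<and> v \<in> carrier ?H \<and> w \<in> carrier ?H \<longrightarrow>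
        a \<odot>\<^bsub>?H\<^esub> (v \<oplus>\<^bsub>?H\<^esub> w) = a \<odot>\<^bsub>?H\<^esub> v \<oplus>\<^bsub>?H\<^esub> a \<odot>\<^bsub>?H\<^esub> w"
      using c by (auto simp: W.smult_r_distr)
  qed
qed

lemma hom_space_minus:
  assumes "module K V" "module K W" "f \<in> multilinear_maps K V W n"
  shows "\<ominus>\<^bsub>hom_space K V W n\<^esub> f = (\<lambda>xs\<in>tuples V n. \<ominus>\<^bsub>W\<^esub> f xs)"
proof -
  interpret W: module K W by fact
  interpret H: module K "hom_space K V W n" by (rule module_hom_space) fact+
  have "(\<lambda>xs\<in>tuples V n. \<ominus>\<^bsub>W\<^esub> f xs) \<in> multilinear_maps K V W n"
    using assms by (intro multilinear_mapsI W.multilinear_minus) (auto simp: multilinear_maps_iff)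
  then show ?thesis
    using assms(3) multilinear_maps_closed[OF assms(3)]
    by (intro H.M.minus_equality) (auto simp: W.M.l_neg)
qed

lemma hom_space_signed:
  assumes "module K V" "module K W" "f \<in> multilinear_maps K V W n"
  shows "signed (hom_space K V W n) k f = (\<lambda>xs\<in>tuples V n. signed W k (f xs))"
  using assms by (auto simp: signed_def hom_space_minus multilinear_maps_iff intro!: restrict_eqI[symmetric])

lemma hom_space_eval:
  "xs \<in> tuples V n \<Longrightarrow> (\<lambda>f. f xs) \<in> module_hom K (hom_space K V W n) W"
  by (auto simp: module_hom_def multilinear_maps_closed)

lemma balavoine_eq:
  fixes E :: "('k, 'e) module"
  assumes "module K E" "P \<in> multilinear_maps K E E (Suc p)" "Q \<in> multilinear_maps K E E (Suc q)"
    "xs \<in> tuples E (Suc (p + q))"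
  shows "balavoine E p q P Q xs = ins E q P Q xs \<ominus>\<^bsub>E\<^esub> signed E (p * q) (ins E p Q P xs)"
proof -
  interpret module K E by fact
  note c = multilinear_maps_closed[OF assms(2)] multilinear_maps_closed[OF assms(3)]
  have "ins E p Q P xs \<in> carrier E"
    using c assms(4) by (intro ins_closed[of "Suc q"]) (auto simp: add.commute)
  then show ?thesis
    using assms(4) bar_comp_eq_ins[OF assms(1), of p P q Q xs] bar_comp_eq_ins[OF assms(1), of q Q p P xs] c
    by (simp add: balavoine_def M.add_pow_signed add.commute)
qed

lemma balavoine_extensional: "balavoine E p q P Q \<in> extensional (tuples E (Suc (p + q)))"
  by (simp add: balavoine_def)

lemma multilinear_balavoine:
  fixes E :: "('k, 'e) module"
  assumes "module K E" "P \<in> multilinear_maps K E E (Suc p)" "Q \<in> multilinear_maps K E E (Suc q)"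
  shows "balavoine E p q P Q \<in> multilinear_maps K E E (Suc (p + q))"
proof -
  interpret module K E by fact
  have m: "multilinear K E E (Suc p) P" "multilinear K E E (Suc q) Q"
    using assms by (auto simp: multilinear_maps_iff)
  have "multilinear K E E (Suc (p + q)) (\<lambda>xs. ins E q P Q xs \<ominus>\<^bsub>E\<^esub> signed E (p * q) (ins E p Q P xs))"
    using multilinear_ins[OF m] multilinear_ins[OF m(2,1)]
    by (intro multilinear_diff multilinear_signed) (simp_all add: add.commute)
  then have "multilinear K E E (Suc (p + q)) (balavoine E p q P Q)"
    using balavoine_eq[OF assms] assms(1)
    by (subst multilinear_cong[where g = "\<lambda>xs. ins E q P Q xs \<ominus>\<^bsub>E\<^esub> signed E (p * q) (ins E p Q P xs)"]) auto
  then show ?thesis by (simp add: multilinear_maps_iff balavoine_extensional)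
qed

lemma balavoine_skew:
  fixes E :: "('k, 'e) module"
  assumes "module K E" "P \<in> multilinear_maps K E E (Suc p)" "Q \<in> multilinear_maps K E E (Suc q)"
    "xs \<in> tuples E (Suc (p + q))"
  shows "balavoine E p q P Q xs = \<ominus>\<^bsub>E\<^esub> signed E (p * q) (balavoine E q p Q P xs)"
proof -
  interpret module K E by fact
  have m: "multilinear K E E (Suc p) P" "multilinear K E E (Suc q) Q"
    using assms by (auto simp: multilinear_maps_iff)
  have c: "ins E q P Q xs \<in> carrier E" "ins E p Q P xs \<in> carrier E"
    using multilinear_closed[OF multilinear_ins[OF m]] multilinear_closed[OF multilinear_ins[OF m(2,1)]] assms(4)
    by (auto simp: add.commute)
  have "xs \<in> tuples E (Suc (q + p))" using assms(4) by (simp add: add.commute)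
  then show ?thesis
    unfolding balavoine_eq[OF assms] balavoine_eq[OF assms(1,3,2) \<open>xs \<in> tuples E (Suc (q + p))\<close>] mult.commute[of q p]
    using c by (intro M.signed_skew)
qed

lemma balavoine_nested:
  fixes E :: "('k, 'e) module"
  assumes "module K E" "P \<in> multilinear_maps K E E (Suc p)" "Q \<in> multilinear_maps K E E (Suc q)"
    "S \<in> multilinear_maps K E E (Suc r)" "xs \<in> tuples E (Suc (p + q + r))"
  shows "balavoine E p (q + r) P (balavoine E q r Q S) xs =
    (ins E (q + r) P (ins E r Q S) xs \<ominus>\<^bsub>E\<^esub> signed E (q * r) (ins E (q + r) P (ins E q S Q) xs)) \<ominus>\<^bsub>E\<^esub>
    signed E (p * (q + r)) (ins E p (ins E r Q S) P xs \<ominus>\<^bsub>E\<^esub> signed E (q * r) (ins E p (ins E q S Q) P xs))"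
proof -
  interpret module K E by fact
  have m: "multilinear K E E (Suc p) P" "multilinear K E E (Suc q) Q" "multilinear K E E (Suc r) S"
    using assms by (auto simp: multilinear_maps_iff)
  have QS: "multilinear K E E (Suc (q + r)) (ins E r Q S)" and SQ: "multilinear K E E (Suc (q + r)) (ins E q S Q)"
    using multilinear_ins[OF m(2,3)] multilinear_ins[OF m(3,2)] by (simp_all add: add.commute)
  \<comment> \<open>The minus sign of the inner bracket is moved into the exponent
    \<open>Suc (q * r)\<close>, so that additivity and compatibility with \<open>signed\<close>
    suffice to expand the outer bracket.\<close>
  have nSQ: "multilinear K E E (Suc (q + r)) (\<lambda>ys. signed E (Suc (q * r)) (ins E q S Q ys))"
    using SQ by (rule multilinear_signed)
  note mt = multilinear_maps_to
  have xs1: "xs \<in> tuples E (Suc p + (q + r))" "xs \<in> tuples E (Suc (q + r) + p)"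
    using assms(5) by (simp_all add: ac_simps)
  have sg: "signed E (Suc n) x = \<ominus>\<^bsub>E\<^esub> signed E n x" if "x \<in> carrier E" for n x
    using that by (simp add: signed_def)
  have cl: "ins E (q + r) P (ins E r Q S) xs \<in> carrier E" "ins E (q + r) P (ins E q S Q) xs \<in> carrier E"
    "ins E p (ins E r Q S) P xs \<in> carrier E" "ins E p (ins E q S Q) P xs \<in> carrier E"
    by (rule ins_closed[OF mt[OF m(1)] mt[OF QS] xs1(1)] ins_closed[OF mt[OF m(1)] mt[OF SQ] xs1(1)]
        ins_closed[OF mt[OF QS] mt[OF m(1)] xs1(2)] ins_closed[OF mt[OF SQ] mt[OF m(1)] xs1(2)])+
  have b: "balavoine E q r Q S ys = ins E r Q S ys \<oplus>\<^bsub>E\<^esub> signed E (Suc (q * r)) (ins E q S Q ys)"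
    if "ys \<in> tuples E (Suc (q + r))" for ys
    using balavoine_eq[OF assms(1,3,4) that] mt[OF SQ] that by (simp add: sg M.minus_eq)
  have mb: "maps_to (Suc (q + r)) (\<lambda>ys. ins E r Q S ys \<oplus>\<^bsub>E\<^esub> signed E (Suc (q * r)) (ins E q S Q ys))"
    using mt[OF QS] mt[OF nSQ] by simp
  have "ins E (q + r) P (balavoine E q r Q S) xs =
      ins E (q + r) P (\<lambda>ys. ins E r Q S ys \<oplus>\<^bsub>E\<^esub> signed E (Suc (q * r)) (ins E q S Q ys)) xs"
    by (rule ins_cong[OF refl b mb xs1(1)])
  also have "\<dots> = ins E (q + r) P (ins E r Q S) xs \<oplus>\<^bsub>E\<^esub> signed E (Suc (q * r)) (ins E (q + r) P (ins E q S Q) xs)"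
    by (simp only: ins_add_right[OF m(1) mt[OF QS] mt[OF nSQ] xs1(1)] ins_signed_right[OF m(1) mt[OF SQ] xs1(1)])
  finally have 1: "ins E (q + r) P (balavoine E q r Q S) xs =
      ins E (q + r) P (ins E r Q S) xs \<ominus>\<^bsub>E\<^esub> signed E (q * r) (ins E (q + r) P (ins E q S Q) xs)"
    using cl by (simp add: sg M.minus_eq)
  have "ins E p (balavoine E q r Q S) P xs =
      ins E p (\<lambda>ys. ins E r Q S ys \<oplus>\<^bsub>E\<^esub> signed E (Suc (q * r)) (ins E q S Q ys)) P xs"
    by (rule ins_cong[OF b refl mt[OF m(1)] xs1(2)])
  also have "\<dots> = ins E p (ins E r Q S) P xs \<oplus>\<^bsub>E\<^esub> signed E (Suc (q * r)) (ins E p (ins E q S Q) P xs)"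
    by (simp only: ins_add_left[OF mt[OF QS] mt[OF nSQ] mt[OF m(1)] xs1(2)] ins_signed_left[OF mt[OF SQ] mt[OF m(1)] xs1(2)])
  finally have 2: "ins E p (balavoine E q r Q S) P xs =
      ins E p (ins E r Q S) P xs \<ominus>\<^bsub>E\<^esub> signed E (q * r) (ins E p (ins E q S Q) P xs)"
    using cl by (simp add: sg M.minus_eq)
  have "xs \<in> tuples E (Suc (p + (q + r)))" using assms(5) by (simp add: add.assoc)
  from balavoine_eq[OF assms(1,2) multilinear_balavoine[OF assms(1,3,4)] this]
  show ?thesis unfolding 1 2 .
qed

text \<open>Skew-symmetry first turns [[P, Q], S] into a bracket nested on the right, so that all
  three brackets expand by \<open>balavoine_nested\<close>. The associator symmetry is then used
  once for each of \<open>P\<close>, \<open>Q\<close> and \<open>S\<close> as the outer map.\<close>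

lemma balavoine_jacobi:
  fixes E :: "('k, 'e) module"
  assumes "module K E" and P: "P \<in> multilinear_maps K E E (Suc p)" and Q: "Q \<in> multilinear_maps K E E (Suc q)"
    and S: "S \<in> multilinear_maps K E E (Suc r)" and xs: "xs \<in> tuples E (Suc (p + q + r))"
  shows "balavoine E p (q + r) P (balavoine E q r Q S) xs =
    balavoine E (p + q) r (balavoine E p q P Q) S xs \<oplus>\<^bsub>E\<^esub>
    signed E (p * q) (balavoine E q (p + r) Q (balavoine E p r P S) xs)"
proof -
  interpret module K E by fact
  have m: "multilinear K E E (Suc p) P" "multilinear K E E (Suc q) Q" "multilinear K E E (Suc r) S"
    using assms by (auto simp: multilinear_maps_iff)
  have xs2: "xs \<in> tuples E (Suc (q + p + r))" and xs3: "xs \<in> tuples E (Suc (r + p + q))"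
    using xs by (simp_all add: ac_simps)
  have PQ: "balavoine E p q P Q \<in> multilinear_maps K E E (Suc (p + q))"
    by (rule multilinear_balavoine[OF assms(1) P Q])
  note n1 = balavoine_nested[OF assms(1) P Q S xs]
    and n2 = balavoine_nested[OF assms(1) Q P S xs2]
    and n3 = balavoine_nested[OF assms(1) S P Q xs3]
  have n3': "balavoine E (p + q) r (balavoine E p q P Q) S xs =
      \<ominus>\<^bsub>E\<^esub> signed E ((p + q) * r) (balavoine E r (p + q) S (balavoine E p q P Q) xs)"
    by (rule balavoine_skew[OF assms(1) PQ S]) (use xs in \<open>simp add: ac_simps\<close>)
  define PQS where "PQS = ins E (q + r) P (ins E r Q S) xs"
  define PSQ where "PSQ = ins E (q + r) P (ins E q S Q) xs"
  define QPS where "QPS = ins E (p + r) Q (ins E r P S) xs"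
  define QSP where "QSP = ins E (p + r) Q (ins E p S P) xs"
  define SPQ where "SPQ = ins E (p + q) S (ins E q P Q) xs"
  define SQP where "SQP = ins E (p + q) S (ins E p Q P) xs"
  have xa: "xs \<in> tuples E (Suc p + q + r)" "xs \<in> tuples E (Suc p + r + q)"
    "xs \<in> tuples E (Suc q + p + r)" "xs \<in> tuples E (Suc q + r + p)"
    "xs \<in> tuples E (Suc r + p + q)" "xs \<in> tuples E (Suc r + q + p)"
    using xs by (simp_all add: ac_simps)
  have sym1: "ins E r (ins E q P Q) S xs \<ominus>\<^bsub>E\<^esub> PQS = signed E (q * r) (ins E q (ins E r P S) Q xs \<ominus>\<^bsub>E\<^esub> PSQ)"
    using associator_symmetric[OF m(1) m(2) m(3) xa(1)]
    by (simp only: associator_def PQS_def PSQ_def add.commute[of r q])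
  have sym2: "ins E r (ins E p Q P) S xs \<ominus>\<^bsub>E\<^esub> QPS = signed E (p * r) (ins E p (ins E r Q S) P xs \<ominus>\<^bsub>E\<^esub> QSP)"
    using associator_symmetric[OF m(2) m(1) m(3) xa(3)]
    by (simp only: associator_def QPS_def QSP_def add.commute[of r p])
  have sym3: "ins E q (ins E p S P) Q xs \<ominus>\<^bsub>E\<^esub> SPQ = signed E (p * q) (ins E p (ins E q S Q) P xs \<ominus>\<^bsub>E\<^esub> SQP)"
    using associator_symmetric[OF m(3) m(1) m(2) xa(5)]
    by (simp only: associator_def SPQ_def SQP_def add.commute[of q p])
  note c1 = associator_closed[OF m(1) m(2) m(3) xa(1)] associator_closed[OF m(1) m(3) m(2) xa(2)]
    and c2 = associator_closed[OF m(2) m(1) m(3) xa(3)] associator_closed[OF m(2) m(3) m(1) xa(4)]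
    and c3 = associator_closed[OF m(3) m(1) m(2) xa(5)] associator_closed[OF m(3) m(2) m(1) xa(6)]
  have cl: "PQS \<in> carrier E" "PSQ \<in> carrier E" "QPS \<in> carrier E" "QSP \<in> carrier E" "SPQ \<in> carrier E" "SQP \<in> carrier E"
    using c1 c2 c3 by (simp_all add: PQS_def PSQ_def QPS_def QSP_def SPQ_def SQP_def add.commute)
  define x y z x' y' z' where "x = ins E r (ins E q P Q) S xs" and "y = ins E r (ins E p Q P) S xs"
    and "z = ins E q (ins E p S P) Q xs" and "x' = ins E q (ins E r P S) Q xs"
    and "y' = ins E p (ins E r Q S) P xs" and "z' = ins E p (ins E q S Q) P xs"
  have cl': "x \<in> carrier E" "y \<in> carrier E" "z \<in> carrier E" "x' \<in> carrier E" "y' \<in> carrier E" "z' \<in> carrier E"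
    using c1 c2 c3 by (simp_all add: x_def y_def z_def x'_def y'_def z'_def)
  have solve: "u = v \<oplus>\<^bsub>E\<^esub> w" if "u \<ominus>\<^bsub>E\<^esub> v = w" "u \<in> carrier E" "v \<in> carrier E" for u v w
    using that by (auto simp: M.minus_eq M.a_ac M.r_neg2 M.r_neg M.l_neg)
  have e1: "x = PQS \<oplus>\<^bsub>E\<^esub> signed E (q * r) (x' \<ominus>\<^bsub>E\<^esub> PSQ)"
    using solve[OF sym1[folded x_def x'_def]] cl cl' by simp
  have e2: "y = QPS \<oplus>\<^bsub>E\<^esub> signed E (p * r) (y' \<ominus>\<^bsub>E\<^esub> QSP)"
    using solve[OF sym2[folded y_def y'_def]] cl cl' by simp
  have e3: "z = SPQ \<oplus>\<^bsub>E\<^esub> signed E (p * q) (z' \<ominus>\<^bsub>E\<^esub> SQP)"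
    using solve[OF sym3[folded z_def z'_def]] cl cl' by simp
  show ?thesis
    unfolding n3' n1 n2 n3 PQS_def[symmetric] PSQ_def[symmetric] QPS_def[symmetric] QSP_def[symmetric]
      SPQ_def[symmetric] SQP_def[symmetric] x_def[symmetric] y_def[symmetric] z_def[symmetric]
      x'_def[symmetric] y'_def[symmetric] z'_def[symmetric]
    by (rule M.signed_jacobi[OF cl cl'(4-6) e1 e2 e3])
qed

section \<open>Derived brackets\<close>

lemma module_hom_zero:
  assumes "f \<in> module_hom R M N" "module R M" "module R N"
  shows "f \<zero>\<^bsub>M\<^esub> = \<zero>\<^bsub>N\<^esub>"
proof -
  interpret mod_hom R M N f using assms by (simp add: mod_hom_def mod_hom_axioms_def)
  show ?thesis by simp
qed

lemma module_hom_signed_apply: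
  assumes "f \<in> module_hom R M N" "module R M" "module R N" "x \<in> carrier M"
  shows "f (signed M n x) = signed N n (f x)" "f (\<ominus>\<^bsub>M\<^esub> x) = \<ominus>\<^bsub>N\<^esub> f x"
proof -
  interpret mod_hom R M N f using assms by (simp add: mod_hom_def mod_hom_axioms_def)
  show "f (signed M n x) = signed N n (f x)" "f (\<ominus>\<^bsub>M\<^esub> x) = \<ominus>\<^bsub>N\<^esub> f x"
    using assms(4) by (simp_all add: signed_def)
qed

lemma bilinear_mapsD:
  assumes "b \<in> bilinear_maps K U V W"
  shows "u \<in> carrier U \<Longrightarrow> b u \<in> module_hom K V W" "v \<in> carrier V \<Longrightarrow> (\<lambda>u. b u v) \<in> module_hom K U W"
  using assms by (auto simp: bilinear_maps_def)

lemma bilinear_maps_closed: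
  "b \<in> bilinear_maps K U V W \<Longrightarrow> u \<in> carrier U \<Longrightarrow> v \<in> carrier V \<Longrightarrow> b u v \<in> carrier W"
  by (auto simp: bilinear_maps_def module_hom_def)

lemma module_hom_hom_space:
  assumes "\<And>z. z \<in> carrier Z \<Longrightarrow> F z \<in> multilinear_maps K V W n"
    and "\<And>xs. xs \<in> tuples V n \<Longrightarrow> (\<lambda>z. F z xs) \<in> module_hom K Z W"
    and "module K Z" "module K V" "module K W"
  shows "F \<in> module_hom K Z (hom_space K V W n)"
proof -
  interpret Z: module K Z by fact
  interpret H: module K "hom_space K V W n" by (rule module_hom_space) fact+
  have "F (x \<oplus>\<^bsub>Z\<^esub> y) = F x \<oplus>\<^bsub>hom_space K V W n\<^esub> F y" if "x \<in> carrier Z" "y \<in> carrier Z" for x y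
  proof (rule multilinear_maps_ext)
    show "F x \<oplus>\<^bsub>hom_space K V W n\<^esub> F y \<in> multilinear_maps K V W n"
      using H.M.a_closed[of "F x" "F y"] assms(1) that by simp
  qed (use that assms(1) module_hom_add[OF assms(2)] in auto)
  moreover have "F (a \<odot>\<^bsub>Z\<^esub> x) = a \<odot>\<^bsub>hom_space K V W n\<^esub> F x" if "a \<in> carrier K" "x \<in> carrier Z" for a x
  proof (rule multilinear_maps_ext)
    show "a \<odot>\<^bsub>hom_space K V W n\<^esub> F x \<in> multilinear_maps K V W n"
      using H.smult_closed[of a "F x"] assms(1) that by simp
  qed (use that assms(1) module_hom_smult[OF assms(2)] in auto)
  ultimately show ?thesis using assms(1) by (auto simp: module_hom_def)
qed

lemma (in module) module_hom_diff_fun: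
  assumes "f \<in> module_hom R Z M" "g \<in> module_hom R Z M"
  shows "(\<lambda>x. f x \<ominus>\<^bsub>M\<^esub> g x) \<in> module_hom R Z M"
  using module_hom_add_fun[OF assms(1) module_hom_signed[OF assms(2), of 1]] by (simp add: signed_def M.minus_eq)

lemma balavoine_bilinear:
  fixes E :: "('k, 'e) module"
  assumes "module K E"
  shows "balavoine E p q \<in>
    bilinear_maps K (hom_space K E E (Suc p)) (hom_space K E E (Suc q)) (hom_space K E E (Suc (p + q)))"
proof -
  interpret module K E by fact
  note mod = module_hom_space[OF assms assms]
  have 1: "balavoine E p q P \<in> module_hom K (hom_space K E E (Suc q)) (hom_space K E E (Suc (p + q)))"
    if P: "P \<in> multilinear_maps K E E (Suc p)" for P
  proof (rule module_hom_hom_space)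
    fix xs assume xs: "xs \<in> tuples E (Suc (p + q))"
    have P': "multilinear K E E (Suc p) P" "maps_to (Suc p) P"
      using P by (auto simp: multilinear_maps_iff multilinear_closed)
    have "(\<lambda>Q. ins E q P Q xs \<ominus>\<^bsub>E\<^esub> signed E (p * q) (ins E p Q P xs)) \<in> module_hom K (hom_space K E E (Suc q)) E"
    proof (intro module_hom_diff_fun module_hom_signed)
      show "(\<lambda>Q. ins E q P Q xs) \<in> module_hom K (hom_space K E E (Suc q)) E"
        using xs by (intro module_hom_ins_right[OF P'(1)] hom_space_eval mod) auto
      show "(\<lambda>Q. ins E p Q P xs) \<in> module_hom K (hom_space K E E (Suc q)) E"
        using xs by (intro module_hom_ins_left[of "Suc q"] hom_space_eval mod P') (auto simp: add.commute)
    qed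
    then show "(\<lambda>Q. balavoine E p q P Q xs) \<in> module_hom K (hom_space K E E (Suc q)) E"
      using balavoine_eq[OF assms P _ xs] by (subst module_hom_cong[OF _ mod]) auto
  qed (use multilinear_balavoine[OF assms P] mod assms in auto)
  have 2: "(\<lambda>P. balavoine E p q P Q) \<in> module_hom K (hom_space K E E (Suc p)) (hom_space K E E (Suc (p + q)))"
    if Q: "Q \<in> multilinear_maps K E E (Suc q)" for Q
  proof (rule module_hom_hom_space)
    fix xs assume xs: "xs \<in> tuples E (Suc (p + q))"
    have Q': "multilinear K E E (Suc q) Q" "maps_to (Suc q) Q"
      using Q by (auto simp: multilinear_maps_iff multilinear_closed)
    have "(\<lambda>P. ins E q P Q xs \<ominus>\<^bsub>E\<^esub> signed E (p * q) (ins E p Q P xs)) \<in> module_hom K (hom_space K E E (Suc p)) E"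
    proof (intro module_hom_diff_fun module_hom_signed)
      show "(\<lambda>P. ins E q P Q xs) \<in> module_hom K (hom_space K E E (Suc p)) E"
        using xs by (intro module_hom_ins_left[of "Suc p"] hom_space_eval mod Q') auto
      show "(\<lambda>P. ins E p Q P xs) \<in> module_hom K (hom_space K E E (Suc p)) E"
        using xs by (intro module_hom_ins_right[OF Q'(1)] hom_space_eval mod) (auto simp: add.commute)
    qed
    then show "(\<lambda>P. balavoine E p q P Q xs) \<in> module_hom K (hom_space K E E (Suc p)) E"
      using balavoine_eq[OF assms _ Q xs] by (subst module_hom_cong[OF _ mod]) auto
  qed (use multilinear_balavoine[OF assms _ Q] mod assms in auto)
  show ?thesis using 1 2 by (auto simp: bilinear_maps_def)
qed

text \<open>The derived bracket construction rests on these axioms alone and is therefore carried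
  out without reference to multilinear maps.\<close>

locale graded_bracket =
  fixes K :: "('k, 'r) ring_scheme" and Y :: "nat \<Rightarrow> ('k, 'x, 'm) module_scheme" and br :: "nat \<Rightarrow> nat \<Rightarrow> 'x \<Rightarrow> 'x \<Rightarrow> 'x"
  assumes Y_module: "module K (Y p)"
    and br_bilinear: "br p q \<in> bilinear_maps K (Y p) (Y q) (Y (p + q))"
    and br_skew: "\<lbrakk>x \<in> carrier (Y p); y \<in> carrier (Y q)\<rbrakk> \<Longrightarrow>
      br p q x y = \<ominus>\<^bsub>Y (p + q)\<^esub> (signed (Y (p + q)) (p * q) (br q p y x))"
    and br_jacobi: "\<lbrakk>x \<in> carrier (Y p); y \<in> carrier (Y q); z \<in> carrier (Y r)\<rbrakk> \<Longrightarrow>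
      br p (q + r) x (br q r y z) = br (p + q) r (br p q x y) z \<oplus>\<^bsub>Y (p + q + r)\<^esub>
        signed (Y (p + q + r)) (p * q) (br q (p + r) y (br p r x z))"
begin

lemma br_closed [simp]: "x \<in> carrier (Y p) \<Longrightarrow> y \<in> carrier (Y q) \<Longrightarrow> br p q x y \<in> carrier (Y (p + q))"
  by (rule bilinear_maps_closed[OF br_bilinear])

lemma br_closed': "x \<in> carrier (Y p) \<Longrightarrow> y \<in> carrier (Y q) \<Longrightarrow> p + q = r \<Longrightarrow> br p q x y \<in> carrier (Y r)"
  using br_closed by blast

lemma abelian_Y: "abelian_group (Y p)"
  using Y_module[of p] by (simp add: module_def)

lemma br_signed:
  assumes "x \<in> carrier (Y p)" "y \<in> carrier (Y q)"
  shows "br p q (signed (Y p) n x) y = signed (Y (p + q)) n (br p q x y)"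
    and "br p q x (signed (Y q) n y) = signed (Y (p + q)) n (br p q x y)"
  using module_hom_signed_apply(1)[OF bilinear_mapsD(1)[OF br_bilinear assms(1)] Y_module Y_module assms(2)]
    module_hom_signed_apply(1)[OF bilinear_mapsD(2)[OF br_bilinear assms(2)] Y_module Y_module assms(1)]
  by auto

end

text \<open>
  The indices of \<open>Y\<close> are the degrees of the Balavoine bracket, one less than the arities. An element
  of degree \<open>n\<close> of \<open>C\<^sup>*(V, L)\<close> therefore has index \<open>n - 1\<close>.
\<close>

locale derived_structure = graded_bracket +
  fixes mu
  assumes mu_closed: "mu \<in> carrier (Y 1)"
    and mu_square: "br 1 1 mu mu = \<zero>\<^bsub>Y 2\<^esub>"
    and no_two_torsion: "x \<in> carrier (Y p) \<Longrightarrow> x \<oplus>\<^bsub>Y p\<^esub> x = \<zero>\<^bsub>Y p\<^esub> \<Longrightarrow> x = \<zero>\<^bsub>Y p\<^esub>"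
begin

definition differential :: "nat \<Rightarrow> 'c \<Rightarrow> 'c" where
  "differential p x = br 1 p mu x"

definition derived :: "nat \<Rightarrow> nat \<Rightarrow> 'c \<Rightarrow> 'c \<Rightarrow> 'c" where
  "derived p q x y = signed (Y (Suc (p + q))) p (br (Suc p) q (differential p x) y)"

lemma differential_closed: "x \<in> carrier (Y p) \<Longrightarrow> differential p x \<in> carrier (Y (Suc p))"
  unfolding differential_def using br_closed[OF mu_closed, of x p] by simp

lemma derived_closed:
  assumes "x \<in> carrier (Y p)" "y \<in> carrier (Y q)"
  shows "derived p q x y \<in> carrier (Y (Suc (p + q)))"
proof -
  interpret abelian_group "Y (Suc (p + q))" by (rule abelian_Y)
  show ?thesis
    unfolding derived_def using br_closed[OF differential_closed[OF assms(1)] assms(2)] by (intro signed_closed) simp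
qed

text \<open>Since [\<mu>, \<mu>] = 0 and \<mu> has odd degree, the Jacobi identity for \<mu>, \<mu>
  and x says that d^2 x is its own negative. The absence of 2-torsion finishes the argument.\<close>

lemma differential_square:
  assumes "x \<in> carrier (Y p)"
  shows "differential (Suc p) (differential p x) = \<zero>\<^bsub>Y (Suc (Suc p))\<^esub>"
proof -
  interpret abelian_group "Y (Suc (Suc p))" by (rule abelian_Y)
  let ?dd = "br 1 (Suc p) mu (br 1 p mu x)"
  have dd: "?dd \<in> carrier (Y (Suc (Suc p)))"
    using differential_closed[OF differential_closed[OF assms]] by (simp add: differential_def)
  have "br 2 p \<zero>\<^bsub>Y 2\<^esub> x = \<zero>\<^bsub>Y (Suc (Suc p))\<^esub>"
    using module_hom_zero[OF bilinear_mapsD(2)[OF br_bilinear[of 2 p] assms] Y_module Y_module] by simp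
  then have "?dd = \<zero>\<^bsub>Y (Suc (Suc p))\<^esub> \<oplus>\<^bsub>Y (Suc (Suc p))\<^esub> signed (Y (Suc (Suc p))) 1 ?dd"
    using br_jacobi[OF mu_closed mu_closed assms] mu_square by (simp add: numeral_2_eq_2)
  then have "?dd = \<ominus>\<^bsub>Y (Suc (Suc p))\<^esub> ?dd"
    using dd by (simp add: signed_def)
  then have "?dd \<oplus>\<^bsub>Y (Suc (Suc p))\<^esub> ?dd = \<zero>\<^bsub>Y (Suc (Suc p))\<^esub>"
    using dd r_neg by metis
  then show ?thesis using no_two_torsion[OF dd] by (simp add: differential_def)
qed

lemma differential_br:
  assumes "x \<in> carrier (Y p)" "y \<in> carrier (Y q)"
  shows "differential (p + q) (br p q x y) =
    br (Suc p) q (differential p x) y \<oplus>\<^bsub>Y (Suc (p + q))\<^esub>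
    signed (Y (Suc (p + q))) p (br p (Suc q) x (differential q y))"
  using br_jacobi[OF mu_closed assms] by (simp add: differential_def)

lemma differential_signed:
  assumes "x \<in> carrier (Y p)"
  shows "differential p (signed (Y p) n x) = signed (Y (Suc p)) n (differential p x)"
  using br_signed(2)[OF mu_closed assms] by (simp add: differential_def)

lemma (in abelian_group) signed_skew_derived:
  assumes "a \<in> carrier G" "b \<in> carrier G" "\<zero> = a \<oplus> signed G p (\<ominus> (signed G (p * Suc q) b))"
  shows "signed G p a = \<ominus> (signed G (Suc p * Suc q) (signed G q b))"
proof -
  have "a = \<ominus> (signed G p (\<ominus> (signed G (p * Suc q) b)))"
    using assms by (metis a_inv_closed minus_equality signed_closed)
  then show ?thesis using assms(1,2)
    by (cases "even p"; cases "even q") (simp_all add: signed_def)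
qed

text \<open>Applying d to [x, y] = 0 shows that [dx, y] and [x, dy] agree up to sign, and
  skew-symmetry of the given bracket turns the latter into [dy, x].\<close>

lemma derived_skew:
  assumes x: "x \<in> carrier (Y p)" and y: "y \<in> carrier (Y q)" and "br p q x y = \<zero>\<^bsub>Y (p + q)\<^esub>"
  shows "derived p q x y = \<ominus>\<^bsub>Y (Suc (p + q))\<^esub> (signed (Y (Suc (p + q))) (Suc p * Suc q) (derived q p y x))"
proof -
  interpret abelian_group "Y (Suc (p + q))" by (rule abelian_Y)
  let ?a = "br (Suc p) q (differential p x) y" and ?b = "br (Suc q) p (differential q y) x"
  note dx = differential_closed[OF x] and dy = differential_closed[OF y]
  have "differential (p + q) \<zero>\<^bsub>Y (p + q)\<^esub> = \<zero>\<^bsub>Y (Suc (p + q))\<^esub>"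
    unfolding differential_def
    using module_hom_zero[OF bilinear_mapsD(1)[OF br_bilinear[of 1 "p + q"] mu_closed] Y_module Y_module] by simp
  then have "\<zero>\<^bsub>Y (Suc (p + q))\<^esub> = ?a \<oplus>\<^bsub>Y (Suc (p + q))\<^esub>
      signed (Y (Suc (p + q))) p (\<ominus>\<^bsub>Y (Suc (p + q))\<^esub> (signed (Y (Suc (p + q))) (p * Suc q) ?b))"
    using differential_br[OF x y] assms(3) br_skew[OF x dy] by simp
  moreover have "?a \<in> carrier (Y (Suc (p + q)))" "?b \<in> carrier (Y (Suc (p + q)))"
    by (rule br_closed'[OF dx y] br_closed'[OF dy x]; simp)+
  ultimately show ?thesis
    unfolding derived_def add.commute[of q p] by (intro signed_skew_derived)
qed

lemma (in abelian_group) signed_jacobi_derived: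
  assumes "w \<in> carrier G" "u \<in> carrier G"
  shows "signed G a (signed G b (w \<oplus> signed G (Suc a * Suc b) u)) =
    signed G (Suc a + b) (signed G a (signed G (Suc a) w)) \<oplus>
    signed G (Suc a * Suc b) (signed G b (signed G a u))"
  using assms by (cases "even a"; cases "even b") (simp_all add: signed_def minus_add)

text \<open>This is the Jacobi identity for dx, dy and z, combined with d[dx, y] = [dx, dy] up to
  sign, which holds because d^2 = 0. The elements dx and dy have degrees \<open>Suc a\<close> and
  \<open>Suc b\<close>, which yields the sign of the new grading.\<close>

lemma derived_jacobi:
  assumes x: "x \<in> carrier (Y a)" and y: "y \<in> carrier (Y b)" and z: "z \<in> carrier (Y c)"
  defines "N \<equiv> Suc (Suc (a + b + c))"
  shows "derived a (Suc (b + c)) x (derived b c y z) =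
    derived (Suc (a + b)) c (derived a b x y) z \<oplus>\<^bsub>Y N\<^esub>
    signed (Y N) (Suc a * Suc b) (derived b (Suc (a + c)) y (derived a c x z))"
proof -
  interpret abelian_group "Y N" by (rule abelian_Y)
  note dx = differential_closed[OF x] and dy = differential_closed[OF y] and dz = differential_closed[OF z]
  let ?dx = "differential a x" and ?dy = "differential b y"
  define w where "w = br (Suc (Suc (a + b))) c (br (Suc a) (Suc b) ?dx ?dy) z"
  define u where "u = br (Suc b) (Suc (a + c)) ?dy (br (Suc a) c ?dx z)"
  have dxdy: "br (Suc a) (Suc b) ?dx ?dy \<in> carrier (Y (Suc (Suc (a + b))))"
    by (rule br_closed'[OF dx dy]) simp
  have dxz: "br (Suc a) c ?dx z \<in> carrier (Y (Suc (a + c)))"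
    by (rule br_closed'[OF dx z]) simp
  have dyz: "br (Suc b) c ?dy z \<in> carrier (Y (Suc (b + c)))"
    by (rule br_closed'[OF dy z]) simp
  have w: "w \<in> carrier (Y N)" unfolding w_def by (rule br_closed'[OF dxdy z]) (simp add: N_def)
  have u: "u \<in> carrier (Y N)" unfolding u_def by (rule br_closed'[OF dy dxz]) (simp add: N_def)
  have wu: "br (Suc a) (Suc (b + c)) ?dx (br (Suc b) c ?dy z) = w \<oplus>\<^bsub>Y N\<^esub> signed (Y N) (Suc a * Suc b) u"
    using br_jacobi[OF dx dy z] by (simp add: w_def u_def N_def)
  have Ns: "Suc a + Suc (b + c) = N" "Suc (a + Suc (b + c)) = N" "Suc b + Suc (a + c) = N" "Suc (b + Suc (a + c)) = N"
    "Suc (Suc (a + b)) + c = N" "Suc (Suc (a + b) + c) = N"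
    by (simp_all add: N_def)
  have l: "derived a (Suc (b + c)) x (derived b c y z) = signed (Y N) a (signed (Y N) b (w \<oplus>\<^bsub>Y N\<^esub> signed (Y N) (Suc a * Suc b) u))"
    unfolding derived_def br_signed(2)[OF dx dyz] Ns wu ..
  have r2: "derived b (Suc (a + c)) y (derived a c x z) = signed (Y N) b (signed (Y N) a u)"
    unfolding derived_def br_signed(2)[OF dy dxz] Ns u_def[symmetric] ..
  have "differential (Suc (a + b)) (derived a b x y) =
      signed (Y (Suc (Suc (a + b)))) a (signed (Y (Suc (Suc (a + b)))) (Suc a) (br (Suc a) (Suc b) ?dx ?dy))"
  proof -
    interpret A: abelian_group "Y (Suc (Suc (a + b)))" by (rule abelian_Y)
    have dxy: "br (Suc a) b ?dx y \<in> carrier (Y (Suc (a + b)))"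
      by (rule br_closed'[OF dx y]) simp
    have "br (Suc (Suc a)) b (differential (Suc a) ?dx) y = \<zero>\<^bsub>Y (Suc (Suc (a + b)))\<^esub>"
      unfolding differential_square[OF x]
      using module_hom_zero[OF bilinear_mapsD(2)[OF br_bilinear[of "Suc (Suc a)" b] y] Y_module Y_module] by simp
    then have "differential (Suc (a + b)) (br (Suc a) b ?dx y) = signed (Y (Suc (Suc (a + b)))) (Suc a) (br (Suc a) (Suc b) ?dx ?dy)"
      using differential_br[OF dx y] dxdy by simp
    then show ?thesis unfolding derived_def differential_signed[OF dxy] by simp
  qed
  then have r1: "derived (Suc (a + b)) c (derived a b x y) z = signed (Y N) (Suc a + b) (signed (Y N) a (signed (Y N) (Suc a) w))"
  proof -
    interpret A: abelian_group "Y (Suc (Suc (a + b)))" by (rule abelian_Y)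
    assume eq: "differential (Suc (a + b)) (derived a b x y) =
      signed (Y (Suc (Suc (a + b)))) a (signed (Y (Suc (Suc (a + b)))) (Suc a) (br (Suc a) (Suc b) ?dx ?dy))"
    show ?thesis
      unfolding derived_def[of "Suc (a + b)"] eq br_signed(1)[OF A.signed_closed[OF dxdy] z] br_signed(1)[OF dxdy z] Ns
        w_def[symmetric] by simp
  qed
  show ?thesis unfolding l r1 r2 by (rule signed_jacobi_derived[OF w u])
qed

lemma derived_bilinear: "derived p q \<in> bilinear_maps K (Y p) (Y q) (Y (Suc (p + q)))"
proof -
  interpret module K "Y (Suc (p + q))" by (rule Y_module)
  have "derived p q x \<in> module_hom K (Y q) (Y (Suc (p + q)))" if "x \<in> carrier (Y p)" for x
    unfolding derived_def
    using bilinear_mapsD(1)[OF br_bilinear differential_closed[OF that], of q] by (intro module_hom_signed) simp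
  moreover have "(\<lambda>x. derived p q x y) \<in> module_hom K (Y p) (Y (Suc (p + q)))" if "y \<in> carrier (Y q)" for y
  proof -
    have "differential p \<in> module_hom K (Y p) (Y (Suc p))"
      unfolding differential_def using bilinear_mapsD(1)[OF br_bilinear mu_closed, of p] by simp
    from module_hom_compose[OF this, of "\<lambda>u. br (Suc p) q u y"]
    have "(\<lambda>u. br (Suc p) q u y) \<in> module_hom K (Y (Suc p)) (Y (Suc (p + q))) \<Longrightarrow>
      (\<lambda>x. br (Suc p) q (differential p x) y) \<in> module_hom K (Y p) (Y (Suc (p + q)))" .
    moreover have "(\<lambda>u. br (Suc p) q u y) \<in> module_hom K (Y (Suc p)) (Y (Suc (p + q)))"
      using bilinear_mapsD(2)[OF br_bilinear that, of "Suc p"] by simp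
    ultimately show ?thesis
      unfolding derived_def by (intro module_hom_signed) blast
  qed
  ultimately show ?thesis by (simp add: bilinear_maps_def)
qed

end

lemma graded_bracket_balavoine:
  fixes E :: "('k, 'e) module"
  assumes "module K E"
  shows "graded_bracket K (\<lambda>p. hom_space K E E (Suc p)) (balavoine E)"
proof (rule graded_bracket.intro)
  interpret module K E by fact
  show "module K (hom_space K E E (Suc p))" for p
    by (rule module_hom_space[OF assms assms])
  show "balavoine E p q \<in> bilinear_maps K (hom_space K E E (Suc p)) (hom_space K E E (Suc q)) (hom_space K E E (Suc (p + q)))"
    for p q by (rule balavoine_bilinear[OF assms])
  let ?Y = "\<lambda>p. hom_space K E E (Suc p)"
  have sc: "signed (?Y k) n f \<in> multilinear_maps K E E (Suc k)" if "f \<in> multilinear_maps K E E (Suc k)" for k n f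
  proof -
    interpret Y: module K "?Y k" by (rule module_hom_space[OF assms assms])
    show ?thesis using Y.M.signed_closed[of f n] that by simp
  qed
  fix p q x y assume x: "x \<in> carrier (?Y p)" and y: "y \<in> carrier (?Y q)"
  have yx: "balavoine E q p y x \<in> multilinear_maps K E E (Suc (p + q))"
    using multilinear_balavoine[OF assms, of y q x p] x y by (simp add: add.commute)
  show "balavoine E p q x y = \<ominus>\<^bsub>?Y (p + q)\<^esub> (signed (?Y (p + q)) (p * q) (balavoine E q p y x))"
    unfolding hom_space_minus[OF assms assms sc[OF yx]] unfolding hom_space_signed[OF assms assms yx]
    using balavoine_skew[OF assms, of x p y q] x y balavoine_extensional
    by (intro restrict_eqI[symmetric]) auto
  fix r z assume z: "z \<in> carrier (?Y r)"
  have xz: "balavoine E p r x z \<in> multilinear_maps K E E (Suc (p + r))"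
    using multilinear_balavoine[OF assms, of x p z r] x z by simp
  have yxz: "balavoine E q (p + r) y (balavoine E p r x z) \<in> multilinear_maps K E E (Suc (p + q + r))"
    using multilinear_balavoine[OF assms _ xz, of y q] y by (simp add: ac_simps)
  have e: "balavoine E p (q + r) x (balavoine E q r y z) \<in> extensional (tuples E (Suc (p + q + r)))"
    using balavoine_extensional[of E p "q + r"] by (simp add: add.assoc)
  show "balavoine E p (q + r) x (balavoine E q r y z) =
      balavoine E (p + q) r (balavoine E p q x y) z \<oplus>\<^bsub>?Y (p + q + r)\<^esub>
      signed (?Y (p + q + r)) (p * q) (balavoine E q (p + r) y (balavoine E p r x z))"
    unfolding hom_space_signed[OF assms assms yxz] hom_space_simps
    using balavoine_jacobi[OF assms, of x p y q z r] x y z by (intro restrict_eqI[symmetric] e) auto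
qed

section \<open>The Leibniz structure on the direct sum\<close>

lemma tuples_map:
  "\<lbrakk>\<And>x. x \<in> carrier W \<Longrightarrow> \<phi> x \<in> carrier V; xs \<in> tuples W n\<rbrakk> \<Longrightarrow> map \<phi> xs \<in> tuples V n"
  by (auto simp: tuples_def)

lemma multilinear_compose:
  assumes "multilinear K V N n f" "\<phi> \<in> module_hom K W V" "h \<in> module_hom K N M"
  shows "multilinear K W M n (\<lambda>ws. h (f (map \<phi> ws)))"
proof -
  have c: "map \<phi> xs \<in> tuples V n" if "xs \<in> tuples W n" for xs
    using module_hom_closed[OF assms(2)] that by (intro tuples_map) auto
  have h: "h x \<in> carrier M" if "x \<in> carrier N" for x
    using module_hom_closed[OF assms(3)] that by auto
  have "(\<lambda>v. h (f (map \<phi> (xs[i := v])))) \<in> module_hom K W M" if "xs \<in> tuples W n" "i < n" for xs i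
  proof -
    have "(\<lambda>v. f ((map \<phi> xs)[i := v])) \<in> module_hom K V N"
      using assms(1) c[OF that(1)] that(2) by (simp add: multilinear_def)
    then show ?thesis
      using assms(2,3) by (auto simp: module_hom_def Pi_def map_update)
  qed
  then show ?thesis using assms(1) c h by (auto simp: multilinear_def)
qed

text \<open>Covers extension by zero, restriction to \<open>V\<close>, the action of a morphism, and
  composition with a homomorphism of algebras; these differ only in the choice of
  \<open>\<phi>\<close> and \<open>h\<close>.\<close>

lemma module_hom_transport:
  assumes "\<phi> \<in> module_hom K W V" "h \<in> module_hom K N M"
    and "module K V" "module K W" "module K N" "module K M"
  shows "(\<lambda>f. \<lambda>ws\<in>tuples W n. h (f (map \<phi> ws))) \<in> module_hom K (hom_space K V N n) (hom_space K W M n)"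
proof (rule module_hom_hom_space)
  fix f assume "f \<in> carrier (hom_space K V N n)"
  then show "(\<lambda>ws\<in>tuples W n. h (f (map \<phi> ws))) \<in> multilinear_maps K W M n"
    using assms by (intro multilinear_mapsI multilinear_compose) (auto simp: multilinear_maps_iff)
next
  fix ws assume ws: "ws \<in> tuples W n"
  then have "map \<phi> ws \<in> tuples V n"
    using module_hom_closed[OF assms(1)] by (intro tuples_map) auto
  from hom_space_eval[OF this, of K N] show "(\<lambda>f. (\<lambda>ws\<in>tuples W n. h (f (map \<phi> ws))) ws) \<in> module_hom K (hom_space K V N n) M"
    using ws assms(2) by (auto simp: module_hom_def Pi_def)
qed (use assms module_hom_space in auto)

lemma bilinear_maps_add:
  assumes "b \<in> bilinear_maps K U V W"
  shows "\<lbrakk>u \<in> carrier U; v \<in> carrier V; v' \<in> carrier V\<rbrakk> \<Longrightarrow> b u (v \<oplus>\<^bsub>V\<^esub> v') = b u v \<oplus>\<^bsub>W\<^esub> b u v'"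
    "\<lbrakk>u \<in> carrier U; u' \<in> carrier U; v \<in> carrier V\<rbrakk> \<Longrightarrow> b (u \<oplus>\<^bsub>U\<^esub> u') v = b u v \<oplus>\<^bsub>W\<^esub> b u' v"
  using module_hom_add[OF bilinear_mapsD(1)[OF assms]] module_hom_add[OF bilinear_mapsD(2)[OF assms]] by blast+

lemma bilinear_maps_smult:
  assumes "b \<in> bilinear_maps K U V W"
  shows "\<lbrakk>a \<in> carrier K; u \<in> carrier U; v \<in> carrier V\<rbrakk> \<Longrightarrow> b u (a \<odot>\<^bsub>V\<^esub> v) = a \<odot>\<^bsub>W\<^esub> b u v"
    "\<lbrakk>a \<in> carrier K; u \<in> carrier U; v \<in> carrier V\<rbrakk> \<Longrightarrow> b (a \<odot>\<^bsub>U\<^esub> u) v = a \<odot>\<^bsub>W\<^esub> b u v"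
  using module_hom_smult[OF bilinear_mapsD(1)[OF assms]] module_hom_smult[OF bilinear_mapsD(2)[OF assms]] by blast+

lemma bilinear_maps_zero:
  assumes "b \<in> bilinear_maps K U V W" "module K U" "module K V" "module K W"
  shows "u \<in> carrier U \<Longrightarrow> b u \<zero>\<^bsub>V\<^esub> = \<zero>\<^bsub>W\<^esub>" "v \<in> carrier V \<Longrightarrow> b \<zero>\<^bsub>U\<^esub> v = \<zero>\<^bsub>W\<^esub>"
  using module_hom_zero[OF bilinear_mapsD(1)[OF assms(1)]] module_hom_zero[OF bilinear_mapsD(2)[OF assms(1)]] assms by blast+

lemma bilinear_maps_minus:
  assumes "b \<in> bilinear_maps K U V W" "module K U" "module K V" "module K W" "u \<in> carrier U" "v \<in> carrier V"
  shows "b u (\<ominus>\<^bsub>V\<^esub> v) = \<ominus>\<^bsub>W\<^esub> b u v" "b (\<ominus>\<^bsub>U\<^esub> u) v = \<ominus>\<^bsub>W\<^esub> b u v"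
  using module_hom_signed_apply(2)[OF bilinear_mapsD(1)[OF assms(1,5)] assms(3,4,6)]
    module_hom_signed_apply(2)[OF bilinear_mapsD(2)[OF assms(1,6)] assms(2,4,5)] by auto

lemma multilinear_2:
  assumes "b \<in> bilinear_maps K E E E" "module K E"
  shows "multilinear K E E 2 (\<lambda>zs. b (zs ! 0) (zs ! 1))"
  using assms bilinear_mapsD[OF assms(1)] bilinear_maps_closed[OF assms(1)]
  by (auto simp: numeral_2_eq_2 multilinear_Suc multilinear_0 elim: tuples_Suc_cases)

lemma direct_sum_simps [simp]:
  "carrier (direct_sum A B) = carrier A \<times> carrier B"
  "\<zero>\<^bsub>direct_sum A B\<^esub> = (\<zero>\<^bsub>A\<^esub>, \<zero>\<^bsub>B\<^esub>)"
  "x \<oplus>\<^bsub>direct_sum A B\<^esub> y = (fst x \<oplus>\<^bsub>A\<^esub> fst y, snd x \<oplus>\<^bsub>B\<^esub> snd y)"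
  "a \<odot>\<^bsub>direct_sum A B\<^esub> x = (a \<odot>\<^bsub>A\<^esub> fst x, a \<odot>\<^bsub>B\<^esub> snd x)"
  by (simp_all add: direct_sum_def)

text \<open>Common setting for the algebra, its kernel and its quotient. The characteristic is
  represented by the two torsion conditions, which together give the torsion condition on the direct
  sum.\<close>

locale leibniz_pair = L: module K L + V: module K V
  for K :: "'k ring" and L :: "('k, 'g) leibniz" and V :: "('k, 'g, 'v) repn" +
  assumes bracket_bilinear: "bracket L \<in> bilinear_maps K L L L"
    and leibniz: "\<lbrakk>x \<in> carrier L; y \<in> carrier L; z \<in> carrier L\<rbrakk> \<Longrightarrow>
      bracket L x (bracket L y z) = bracket L (bracket L x y) z \<oplus>\<^bsub>L\<^esub> bracket L y (bracket L x z)"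
    and lact_bilinear: "lact V \<in> bilinear_maps K L V V"
    and ract_bilinear: "ract V \<in> bilinear_maps K L V V"
    and lact_bracket: "\<lbrakk>x \<in> carrier L; y \<in> carrier L; v \<in> carrier V\<rbrakk> \<Longrightarrow>
      lact V (bracket L x y) v = lact V x (lact V y v) \<ominus>\<^bsub>V\<^esub> lact V y (lact V x v)"
    and ract_bracket: "\<lbrakk>x \<in> carrier L; y \<in> carrier L; v \<in> carrier V\<rbrakk> \<Longrightarrow>
      ract V (bracket L x y) v = lact V x (ract V y v) \<ominus>\<^bsub>V\<^esub> ract V y (lact V x v)"
    and ract_lact: "\<lbrakk>x \<in> carrier L; y \<in> carrier L; v \<in> carrier V\<rbrakk> \<Longrightarrow>
      ract V y (lact V x v) = \<ominus>\<^bsub>V\<^esub> ract V y (ract V x v)"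
    and no_two_torsion_L: "x \<in> carrier L \<Longrightarrow> x \<oplus>\<^bsub>L\<^esub> x = \<zero>\<^bsub>L\<^esub> \<Longrightarrow> x = \<zero>\<^bsub>L\<^esub>"
    and no_two_torsion_V: "v \<in> carrier V \<Longrightarrow> v \<oplus>\<^bsub>V\<^esub> v = \<zero>\<^bsub>V\<^esub> \<Longrightarrow> v = \<zero>\<^bsub>V\<^esub>"
begin

abbreviation E :: "('k, 'g \<times> 'v) module" where "E \<equiv> direct_sum L V"

abbreviation mu :: "('g \<times> 'v) list \<Rightarrow> 'g \<times> 'v" where "mu \<equiv> semidirect_mult L V"

lemma module_E: "module K E"
  by (rule direct_sum_is_module[OF L.module_axioms V.module_axioms])

sublocale E: module K E
  by (rule module_E)

lemma E_minus: "x \<in> carrier L \<Longrightarrow> v \<in> carrier V \<Longrightarrow> \<ominus>\<^bsub>E\<^esub> (x, v) = (\<ominus>\<^bsub>L\<^esub> x, \<ominus>\<^bsub>V\<^esub> v)"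
  by (rule E.minus_equality) (auto simp: L.l_neg V.l_neg)

lemmas closed [simp] = bilinear_maps_closed[OF bracket_bilinear] bilinear_maps_closed[OF lact_bilinear]
  bilinear_maps_closed[OF ract_bilinear]

lemmas bilinear_zeros [simp] =
  bilinear_maps_zero[OF bracket_bilinear L.module_axioms L.module_axioms L.module_axioms]
  bilinear_maps_zero[OF lact_bilinear L.module_axioms V.module_axioms V.module_axioms]
  bilinear_maps_zero[OF ract_bilinear L.module_axioms V.module_axioms V.module_axioms]

lemmas bilinear_adds = bilinear_maps_add[OF bracket_bilinear] bilinear_maps_add[OF lact_bilinear]
  bilinear_maps_add[OF ract_bilinear]

lemmas bilinear_smults = bilinear_maps_smult[OF bracket_bilinear] bilinear_maps_smult[OF lact_bilinear]
  bilinear_maps_smult[OF ract_bilinear]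

definition mult :: "'g \<times> 'v \<Rightarrow> 'g \<times> 'v \<Rightarrow> 'g \<times> 'v" where
  "mult x y = (bracket L (fst x) (fst y), lact V (fst x) (snd y) \<oplus>\<^bsub>V\<^esub> ract V (fst y) (snd x))"

lemma mult_bilinear: "mult \<in> bilinear_maps K E E E"
  by (auto simp: bilinear_maps_def module_hom_def mult_def bilinear_adds bilinear_smults
      V.M.a_ac V.smult_r_distr)

lemma mult_closed: "x \<in> carrier E \<Longrightarrow> y \<in> carrier E \<Longrightarrow> mult x y \<in> carrier E"
  by (rule bilinear_maps_closed[OF mult_bilinear])

lemma semidirect_mult_apply: "x \<in> carrier E \<Longrightarrow> y \<in> carrier E \<Longrightarrow> mu [x, y] = mult x y"
  by (auto simp: semidirect_mult_def mult_def numeral_2_eq_2)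

lemma semidirect_mult_multilinear: "mu \<in> multilinear_maps K E E 2"
proof -
  have "mu = restrict (\<lambda>zs. mult (zs ! 0) (zs ! 1)) (tuples E 2)"
    by (simp add: semidirect_mult_def mult_def)
  then show ?thesis
    using multilinear_mapsI[OF multilinear_2[OF mult_bilinear module_E] module_E] by simp
qed

text \<open>The component in \<open>V\<close> can be checked separately for each of its arguments.
  The terms in \<open>w\<close> are the axiom for \<open>lact V (bracket L a b)\<close>, those in
  \<open>v\<close> the axiom for \<open>ract V (bracket L a c)\<close>, and those in
  \<open>u\<close> need \<open>ract_bracket\<close> together with \<open>ract_lact\<close>.\<close>

lemma mult_leibniz:
  assumes "x \<in> carrier E" "y \<in> carrier E" "z \<in> carrier E"
  shows "mult x (mult y z) = mult (mult x y) z \<oplus>\<^bsub>E\<^esub> mult y (mult x z)"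
proof -
  obtain a u b v c w where x: "x = (a, u)" "y = (b, v)" "z = (c, w)" by (metis surj_pair)
  have cl: "a \<in> carrier L" "b \<in> carrier L" "c \<in> carrier L" "u \<in> carrier V" "v \<in> carrier V" "w \<in> carrier V"
    using assms unfolding x by simp_all
  \<comment> \<open>Each letter stands for a double action: \<open>j\<close> and \<open>k\<close>
    are the terms that cancel between the two summands on the right, and
    \<open>\<ominus>\<ominus> t\<close> arises because \<open>ract_lact\<close> is applied inside
    \<open>ract_bracket\<close>.\<close>
  have id: "(p \<oplus>\<^bsub>V\<^esub> q) \<oplus>\<^bsub>V\<^esub> (s \<ominus>\<^bsub>V\<^esub> \<ominus>\<^bsub>V\<^esub> t) =
      ((p \<ominus>\<^bsub>V\<^esub> j) \<oplus>\<^bsub>V\<^esub> (k \<oplus>\<^bsub>V\<^esub> t)) \<oplus>\<^bsub>V\<^esub> ((j \<oplus>\<^bsub>V\<^esub> s) \<oplus>\<^bsub>V\<^esub> (q \<ominus>\<^bsub>V\<^esub> k))"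
    if "p \<in> carrier V" "q \<in> carrier V" "s \<in> carrier V" "t \<in> carrier V" "j \<in> carrier V" "k \<in> carrier V" for p q s t j k
    using that by algebra
  have "lact V a (lact V b w \<oplus>\<^bsub>V\<^esub> ract V c v) \<oplus>\<^bsub>V\<^esub> ract V (bracket L b c) u =
      (lact V (bracket L a b) w \<oplus>\<^bsub>V\<^esub> ract V c (lact V a v \<oplus>\<^bsub>V\<^esub> ract V b u)) \<oplus>\<^bsub>V\<^esub>
      (lact V b (lact V a w \<oplus>\<^bsub>V\<^esub> ract V c u) \<oplus>\<^bsub>V\<^esub> ract V (bracket L a c) v)"
  proof -
    have f: "lact V a (lact V b w \<oplus>\<^bsub>V\<^esub> ract V c v) = lact V a (lact V b w) \<oplus>\<^bsub>V\<^esub> lact V a (ract V c v)"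
      "ract V c (lact V a v \<oplus>\<^bsub>V\<^esub> ract V b u) = ract V c (lact V a v) \<oplus>\<^bsub>V\<^esub> ract V c (ract V b u)"
      "lact V b (lact V a w \<oplus>\<^bsub>V\<^esub> ract V c u) = lact V b (lact V a w) \<oplus>\<^bsub>V\<^esub> lact V b (ract V c u)"
      using cl by (simp_all add: bilinear_adds)
    show ?thesis
      unfolding f lact_bracket[OF cl(1,2,6)] ract_bracket[OF cl(2,3,4)] ract_bracket[OF cl(1,3,5)] ract_lact[OF cl(2,3,4)]
      by (rule id) (use cl in simp_all)
  qed
  then show ?thesis
    by (simp only: x mult_def fst_conv snd_conv direct_sum_simps leibniz[OF cl(1,2,3)])
qed

text \<open>The recursion produces -x(yz) + y(xz) + (xy)z, with the sign arising when
  \<open>x\<close> is passed to the outer multiplication. So the square vanishes exactly by the left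
  Leibniz identity.\<close>

lemma ins_semidirect_square:
  assumes "x \<in> carrier E" "y \<in> carrier E" "z \<in> carrier E"
  shows "ins E 1 mu mu [x, y, z] = \<zero>\<^bsub>E\<^esub>"
proof -
  note m = mult_closed[OF assms(1) mult_closed[OF assms(2,3)]] mult_closed[OF mult_closed[OF assms(1,2)] assms(3)]
    mult_closed[OF assms(2) mult_closed[OF assms(1,3)]]
  have 1: "ins E 1 mu mu [x, y, z] = \<ominus>\<^bsub>E\<^esub> mult x (mult y z) \<oplus>\<^bsub>E\<^esub> (mult y (mult x z) \<oplus>\<^bsub>E\<^esub> mult (mult x y) z)"
    using assms m mult_closed
    by (simp add: signed_def semidirect_mult_apply del: direct_sum_simps)
  show ?thesis unfolding 1 mult_leibniz[OF assms]
    using m by (simp add: E.M.minus_add E.M.a_ac E.M.r_neg E.M.r_neg1 E.M.r_neg2 E.M.l_neg del: direct_sum_simps)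
qed

lemma semidirect_mult_square: "balavoine E 1 1 mu mu = \<zero>\<^bsub>hom_space K E E (Suc 2)\<^esub>"
proof -
  have "balavoine E 1 1 mu mu zs = \<zero>\<^bsub>E\<^esub>" if zs: "zs \<in> tuples E (Suc (1 + 1))" for zs
  proof -
    obtain x y z where "zs = [x, y, z]" "x \<in> carrier E" "y \<in> carrier E" "z \<in> carrier E"
      using zs by (auto simp del: direct_sum_simps elim!: tuples_Suc_cases)
    then have "ins E 1 mu mu zs = \<zero>\<^bsub>E\<^esub>" using ins_semidirect_square by blast
    then show ?thesis
      using balavoine_eq[OF module_E, of mu 1 mu 1 zs] semidirect_mult_multilinear zs
      by (simp add: numeral_2_eq_2 E.M.minus_eq del: direct_sum_simps)
  qed
  then show ?thesis
    using balavoine_extensional[of E 1 1 mu mu]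
    by (simp only: hom_space_simps) (intro restrict_eqI[symmetric], simp_all add: numeral_2_eq_2)
qed

sublocale D: derived_structure K "\<lambda>p. hom_space K E E (Suc p)" "balavoine E" mu
proof (rule derived_structure.intro[OF graded_bracket_balavoine[OF module_E] derived_structure_axioms.intro])
  show "mu \<in> carrier (hom_space K E E (Suc 1))"
    using semidirect_mult_multilinear by (simp add: numeral_2_eq_2)
  show "balavoine E 1 1 mu mu = \<zero>\<^bsub>hom_space K E E (Suc 2)\<^esub>"
    by (rule semidirect_mult_square)
  fix f p assume f: "f \<in> carrier (hom_space K E E (Suc p))"
    and 2: "f \<oplus>\<^bsub>hom_space K E E (Suc p)\<^esub> f = \<zero>\<^bsub>hom_space K E E (Suc p)\<^esub>"
  have "f zs = \<zero>\<^bsub>E\<^esub>" if zs: "zs \<in> tuples E (Suc p)" for zs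
  proof -
    have "f zs \<oplus>\<^bsub>E\<^esub> f zs = \<zero>\<^bsub>E\<^esub>" using fun_cong[OF 2, of zs] zs by simp
    moreover have "f zs \<in> carrier E"
      using multilinear_maps_closed[of f K E E "Suc p" zs] f zs by (simp del: direct_sum_simps)
    ultimately show ?thesis by (cases "f zs") (auto intro: no_two_torsion_L no_two_torsion_V)
  qed
  then show "f = \<zero>\<^bsub>hom_space K E E (Suc p)\<^esub>"
    using f by (auto simp: multilinear_maps_iff intro!: restrict_eqI[symmetric])
qed

text \<open>
  A map of weight \<open>k\<close> lowers the total weight of its arguments by \<open>k\<close>: the multiplication has weight
  \<open>0\<close>, the extension by zero of an \<open>n\<close>-linear map has weight \<open>n\<close>, and weights add under
  \<open>balavoine\<close>.
\<close>

definition weight_space :: "int \<Rightarrow> ('g \<times> 'v) set" where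
  "weight_space d = {(x, v). x \<in> carrier L \<and> v \<in> carrier V \<and> (d \<noteq> 0 \<longrightarrow> x = \<zero>\<^bsub>L\<^esub>) \<and> (d \<noteq> 1 \<longrightarrow> v = \<zero>\<^bsub>V\<^esub>)}"

definition has_weight :: "int \<Rightarrow> nat \<Rightarrow> (('g \<times> 'v) list \<Rightarrow> 'g \<times> 'v) \<Rightarrow> bool" where
  "has_weight k n f \<longleftrightarrow> (\<forall>ds xs. length xs = n \<longrightarrow>
     list_all2 (\<lambda>d x. x \<in> weight_space d) ds xs \<longrightarrow> f xs \<in> weight_space (sum_list ds - k))"

lemma has_weightD:
  "\<lbrakk>has_weight k n f; list_all2 (\<lambda>d x. x \<in> weight_space d) ds xs; length xs = n\<rbrakk> \<Longrightarrow> f xs \<in> weight_space (sum_list ds - k)"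
  by (auto simp: has_weight_def)

lemma weight_space_zero: "\<zero>\<^bsub>E\<^esub> \<in> weight_space d"
  by (simp add: weight_space_def)

lemma weight_space_add: "x \<in> weight_space d \<Longrightarrow> y \<in> weight_space d \<Longrightarrow> x \<oplus>\<^bsub>E\<^esub> y \<in> weight_space d"
  by (auto simp: weight_space_def)

lemma weight_space_minus: "x \<in> weight_space d \<Longrightarrow> \<ominus>\<^bsub>E\<^esub> x \<in> weight_space d"
  by (auto simp: weight_space_def E_minus)

lemma weight_space_signed: "x \<in> weight_space d \<Longrightarrow> signed E n x \<in> weight_space d"
  by (simp add: signed_def weight_space_minus)

lemma weight_space_carrier: "x \<in> weight_space d \<Longrightarrow> x \<in> carrier E"
  by (auto simp: weight_space_def)

lemma has_weight_Cons:
  assumes "has_weight k (Suc n) f" "x \<in> weight_space d"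
  shows "has_weight (k - d) n (\<lambda>xs. f (x # xs))"
  unfolding has_weight_def
proof (intro allI impI)
  fix ds xs assume "length xs = n" "list_all2 (\<lambda>d x. x \<in> weight_space d) ds xs"
  then have "f (x # xs) \<in> weight_space (sum_list (d # ds) - k)"
    using assms(2) by (intro has_weightD[OF assms(1)]) auto
  then show "f (x # xs) \<in> weight_space (sum_list ds - (k - d))"
    by (simp add: algebra_simps)
qed

text \<open>Every clause of \<open>ins\<close> preserves the balance: passing on an argument of
  weight \<open>d\<close> replaces \<open>k\<close> by \<open>k - d\<close>, absorbing it replaces
  \<open>l\<close> by \<open>l - d\<close>, and completing \<open>Q\<close> replaces the argument by
  one of weight \<open>d - l\<close>.\<close>

lemma ins_weight:
  assumes "has_weight k p f" "has_weight l (Suc q) Q" "list_all2 (\<lambda>d x. x \<in> weight_space d) ds xs" "length xs = p + q"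
  shows "ins E q f Q xs \<in> weight_space (sum_list ds - (k + l))"
  using assms
proof (induction xs arbitrary: p q f Q k l ds)
  case Nil
  then show ?case by (simp add: weight_space_zero del: direct_sum_simps)
next
  case (Cons x xs)
  obtain d ds' where ds: "ds = d # ds'" "x \<in> weight_space d" "list_all2 (\<lambda>d x. x \<in> weight_space d) ds' xs"
    using Cons.prems(3) by (auto simp: list_all2_Cons2)
  show ?case
  proof (cases p)
    case 0
    then show ?thesis using Cons.prems(4) by (subst E.ins_short) (auto simp: weight_space_zero simp del: direct_sum_simps)
  next
    case (Suc p')
    have "ins E q (\<lambda>ys. f (x # ys)) Q xs \<in> weight_space (sum_list ds' - (k - d + l))"
      using Cons.prems Suc ds by (intro Cons.IH[of _ p'] has_weight_Cons) auto
    then have 1: "ins E q (\<lambda>ys. f (x # ys)) Q xs \<in> weight_space (sum_list ds - (k + l))"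
      using ds(1) by (simp add: algebra_simps)
    show ?thesis
    proof (cases q)
      case 0
      have "Q [x] \<in> weight_space (sum_list [d] - l)"
        using Cons.prems(2) ds 0 by (intro has_weightD[OF Cons.prems(2)]) auto
      then have "f (Q [x] # xs) \<in> weight_space (sum_list ((d - l) # ds') - k)"
        using Cons.prems Suc 0 ds by (intro has_weightD[OF Cons.prems(1)]) auto
      then have "f (Q [x] # xs) \<in> weight_space (sum_list ds - (k + l))"
        using ds(1) by (simp add: algebra_simps)
      then show ?thesis using 1 0 weight_space_add by (simp del: direct_sum_simps)
    next
      case (Suc q')
      have "ins E q' f (\<lambda>ys. Q (x # ys)) xs \<in> weight_space (sum_list ds' - (k + (l - d)))"
        using Cons.prems Suc ds by (intro Cons.IH[of _ p] has_weight_Cons) auto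
      then have "ins E q' f (\<lambda>ys. Q (x # ys)) xs \<in> weight_space (sum_list ds - (k + l))"
        using ds(1) by (simp add: algebra_simps)
      then show ?thesis using 1 Suc weight_space_add weight_space_signed by (simp del: direct_sum_simps)
    qed
  qed
qed

lemma homogeneous_tuples:
  "list_all2 (\<lambda>d x. x \<in> weight_space d) ds xs \<Longrightarrow> length xs = n \<Longrightarrow> xs \<in> tuples E n"
  by (induction ds xs arbitrary: n rule: list_all2_induct) (auto dest: weight_space_carrier)

lemma balavoine_weight:
  assumes "has_weight k (Suc p) P" "has_weight l (Suc q) Q"
    and "P \<in> multilinear_maps K E E (Suc p)" "Q \<in> multilinear_maps K E E (Suc q)"
  shows "has_weight (k + l) (Suc (p + q)) (balavoine E p q P Q)"
  unfolding has_weight_def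
proof (intro allI impI)
  fix ds xs assume xs: "length xs = Suc (p + q)" "list_all2 (\<lambda>d x. x \<in> weight_space d) ds xs"
  have "ins E q P Q xs \<in> weight_space (sum_list ds - (k + l))"
    by (rule ins_weight[OF assms(1,2) xs(2)]) (use xs in simp)
  moreover have "ins E p Q P xs \<in> weight_space (sum_list ds - (l + k))"
    by (rule ins_weight[OF assms(2,1) xs(2)]) (use xs in simp)
  ultimately show "balavoine E p q P Q xs \<in> weight_space (sum_list ds - (k + l))"
    unfolding balavoine_eq[OF module_E assms(3,4) homogeneous_tuples[OF xs(2,1)]] E.M.minus_eq
    by (intro weight_space_add weight_space_minus weight_space_signed) (simp_all add: add.commute)
qed

lemma semidirect_mult_weight: "has_weight 0 2 mu"
  unfolding has_weight_def
proof (intro allI impI)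
  fix ds xs assume "length xs = 2" "list_all2 (\<lambda>d x. x \<in> weight_space d) ds xs"
  then obtain d e a u b v where *: "ds = [d, e]" "xs = [(a, u), (b, v)]" "(a, u) \<in> weight_space d" "(b, v) \<in> weight_space e"
    by (auto simp: numeral_2_eq_2 length_Suc_conv list_all2_Cons2)
  then have "mult (a, u) (b, v) \<in> weight_space (d + e)"
    by (cases "d = 0"; cases "e = 0") (auto simp: weight_space_def mult_def)
  then show "mu xs \<in> weight_space (sum_list ds - 0)"
    using * weight_space_carrier semidirect_mult_apply[of "(a, u)" "(b, v)"] by (auto simp del: direct_sum_simps)
qed

lemma multilinear_zero_arg:
  assumes "multilinear K V L n g" "vs \<in> tuples V n" "\<zero>\<^bsub>V\<^esub> \<in> set vs"
  shows "g vs = \<zero>\<^bsub>L\<^esub>"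
proof -
  obtain i where i: "i < n" "vs ! i = \<zero>\<^bsub>V\<^esub>"
    using assms(2,3) by (auto simp: tuples_def in_set_conv_nth)
  have "(\<lambda>v. g (vs[i := v])) \<in> module_hom K V L"
    using assms i by (simp add: multilinear_def)
  from module_hom_zero[OF this V.module_axioms L.module_axioms] show ?thesis
    using i list_update_id[of vs i] by simp
qed

abbreviation ext :: "nat \<Rightarrow> ('v list \<Rightarrow> 'g) \<Rightarrow> ('g \<times> 'v) list \<Rightarrow> 'g \<times> 'v" where
  "ext \<equiv> extend_zero L V"

text \<open>The recovery step inside \<open>derived_bracket\<close>, isolated because it is linear
  and because \<open>ext\<close> undoes it on maps of weight \<open>n\<close>.\<close>

definition restr :: "nat \<Rightarrow> (('g \<times> 'v) list \<Rightarrow> 'g \<times> 'v) \<Rightarrow> 'v list \<Rightarrow> 'g" where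
  "restr n B = (\<lambda>vs\<in>tuples V n. fst (B (map (\<lambda>v. (\<zero>\<^bsub>L\<^esub>, v)) vs)))"

lemma ext_hom: "ext n \<in> module_hom K (hom_space K V L n) (hom_space K E E n)"
proof -
  have "snd \<in> module_hom K E V" "(\<lambda>x. (x, \<zero>\<^bsub>V\<^esub>)) \<in> module_hom K L E"
    by (auto simp: module_hom_def)
  from module_hom_transport[OF this V.module_axioms module_E L.module_axioms module_E, of n]
  show ?thesis by (simp add: extend_zero_def[abs_def])
qed

lemma restr_hom: "restr n \<in> module_hom K (hom_space K E E n) (hom_space K V L n)"
proof -
  have "(\<lambda>v. (\<zero>\<^bsub>L\<^esub>, v)) \<in> module_hom K V E" "fst \<in> module_hom K E L"
    by (auto simp: module_hom_def)
  from module_hom_transport[OF this module_E V.module_axioms module_E L.module_axioms, of n]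
  show ?thesis by (simp add: restr_def[abs_def])
qed

lemma ext_closed: "g \<in> multilinear_maps K V L n \<Longrightarrow> ext n g \<in> multilinear_maps K E E n"
  using module_hom_closed[OF ext_hom] by auto

lemma restr_closed: "B \<in> multilinear_maps K E E n \<Longrightarrow> restr n B \<in> multilinear_maps K V L n"
  using module_hom_closed[OF restr_hom] by auto

text \<open>If the total weight is not \<open>n\<close>, some argument has weight different from 1.
  Its component in \<open>V\<close> is then zero, and \<open>g\<close> vanishes on the list.\<close>

lemma ext_weight:
  assumes "g \<in> multilinear_maps K V L n"
  shows "has_weight (int n) n (ext n g)"
  unfolding has_weight_def
proof (intro allI impI)
  fix ds xs assume xs: "length xs = n" "list_all2 (\<lambda>d x. x \<in> weight_space d) ds xs"
  note t = homogeneous_tuples[OF xs(2,1)]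
  then have v: "map snd xs \<in> tuples V n" by (intro tuples_map[of E]) auto
  have "g (map snd xs) = \<zero>\<^bsub>L\<^esub>" if "sum_list ds - int n \<noteq> 0"
  proof -
    have "\<exists>d\<in>set ds. d \<noteq> 1"
    proof (rule ccontr)
      assume "\<not> (\<exists>d\<in>set ds. d \<noteq> 1)"
      then have "ds = replicate (length ds) 1" by (intro replicate_eqI) auto
      then have "sum_list ds = int (length ds)" by (metis sum_list_replicate mult.right_neutral)
      then show False using that xs list_all2_lengthD[OF xs(2)] by simp
    qed
    then obtain i where i: "i < length ds" "ds ! i \<noteq> 1" by (auto simp: in_set_conv_nth)
    then have "xs ! i \<in> weight_space (ds ! i)" "i < length xs"
      using list_all2_nthD[OF xs(2)] list_all2_lengthD[OF xs(2)] by auto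
    then have "snd (xs ! i) = \<zero>\<^bsub>V\<^esub>" using i by (auto simp: weight_space_def)
    then have "\<zero>\<^bsub>V\<^esub> \<in> set (map snd xs)" using \<open>i < length xs\<close> by (metis length_map nth_map nth_mem)
    then show ?thesis using assms v by (intro multilinear_zero_arg) (auto simp: multilinear_maps_iff)
  qed
  moreover have "g (map snd xs) \<in> carrier L" using multilinear_maps_closed[OF assms v] .
  ultimately show "ext n g xs \<in> weight_space (sum_list ds - int n)"
    using t by (auto simp: extend_zero_def weight_space_def)
qed

text \<open>Every argument is the sum of its components in \<open>L\<close> and in \<open>V\<close>,
  which have weights 0 and 1.\<close>

lemma multilinear_eq_on_homogeneous:
  assumes "multilinear K E E n f" "multilinear K E E n g"
    and "\<And>ds xs. \<lbrakk>list_all2 (\<lambda>d x. x \<in> weight_space d) ds xs; set ds \<subseteq> {0, 1}; length xs = n\<rbrakk> \<Longrightarrow> f xs = g xs"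
    and "xs \<in> tuples E n"
  shows "f xs = g xs"
  using assms
proof (induction n arbitrary: f g xs)
  case 0
  then show ?case using 0(3)[of "[]" "[]"] by simp
next
  case (Suc n)
  obtain x ys where x: "xs = x # ys" "x \<in> carrier E" "ys \<in> tuples E n"
    using Suc.prems(4) by (rule tuples_Suc_cases)
  have h: "f (y # ys) = g (y # ys)" if y: "y \<in> weight_space d" "d \<in> {0, 1}" for y d
  proof (rule Suc.IH[of "\<lambda>ys. f (y # ys)" "\<lambda>ys. g (y # ys)"])
    fix ds zs assume "list_all2 (\<lambda>d x. x \<in> weight_space d) ds zs" "set ds \<subseteq> {0, 1}" "length zs = n"
    then show "f (y # zs) = g (y # zs)" using y by (intro Suc.prems(3)[of "d # ds"]) auto
  qed (use Suc.prems(1,2) x(3) weight_space_carrier[OF y(1)] in \<open>auto intro!: multilinear_Cons simp del: direct_sum_simps\<close>)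
  obtain a v where av: "x = (a, v)" "a \<in> carrier L" "v \<in> carrier V" using x by auto
  have w: "(a, \<zero>\<^bsub>V\<^esub>) \<in> weight_space 0" "(\<zero>\<^bsub>L\<^esub>, v) \<in> weight_space 1"
    using av by (auto simp: weight_space_def)
  have xs: "x = (a, \<zero>\<^bsub>V\<^esub>) \<oplus>\<^bsub>E\<^esub> (\<zero>\<^bsub>L\<^esub>, v)" using av by simp
  note s = module_hom_add[OF multilinear_head[OF _ x(3)] weight_space_carrier[OF w(1)] weight_space_carrier[OF w(2)]]
  show ?case unfolding x(1) xs s[OF Suc.prems(1)] s[OF Suc.prems(2)]
    using h[OF w(1)] h[OF w(2)] by (simp del: direct_sum_simps)
qed

lemma weight_space_negative: "x \<in> weight_space d \<Longrightarrow> d < 0 \<Longrightarrow> x = \<zero>\<^bsub>E\<^esub>"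
  by (auto simp: weight_space_def)

lemma sum_list_le_length: "set ds \<subseteq> {0, 1 :: int} \<Longrightarrow> sum_list ds \<le> int (length ds)"
  by (induction ds) auto

lemma sum_list_eq_length: "set ds \<subseteq> {0, 1 :: int} \<Longrightarrow> sum_list ds = int (length ds) \<Longrightarrow> set ds \<subseteq> {1}"
proof (induction ds)
  case (Cons d ds)
  then show ?case using sum_list_le_length[of ds] by auto
qed simp

text \<open>With weights in \<open>{0, 1}\<close>, total weight \<open>n\<close> on \<open>n\<close>
  arguments forces all of them into \<open>V\<close>, where both sides agree by construction. A
  smaller total leads to a value of negative weight, hence to zero on both sides.\<close>

lemma ext_restr:
  assumes "B \<in> multilinear_maps K E E n" "has_weight (int n) n B"
  shows "ext n (restr n B) = B"
proof (rule multilinear_maps_ext)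
  note r = restr_closed[OF assms(1)]
  show er: "ext n (restr n B) \<in> multilinear_maps K E E n" by (rule ext_closed[OF r])
  fix xs assume xs: "xs \<in> tuples E n"
  show "ext n (restr n B) xs = B xs"
  proof (rule multilinear_eq_on_homogeneous[OF _ _ _ xs])
    fix ds ys assume ys: "list_all2 (\<lambda>d x. x \<in> weight_space d) ds ys" "set ds \<subseteq> {0, 1}" "length ys = n"
    note t = homogeneous_tuples[OF ys(1,3)] and len = list_all2_lengthD[OF ys(1)]
    note w = has_weightD[OF assms(2) ys(1,3)] has_weightD[OF ext_weight[OF r] ys(1,3)]
    show "ext n (restr n B) ys = B ys"
    proof (cases "sum_list ds = int n")
      case True
      then have d: "set ds \<subseteq> {1}" using sum_list_eq_length[OF ys(2)] len ys(3) by simp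
      have "fst (ys ! i) = \<zero>\<^bsub>L\<^esub>" if "i < n" for i
      proof -
        have "ds ! i \<in> set ds" using that len ys(3) by (intro nth_mem) simp
        then have "ds ! i = 1" using d by auto
        then show ?thesis using list_all2_nthD2[OF ys(1), of i] that ys(3) by (auto simp: weight_space_def)
      qed
      then have "map (\<lambda>v. (\<zero>\<^bsub>L\<^esub>, v)) (map snd ys) = ys"
        using ys(3) by (intro nth_equalityI) (auto simp: prod_eq_iff)
      moreover have "map snd ys \<in> tuples V n" using t by (intro tuples_map[of E]) auto
      moreover have "snd (B ys) = \<zero>\<^bsub>V\<^esub>" using w(1) True by (auto simp: weight_space_def)
      ultimately show ?thesis using t by (simp add: extend_zero_def restr_def prod_eq_iff)
    next
      case False
      then have "sum_list ds - int n < 0" using sum_list_le_length[OF ys(2)] len ys(3) by simp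
      then show ?thesis using weight_space_negative[OF w(1)] weight_space_negative[OF w(2)] by metis
    qed
  qed (use er assms(1) in \<open>auto simp: multilinear_maps_iff\<close>)
qed (rule assms(1))

text \<open>The bracket lowers weights by \<open>p + q + 2\<close> but has only
  \<open>p + q + 1\<close> arguments, each of weight at most 1. Its values thus have negative
  weight.\<close>

lemma balavoine_ext_zero:
  assumes "g \<in> multilinear_maps K V L (Suc p)" "h \<in> multilinear_maps K V L (Suc q)"
  shows "balavoine E p q (ext (Suc p) g) (ext (Suc q) h) = \<zero>\<^bsub>hom_space K E E (Suc (p + q))\<^esub>"
proof (rule multilinear_maps_ext)
  note e = ext_closed[OF assms(1)] ext_closed[OF assms(2)]
  let ?B = "balavoine E p q (ext (Suc p) g) (ext (Suc q) h)"
  interpret H: module K "hom_space K E E (Suc (p + q))" by (rule module_hom_space[OF module_E module_E])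
  show B: "?B \<in> multilinear_maps K E E (Suc (p + q))" by (rule multilinear_balavoine[OF module_E e])
  show z: "\<zero>\<^bsub>hom_space K E E (Suc (p + q))\<^esub> \<in> multilinear_maps K E E (Suc (p + q))"
    using H.M.zero_closed by simp
  have wt: "has_weight (int (Suc p) + int (Suc q)) (Suc (p + q)) ?B"
    by (rule balavoine_weight[OF ext_weight[OF assms(1)] ext_weight[OF assms(2)] e])
  fix xs assume xs: "xs \<in> tuples E (Suc (p + q))"
  show "?B xs = \<zero>\<^bsub>hom_space K E E (Suc (p + q))\<^esub> xs"
  proof (rule multilinear_eq_on_homogeneous[OF _ _ _ xs])
    fix ds ys assume ys: "list_all2 (\<lambda>d x. x \<in> weight_space d) ds ys" "set ds \<subseteq> {0, 1}" "length ys = Suc (p + q)"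
    have "sum_list ds - (int (Suc p) + int (Suc q)) < 0"
      using sum_list_le_length[OF ys(2)] list_all2_lengthD[OF ys(1)] ys(3) by simp
    then show "?B ys = \<zero>\<^bsub>hom_space K E E (Suc (p + q))\<^esub> ys"
      using weight_space_negative[OF has_weightD[OF wt ys(1,3)]] homogeneous_tuples[OF ys(1,3)] by simp
  qed (use B z in \<open>auto simp: multilinear_maps_iff simp del: hom_space_simps\<close>)
qed

text \<open>The multiplication contributes weight 0 and the two extensions \<open>Suc p\<close> and
  \<open>Suc q\<close>. The sum equals the number of arguments, which is the condition in
  \<open>ext_restr\<close>.\<close>

lemma derived_weight:
  assumes "g \<in> multilinear_maps K V L (Suc p)" "h \<in> multilinear_maps K V L (Suc q)"
  shows "has_weight (int (Suc (Suc (p + q)))) (Suc (Suc (p + q))) (D.derived p q (ext (Suc p) g) (ext (Suc q) h))"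
proof -
  note e = ext_closed[OF assms(1)] ext_closed[OF assms(2)]
  have mu2: "mu \<in> multilinear_maps K E E (Suc 1)" "has_weight 0 (Suc 1) mu"
    using semidirect_mult_multilinear semidirect_mult_weight by (simp_all add: numeral_2_eq_2)
  have d: "balavoine E 1 p mu (ext (Suc p) g) \<in> multilinear_maps K E E (Suc (Suc p))"
    using multilinear_balavoine[OF module_E mu2(1) e(1)] by simp
  have wd: "has_weight (int (Suc p)) (Suc (Suc p)) (balavoine E 1 p mu (ext (Suc p) g))"
    using balavoine_weight[OF mu2(2) ext_weight[OF assms(1)] mu2(1) e(1)] by simp
  let ?B = "balavoine E (Suc p) q (balavoine E 1 p mu (ext (Suc p) g)) (ext (Suc q) h)"
  have B: "?B \<in> multilinear_maps K E E (Suc (Suc (p + q)))"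
    using multilinear_balavoine[OF module_E d e(2)] by simp
  have wB: "has_weight (int (Suc (Suc (p + q)))) (Suc (Suc (p + q))) ?B"
    using balavoine_weight[OF wd ext_weight[OF assms(2)] d e(2)] by (simp add: algebra_simps)
  show ?thesis
    unfolding D.derived_def D.differential_def hom_space_signed[OF module_E module_E B]
    using wB homogeneous_tuples weight_space_signed by (auto simp: has_weight_def)
qed

text \<open>For arity \<open>m = Suc p\<close> the sign (-1)^(m-1) is the \<open>signed\<close>
  factor of \<open>D.derived\<close>; taking it out uses that \<open>fst\<close> commutes with
  signs.\<close>

lemma derived_bracket_eq:
  assumes "g \<in> multilinear_maps K V L (Suc p)" "h \<in> multilinear_maps K V L (Suc q)"
  shows "derived_bracket L V (Suc p) (Suc q) g h = restr (Suc (Suc (p + q))) (D.derived p q (ext (Suc p) g) (ext (Suc q) h))"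
proof -
  note e = ext_closed[OF assms(1)] ext_closed[OF assms(2)]
  let ?B = "balavoine E (Suc p) q (balavoine E 1 p mu (ext (Suc p) g)) (ext (Suc q) h)"
  have B: "?B \<in> multilinear_maps K E E (Suc (Suc (p + q)))"
    using D.br_closed[OF D.differential_closed, of "ext (Suc p) g" p "ext (Suc q) h" q] e
    by (simp add: D.differential_def)
  have f: "fst (signed E n x) = signed L n (fst x)" if "x \<in> carrier E" for n x
    using that by (cases x) (simp add: signed_def E_minus)
  have t: "map (\<lambda>v. (\<zero>\<^bsub>L\<^esub>, v)) vs \<in> tuples E (Suc (Suc (p + q)))" if "vs \<in> tuples V (Suc (Suc (p + q)))" for vs
    using that by (intro tuples_map[of V]) auto
  have "fst (?B (map (\<lambda>v. (\<zero>\<^bsub>L\<^esub>, v)) vs)) \<in> carrier L" if "vs \<in> tuples V (Suc (Suc (p + q)))" for vs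
    using multilinear_maps_closed[OF B t[OF that]] by auto
  then show ?thesis
    unfolding derived_bracket_def restr_def D.derived_def D.differential_def hom_space_signed[OF module_E module_E B]
    by (auto simp: L.M.add_pow_signed t f[OF multilinear_maps_closed[OF B t]] intro!: restrict_ext
        simp del: direct_sum_simps One_nat_def)
qed

text \<open>Allows iterated brackets to be computed on the direct sum: without it, the inner bracket
  in the Jacobi identity would be restricted and extended again before it enters the outer
  one.\<close>

lemma ext_derived_bracket:
  assumes "g \<in> multilinear_maps K V L (Suc p)" "h \<in> multilinear_maps K V L (Suc q)"
  shows "ext (Suc (Suc (p + q))) (derived_bracket L V (Suc p) (Suc q) g h) = D.derived p q (ext (Suc p) g) (ext (Suc q) h)"
  unfolding derived_bracket_eq[OF assms]
  using D.derived_closed[of "ext (Suc p) g" p "ext (Suc q) h" q] ext_closed assms derived_weight[OF assms]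
  by (intro ext_restr) auto

end

section \<open>The controlling algebra is a graded Lie algebra\<close>

lemma controlling_algebra_simps [simp]:
  "component (controlling_algebra K L V) = hom_space K V L"
  "gbracket (controlling_algebra K L V) = derived_bracket L V"
  by (simp_all add: controlling_algebra_def)

lemma ge_1_Suc: "n \<ge> 1 \<Longrightarrow> \<exists>m. n = Suc m"
  by (cases n) auto

context leibniz_pair
begin

abbreviation H :: "nat \<Rightarrow> ('k, 'v list \<Rightarrow> 'g) module" where "H n \<equiv> hom_space K V L n"

lemma module_H: "module K (H n)"
  by (rule module_hom_space[OF V.module_axioms L.module_axioms])

lemma derived_bracket_bilinear:
  "derived_bracket L V (Suc p) (Suc q) \<in> bilinear_maps K (H (Suc p)) (H (Suc q)) (H (Suc (Suc (p + q))))"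
proof -
  let ?D = "\<lambda>g h. restr (Suc (Suc (p + q))) (D.derived p q (ext (Suc p) g) (ext (Suc q) h))"
  have "derived_bracket L V (Suc p) (Suc q) g \<in> module_hom K (H (Suc q)) (H (Suc (Suc (p + q))))"
    if g: "g \<in> multilinear_maps K V L (Suc p)" for g
  proof -
    have "D.derived p q (ext (Suc p) g) \<in> module_hom K (hom_space K E E (Suc q)) (hom_space K E E (Suc (Suc (p + q))))"
      using bilinear_mapsD(1)[OF D.derived_bilinear, of "ext (Suc p) g" p q] ext_closed[OF g] by simp
    from module_hom_compose[OF module_hom_compose[OF ext_hom this] restr_hom]
    show ?thesis
      using derived_bracket_eq[OF g] by (subst module_hom_cong[OF _ module_H, where g = "?D g"]) auto
  qed
  moreover have "(\<lambda>g. derived_bracket L V (Suc p) (Suc q) g h) \<in> module_hom K (H (Suc p)) (H (Suc (Suc (p + q))))"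
    if h: "h \<in> multilinear_maps K V L (Suc q)" for h
  proof -
    have "(\<lambda>x. D.derived p q x (ext (Suc q) h)) \<in> module_hom K (hom_space K E E (Suc p)) (hom_space K E E (Suc (Suc (p + q))))"
      using bilinear_mapsD(2)[OF D.derived_bilinear, of "ext (Suc q) h" q p] ext_closed[OF h] by simp
    from module_hom_compose[OF module_hom_compose[OF ext_hom this] restr_hom]
    show ?thesis
      using derived_bracket_eq[OF _ h] by (subst module_hom_cong[OF _ module_H, where g = "\<lambda>g. ?D g h"]) auto
  qed
  ultimately show ?thesis by (simp add: bilinear_maps_def)
qed

lemma derived_bracket_closed:
  "g \<in> multilinear_maps K V L (Suc p) \<Longrightarrow> h \<in> multilinear_maps K V L (Suc q) \<Longrightarrow>
   derived_bracket L V (Suc p) (Suc q) g h \<in> multilinear_maps K V L (Suc (Suc (p + q)))"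
  using bilinear_maps_closed[OF derived_bracket_bilinear[of p q], of g h] by simp

lemma derived_bracket_skew:
  assumes g: "g \<in> multilinear_maps K V L (Suc p)" and h: "h \<in> multilinear_maps K V L (Suc q)"
  defines "N \<equiv> Suc (Suc (p + q))"
  shows "derived_bracket L V (Suc p) (Suc q) g h =
    \<ominus>\<^bsub>H N\<^esub> (signed (H N) (Suc p * Suc q) (derived_bracket L V (Suc q) (Suc p) h g))"
proof -
  note e = ext_closed[OF g] ext_closed[OF h]
  let ?X = "hom_space K E E N"
  have mX: "module K ?X" by (rule module_hom_space[OF module_E module_E])
  interpret X: module K ?X by (rule mX)
  have c: "D.derived q p (ext (Suc q) h) (ext (Suc p) g) \<in> carrier ?X"
    using D.derived_closed[of "ext (Suc q) h" q "ext (Suc p) g" p] e by (simp add: N_def add.commute)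
  have "D.derived p q (ext (Suc p) g) (ext (Suc q) h) =
      \<ominus>\<^bsub>?X\<^esub> (signed ?X (Suc p * Suc q) (D.derived q p (ext (Suc q) h) (ext (Suc p) g)))"
    unfolding N_def using e balavoine_ext_zero[OF g h] by (intro D.derived_skew) simp_all
  then have "restr N (D.derived p q (ext (Suc p) g) (ext (Suc q) h)) =
      \<ominus>\<^bsub>H N\<^esub> (signed (H N) (Suc p * Suc q) (restr N (D.derived q p (ext (Suc q) h) (ext (Suc p) g))))"
    using module_hom_signed_apply(1)[OF restr_hom mX module_H c]
      module_hom_signed_apply(2)[OF restr_hom mX module_H X.M.signed_closed[OF c]] by simp
  then show ?thesis
    unfolding derived_bracket_eq[OF g h] derived_bracket_eq[OF h g] N_def add.commute[of q p] .
qed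

lemma derived_bracket_jacobi:
  assumes f: "f \<in> multilinear_maps K V L (Suc a)" and g: "g \<in> multilinear_maps K V L (Suc b)"
    and h: "h \<in> multilinear_maps K V L (Suc c)"
  defines "N \<equiv> Suc (Suc (Suc (a + b + c)))"
  shows "derived_bracket L V (Suc a) (Suc (Suc (b + c))) f (derived_bracket L V (Suc b) (Suc c) g h) =
    derived_bracket L V (Suc (Suc (a + b))) (Suc c) (derived_bracket L V (Suc a) (Suc b) f g) h \<oplus>\<^bsub>H N\<^esub>
    signed (H N) (Suc a * Suc b)
      (derived_bracket L V (Suc b) (Suc (Suc (a + c))) g (derived_bracket L V (Suc a) (Suc c) f h))"
proof -
  note e = ext_closed[OF f] ext_closed[OF g] ext_closed[OF h]
  let ?X = "hom_space K E E N"
  let ?f = "ext (Suc a) f" and ?g = "ext (Suc b) g" and ?h = "ext (Suc c) h"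
  have mX: "module K ?X" by (rule module_hom_space[OF module_E module_E])
  interpret X: module K ?X by (rule mX)
  have dc: "D.derived p q x y \<in> multilinear_maps K E E (Suc (Suc (p + q)))"
    if "x \<in> multilinear_maps K E E (Suc p)" "y \<in> multilinear_maps K E E (Suc q)" for p q x y
    using D.derived_closed[of x p y q] that by simp
  have c1: "D.derived (Suc (a + b)) c (D.derived a b ?f ?g) ?h \<in> carrier ?X"
    using dc[OF dc[OF e(1,2)] e(3)] by (simp add: N_def)
  have c2: "D.derived b (Suc (a + c)) ?g (D.derived a c ?f ?h) \<in> carrier ?X"
    using dc[OF e(2) dc[OF e(1,3)]] by (simp add: N_def ac_simps)
  have "D.derived a (Suc (b + c)) ?f (D.derived b c ?g ?h) =
      D.derived (Suc (a + b)) c (D.derived a b ?f ?g) ?h \<oplus>\<^bsub>?X\<^esub>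
      signed ?X (Suc a * Suc b) (D.derived b (Suc (a + c)) ?g (D.derived a c ?f ?h))"
    unfolding N_def using e by (intro D.derived_jacobi) simp_all
  then have "restr N (D.derived a (Suc (b + c)) ?f (D.derived b c ?g ?h)) =
      restr N (D.derived (Suc (a + b)) c (D.derived a b ?f ?g) ?h) \<oplus>\<^bsub>H N\<^esub>
      signed (H N) (Suc a * Suc b) (restr N (D.derived b (Suc (a + c)) ?g (D.derived a c ?f ?h)))"
    using module_hom_signed_apply(1)[OF restr_hom mX module_H c2]
      module_hom_add[OF restr_hom c1 X.M.signed_closed[OF c2]] by simp
  moreover have "Suc (Suc (a + Suc (b + c))) = N" "Suc (Suc (Suc (a + b) + c)) = N" "Suc (Suc (b + Suc (a + c))) = N"
    by (simp_all add: N_def)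
  ultimately show ?thesis
    using derived_bracket_eq[OF f derived_bracket_closed[OF g h]] derived_bracket_eq[OF derived_bracket_closed[OF f g] h]
      derived_bracket_eq[OF g derived_bracket_closed[OF f h]]
    by (simp only: ext_derived_bracket[OF f g] ext_derived_bracket[OF g h] ext_derived_bracket[OF f h])
qed

lemma graded_lie_algebra_controlling:
  assumes "field K"
  shows "graded_lie_algebra K (controlling_algebra K L V)"
proof -
  have ab: "abelian_group (H n)" for n
    using module_H[of n] by (simp add: module_def)
  have aps: "[((- 1 :: int) ^ k)] \<cdot>\<^bsub>H n\<^esub> x = signed (H n) k x" if "x \<in> multilinear_maps K V L n" for n k x
    using abelian_group.add_pow_signed[OF ab, of x n k] that by simp
  have vs: "vectorspace K (H n)" for n
    using module_H assms by (simp add: vectorspace_def)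
  have bil: "derived_bracket L V m n \<in> bilinear_maps K (H m) (H n) (H (m + n))" if "m \<ge> 1" "n \<ge> 1" for m n
    using ge_1_Suc[OF that(1)] ge_1_Suc[OF that(2)] derived_bracket_bilinear by auto
  have skew: "derived_bracket L V m n x y = \<ominus>\<^bsub>H (m + n)\<^esub> ([((- 1 :: int) ^ (m * n))] \<cdot>\<^bsub>H (m + n)\<^esub> derived_bracket L V n m y x)"
    if mn: "m \<ge> 1" "n \<ge> 1" and xy: "x \<in> multilinear_maps K V L m" "y \<in> multilinear_maps K V L n" for m n x y
  proof -
    obtain p q where p: "m = Suc p" "n = Suc q" using ge_1_Suc mn by blast
    have "derived_bracket L V n m y x \<in> multilinear_maps K V L (Suc (Suc (p + q)))"
      using derived_bracket_closed[of y q x p] xy by (simp add: p add.commute)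
    then show ?thesis
      using derived_bracket_skew[of x p y q] xy by (simp add: p aps del: power_Suc mult_Suc mult_Suc_right)
  qed
  have jac: "derived_bracket L V l (m + n) x (derived_bracket L V m n y z) =
      derived_bracket L V (l + m) n (derived_bracket L V l m x y) z \<oplus>\<^bsub>H (l + m + n)\<^esub>
      [((- 1 :: int) ^ (l * m))] \<cdot>\<^bsub>H (l + m + n)\<^esub> derived_bracket L V m (l + n) y (derived_bracket L V l n x z)"
    if lmn: "l \<ge> 1" "m \<ge> 1" "n \<ge> 1"
      and xyz: "x \<in> multilinear_maps K V L l" "y \<in> multilinear_maps K V L m" "z \<in> multilinear_maps K V L n" for l m n x y z
  proof -
    obtain a b c where p: "l = Suc a" "m = Suc b" "n = Suc c" using ge_1_Suc lmn by meson
    have xz: "derived_bracket L V (Suc a) (Suc c) x z \<in> multilinear_maps K V L (Suc (Suc (a + c)))"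
      using derived_bracket_closed[of x a z c] xyz by (simp add: p)
    have "derived_bracket L V (Suc b) (Suc (Suc (a + c))) y (derived_bracket L V (Suc a) (Suc c) x z)
        \<in> multilinear_maps K V L (Suc (Suc (b + Suc (a + c))))"
      using derived_bracket_closed[OF _ xz, of y b] xyz by (simp add: p)
    moreover have "Suc (Suc (b + Suc (a + c))) = Suc (Suc (Suc (a + b + c)))" by simp
    ultimately have "derived_bracket L V (Suc b) (Suc (Suc (a + c))) y (derived_bracket L V (Suc a) (Suc c) x z)
        \<in> multilinear_maps K V L (Suc (Suc (Suc (a + b + c))))" by (simp only:)
    then show ?thesis
      using derived_bracket_jacobi[of x a y b z c] xyz by (simp add: p aps del: power_Suc mult_Suc mult_Suc_right)
  qed
  show ?thesis
    unfolding graded_lie_algebra_def controlling_algebra_simps hom_space_simps(1)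
    by (intro conjI allI impI ballI; (rule vs bil skew jac; assumption))
qed

end

section \<open>Naturality of the brackets\<close>

lemma ins_natural:
  assumes "module K E" "module K F" and h: "h \<in> module_hom K E F"
    and "\<And>ys. ys \<in> tuples E p \<Longrightarrow> f ys \<in> carrier E" "\<And>ys. ys \<in> tuples E (Suc q) \<Longrightarrow> Q ys \<in> carrier E"
    and "\<And>ys. ys \<in> tuples E p \<Longrightarrow> h (f ys) = f' (map h ys)"
    and "\<And>ys. ys \<in> tuples E (Suc q) \<Longrightarrow> h (Q ys) = Q' (map h ys)"
    and "xs \<in> tuples E (p + q)"
  shows "h (ins E q f Q xs) = ins F q f' Q' (map h xs)"
  using assms(4-)
proof (induction xs arbitrary: p q f f' Q Q')
  case Nil
  then show ?case using module_hom_zero[OF h assms(1,2)] by simp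
next
  case (Cons x xs)
  interpret E: module K E by fact
  interpret F: module K F by fact
  show ?case
  proof (cases p)
    case 0
    then have "length (x # xs) \<le> q" using Cons.prems(5) by (auto dest: length_tuples)
    then show ?thesis using module_hom_zero[OF h assms(1,2)] by (simp add: E.ins_short F.ins_short del: ins.simps)
  next
    case (Suc p')
    have xs: "x \<in> carrier E" "xs \<in> tuples E (p' + q)" using Cons.prems(5) Suc by auto
    have c1: "ins E q (\<lambda>ys. f (x # ys)) Q xs \<in> carrier E"
      using Cons.prems(1,2) xs Suc by (intro E.ins_closed[of p']) auto
    have "h (ins E q (\<lambda>ys. f (x # ys)) Q xs) = ins F q (\<lambda>ys. f' (h x # ys)) Q' (map h xs)"
      using Cons.prems xs Suc by (intro Cons.IH[of p']) auto
    then have 1: "h (signed E q (ins E q (\<lambda>ys. f (x # ys)) Q xs)) = signed F q (ins F q (\<lambda>ys. f' (h x # ys)) Q' (map h xs))"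
      using module_hom_signed_apply(1)[OF h assms(1,2) c1] by simp
    show ?thesis
    proof (cases q)
      case 0
      have "f (Q [x] # xs) \<in> carrier E" "h (f (Q [x] # xs)) = f' (Q' [h x] # map h xs)"
        using Cons.prems xs Suc 0 by auto
      then show ?thesis using 1 c1 0 by (simp add: module_hom_add[OF h])
    next
      case (Suc q')
      have c2: "ins E q' f (\<lambda>ys. Q (x # ys)) xs \<in> carrier E"
        using Cons.prems(1,2) xs Suc \<open>p = Suc p'\<close> by (intro E.ins_closed[of p]) auto
      have "h (ins E q' f (\<lambda>ys. Q (x # ys)) xs) = ins F q' f' (\<lambda>ys. Q' (h x # ys)) (map h xs)"
        using Cons.prems xs Suc \<open>p = Suc p'\<close> by (intro Cons.IH[of p]) auto
      then show ?thesis using 1 c1 c2 Suc by (simp add: module_hom_add[OF h])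
    qed
  qed
qed

lemma balavoine_natural:
  fixes E :: "('k, 'e) module" and F :: "('k, 'f) module"
  assumes "module K E" "module K F" "h \<in> module_hom K E F"
    and P: "P \<in> multilinear_maps K E E (Suc p)" "P' \<in> multilinear_maps K F F (Suc p)"
      "\<And>ys. ys \<in> tuples E (Suc p) \<Longrightarrow> h (P ys) = P' (map h ys)"
    and Q: "Q \<in> multilinear_maps K E E (Suc q)" "Q' \<in> multilinear_maps K F F (Suc q)"
      "\<And>ys. ys \<in> tuples E (Suc q) \<Longrightarrow> h (Q ys) = Q' (map h ys)"
    and xs: "xs \<in> tuples E (Suc (p + q))"
  shows "h (balavoine E p q P Q xs) = balavoine F p q P' Q' (map h xs)"
proof -
  interpret E: module K E by fact
  interpret F: module K F by fact
  have xs': "map h xs \<in> tuples F (Suc (p + q))"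
    using module_hom_closed[OF assms(3)] xs by (intro tuples_map) auto
  note cP = multilinear_maps_closed[OF P(1)] and cQ = multilinear_maps_closed[OF Q(1)]
  have x1: "xs \<in> tuples E (Suc p + q)" "xs \<in> tuples E (Suc q + p)" using xs by (simp_all add: add.commute)
  have c: "ins E q P Q xs \<in> carrier E" "ins E p Q P xs \<in> carrier E"
    using cP cQ E.ins_closed[OF _ _ x1(1)] E.ins_closed[OF _ _ x1(2)] by auto
  have 1: "h (ins E q P Q xs) = ins F q P' Q' (map h xs)"
    by (rule ins_natural[where f = P and Q = Q and f' = P' and Q' = Q', OF assms(1-3) cP cQ P(3) Q(3) x1(1)])
  have 2: "h (ins E p Q P xs) = ins F p Q' P' (map h xs)"
    by (rule ins_natural[where f = Q and Q = P and f' = Q' and Q' = P', OF assms(1-3) cQ cP Q(3) P(3) x1(2)])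
  show ?thesis
    unfolding balavoine_eq[OF assms(1) P(1) Q(1) xs] balavoine_eq[OF assms(2) P(2) Q(2) xs'] E.M.minus_eq F.M.minus_eq
    using c 1 2 by (simp add: module_hom_add[OF assms(3)] module_hom_signed_apply[OF assms(3,1,2)])
qed

text \<open>Hom spaces are covariant in \<open>L\<close> and contravariant in \<open>V\<close>, so
  \<open>a\<close> and \<open>b\<close> together induce no map between them. Instead
  \<open>g\<close> and \<open>g'\<close> are merely related by the two maps. Taking \<open>a\<close>
  to be the identity gives the action of morphisms, and taking \<open>b\<close> to be the identity
  gives \<open>alpha\<close> and \<open>beta\<close>.\<close>

lemma derived_bracket_natural:
  assumes "leibniz_pair K L V" "leibniz_pair K L' V'"
    and a: "a \<in> module_hom K L L'" and b: "b \<in> module_hom K V V'"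
    and br: "\<And>x y. \<lbrakk>x \<in> carrier L; y \<in> carrier L\<rbrakk> \<Longrightarrow> a (bracket L x y) = bracket L' (a x) (a y)"
    and la: "\<And>x v. \<lbrakk>x \<in> carrier L; v \<in> carrier V\<rbrakk> \<Longrightarrow> b (lact V x v) = lact V' (a x) (b v)"
    and ra: "\<And>x v. \<lbrakk>x \<in> carrier L; v \<in> carrier V\<rbrakk> \<Longrightarrow> b (ract V x v) = ract V' (a x) (b v)"
    and g: "g \<in> multilinear_maps K V L (Suc p)" "g' \<in> multilinear_maps K V' L' (Suc p)"
      "\<And>vs. vs \<in> tuples V (Suc p) \<Longrightarrow> a (g vs) = g' (map b vs)"
    and h: "h \<in> multilinear_maps K V L (Suc q)" "h' \<in> multilinear_maps K V' L' (Suc q)"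
      "\<And>vs. vs \<in> tuples V (Suc q) \<Longrightarrow> a (h vs) = h' (map b vs)"
    and vs: "vs \<in> tuples V (Suc (Suc (p + q)))"
  shows "a (derived_bracket L V (Suc p) (Suc q) g h vs) = derived_bracket L' V' (Suc p) (Suc q) g' h' (map b vs)"
proof -
  interpret A: leibniz_pair K L V by fact
  interpret B: leibniz_pair K L' V' by fact
  \<comment> \<open>\<open>\<Phi>\<close> is a homomorphism of the semidirect products. The relation
    therefore holds for the two multiplications and for the extensions by zero, and it passes
    through both Balavoine brackets.\<close>
  define \<Phi> where "\<Phi> = (\<lambda>z. (a (fst z), b (snd z)))"
  have ac: "a x \<in> carrier L'" if "x \<in> carrier L" for x using module_hom_closed[OF a] that by auto
  have bc: "b v \<in> carrier V'" if "v \<in> carrier V" for v using module_hom_closed[OF b] that by auto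
  have a0: "a \<zero>\<^bsub>L\<^esub> = \<zero>\<^bsub>L'\<^esub>" by (rule module_hom_zero[OF a A.L.module_axioms B.L.module_axioms])
  have b0: "b \<zero>\<^bsub>V\<^esub> = \<zero>\<^bsub>V'\<^esub>" by (rule module_hom_zero[OF b A.V.module_axioms B.V.module_axioms])
  have \<Phi>: "\<Phi> \<in> module_hom K A.E B.E"
    using ac bc by (auto simp: module_hom_def \<Phi>_def module_hom_add[OF a] module_hom_add[OF b]
        module_hom_smult[OF a] module_hom_smult[OF b])
  have \<Phi>t: "map \<Phi> zs \<in> tuples B.E n" if "zs \<in> tuples A.E n" for zs n
    using module_hom_closed[OF \<Phi>] that by (intro tuples_map) auto
  have mu: "\<Phi> (A.mu zs) = B.mu (map \<Phi> zs)" if zs2: "zs \<in> tuples A.E (Suc 1)" for zs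
  proof -
    obtain x y where z: "zs = [x, y]" "x \<in> carrier A.E" "y \<in> carrier A.E"
    proof -
      obtain x ys where x: "zs = x # ys" "x \<in> carrier A.E" "ys \<in> tuples A.E 1"
        using zs2 by (rule tuples_Suc_cases)
      obtain y us where "ys = y # us" "y \<in> carrier A.E" "us \<in> tuples A.E 0"
        using x(3) unfolding One_nat_def by (rule tuples_Suc_cases)
      then show ?thesis using x that by simp
    qed
    then have c: "fst x \<in> carrier L" "snd x \<in> carrier V" "fst y \<in> carrier L" "snd y \<in> carrier V" by auto
    have z': "\<Phi> x \<in> carrier B.E" "\<Phi> y \<in> carrier B.E"
      using module_hom_closed[OF \<Phi>] z by auto
    have "\<Phi> (A.mult x y) = B.mult (\<Phi> x) (\<Phi> y)"
      using c by (simp add: \<Phi>_def A.mult_def B.mult_def br module_hom_add[OF b] la ra)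
    then show ?thesis
      using A.semidirect_mult_apply[OF z(2,3)] B.semidirect_mult_apply[OF z'] z(1) by simp
  qed
  have ext: "\<Phi> (A.ext n f zs) = B.ext n f' (map \<Phi> zs)"
    if "zs \<in> tuples A.E n" "\<And>vs. vs \<in> tuples V n \<Longrightarrow> a (f vs) = f' (map b vs)" for n f f' zs
  proof -
    have "map snd zs \<in> tuples V n" using that(1) by (intro tuples_map[of A.E]) auto
    then show ?thesis
      using that(2)[of "map snd zs"] that(1) \<Phi>t[OF that(1)] b0 by (simp add: extend_zero_def \<Phi>_def o_def)
  qed
  have extg: "\<Phi> (A.ext (Suc p) g zs) = B.ext (Suc p) g' (map \<Phi> zs)" if "zs \<in> tuples A.E (Suc p)" for zs
    by (rule ext[OF that]) (rule g(3))
  have exth: "\<Phi> (A.ext (Suc q) h zs) = B.ext (Suc q) h' (map \<Phi> zs)" if "zs \<in> tuples A.E (Suc q)" for zs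
    by (rule ext[OF that]) (rule h(3))
  have muA: "A.mu \<in> multilinear_maps K A.E A.E (Suc 1)" and muB: "B.mu \<in> multilinear_maps K B.E B.E (Suc 1)"
    using A.semidirect_mult_multilinear B.semidirect_mult_multilinear by (simp_all add: numeral_2_eq_2)
  note eg = A.ext_closed[OF g(1)] B.ext_closed[OF g(2)] and eh = A.ext_closed[OF h(1)] B.ext_closed[OF h(2)]
  have dA: "balavoine A.E 1 p A.mu (A.ext (Suc p) g) \<in> multilinear_maps K A.E A.E (Suc (Suc p))"
    using multilinear_balavoine[OF A.module_E muA eg(1)] by simp
  have dB: "balavoine B.E 1 p B.mu (B.ext (Suc p) g') \<in> multilinear_maps K B.E B.E (Suc (Suc p))"
    using multilinear_balavoine[OF B.module_E muB eg(2)] by simp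
  have d: "\<Phi> (balavoine A.E 1 p A.mu (A.ext (Suc p) g) zs) = balavoine B.E 1 p B.mu (B.ext (Suc p) g') (map \<Phi> zs)"
    if "zs \<in> tuples A.E (Suc (Suc p))" for zs
    by (rule balavoine_natural[OF A.module_E B.module_E \<Phi> muA muB mu eg extg]) (use that in simp_all)
  let ?zs = "map (\<lambda>v. (\<zero>\<^bsub>L\<^esub>, v)) vs"
  let ?BA = "balavoine A.E (Suc p) q (balavoine A.E 1 p A.mu (A.ext (Suc p) g)) (A.ext (Suc q) h)"
  let ?BB = "balavoine B.E (Suc p) q (balavoine B.E 1 p B.mu (B.ext (Suc p) g')) (B.ext (Suc q) h')"
  have zs: "?zs \<in> tuples A.E (Suc (Suc p + q))"
    using vs by (intro tuples_map[of V]) auto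
  have zs': "map \<Phi> ?zs = map (\<lambda>v. (\<zero>\<^bsub>L'\<^esub>, v)) (map b vs)"
    by (simp add: \<Phi>_def a0)
  have e: "\<Phi> (?BA ?zs) = ?BB (map \<Phi> ?zs)"
    by (rule balavoine_natural[OF A.module_E B.module_E \<Phi> dA dB d eh exth zs])
  have BA: "?BA ?zs \<in> carrier A.E" 
    using multilinear_maps_closed[OF multilinear_balavoine[OF A.module_E dA eh(1)] zs] .
  have BB: "?BB (map \<Phi> ?zs) \<in> carrier B.E"
    using multilinear_maps_closed[OF multilinear_balavoine[OF B.module_E dB eh(2)] \<Phi>t[OF zs]] .
  have f: "a (fst (?BA ?zs)) = fst (?BB (map \<Phi> ?zs))"
    using arg_cong[OF e, of fst] by (simp add: \<Phi>_def)
  have vs': "map b vs \<in> tuples V' (Suc (Suc (p + q)))"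
    using vs bc by (intro tuples_map) auto
  have fA: "fst (?BA ?zs) \<in> carrier L" and fB: "fst (?BB (map \<Phi> ?zs)) \<in> carrier L'"
    using BA BB by (auto simp: mem_Times_iff)
  have "derived_bracket L V (Suc p) (Suc q) g h vs = signed L p (fst (?BA ?zs))"
    using vs A.L.M.add_pow_signed[OF fA] by (simp add: derived_bracket_def)
  moreover have "derived_bracket L' V' (Suc p) (Suc q) g' h' (map b vs) = signed L' p (fst (?BB (map \<Phi> ?zs)))"
    unfolding zs' using vs' B.L.M.add_pow_signed[OF fB[unfolded zs']] by (simp add: derived_bracket_def)
  ultimately show ?thesis
    using module_hom_signed_apply(1)[OF a A.L.module_axioms B.L.module_axioms fA] f by simp
qed

section \<open>The Leibniz kernel and the canonical Lie algebra\<close>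

lemma module_hom_inv_into:
  assumes f: "f \<in> module_hom K M N" and bij: "bij_betw f (carrier M) (carrier N)"
    and "module K M" "module K N"
  shows "inv_into (carrier M) f \<in> module_hom K N M"
proof -
  interpret M: module K M by fact
  interpret N: module K N by fact
  let ?g = "inv_into (carrier M) f"
  have c: "?g y \<in> carrier M" and fg: "f (?g y) = y" if "y \<in> carrier N" for y
    using that bij by (auto simp: bij_betw_def intro: inv_into_into f_inv_into_f)
  have gf: "?g (f x) = x" if "x \<in> carrier M" for x
    using that bij by (auto simp: bij_betw_def)
  have "?g (y \<oplus>\<^bsub>N\<^esub> z) = ?g y \<oplus>\<^bsub>M\<^esub> ?g z" if "y \<in> carrier N" "z \<in> carrier N" for y z
    using gf[of "?g y \<oplus>\<^bsub>M\<^esub> ?g z"] module_hom_add[OF f c[OF that(1)] c[OF that(2)]] c fg that by simp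
  moreover have "?g (a \<odot>\<^bsub>N\<^esub> y) = a \<odot>\<^bsub>M\<^esub> ?g y" if "a \<in> carrier K" "y \<in> carrier N" for a y
    using gf[of "a \<odot>\<^bsub>M\<^esub> ?g y"] module_hom_smult[OF f that(1) c[OF that(2)]] c fg that by simp
  ultimately show ?thesis using c by (auto simp: module_hom_def)
qed

lemma module_hom_finsum:
  assumes h: "h \<in> module_hom K M N" and "module K M" "module K N" and "finite A" "\<And>i. i \<in> A \<Longrightarrow> g i \<in> carrier M"
  shows "h (\<Oplus>\<^bsub>M\<^esub>i\<in>A. g i) = (\<Oplus>\<^bsub>N\<^esub>i\<in>A. h (g i))"
proof -
  interpret M: module K M by fact
  interpret N: module K N by fact
  have c: "h x \<in> carrier N" if "x \<in> carrier M" for x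
    using module_hom_closed[OF h] that by auto
  show ?thesis using assms(4,5)
  proof (induction A)
    case empty
    then show ?case using module_hom_zero[OF h assms(2,3)] by simp
  next
    case (insert i A)
    then show ?case
      using c by (simp add: M.finsum_insert N.finsum_insert Pi_def module_hom_add[OF h] M.finsum_closed)
  qed
qed

text \<open>Preimages \<open>t\<close> of a finite basis \<open>C\<close> are chosen and extended
  linearly. The section first takes coordinates, inverting \<open>W.lincomb\<close>, and then forms
  the combination \<open>\<Lambda>\<close> of the preimages. The basis is finite because
  \<open>W\<close> is an image of \<open>V\<close>.\<close>

lemma linear_section:
  assumes "vectorspace K V" "vectorspace K W" "vectorspace.fin_dim K V"
    and T: "T \<in> module_hom K V W" and surj: "T ` carrier V = carrier W"
  obtains s where "s \<in> module_hom K W V" "\<And>w. w \<in> carrier W \<Longrightarrow> T (s w) = w"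
proof -
  interpret V: vectorspace K V by fact
  interpret W: vectorspace K W by fact
  interpret lm: linear_map K V W T
    by (simp add: linear_map_def assms(1,2) mod_hom_def mod_hom_axioms_def T V.module_axioms W.module_axioms)
  have "W.fin_dim" by (rule lm.surj_fin_dim[OF assms(3) surj])
  then obtain C where C: "finite C" "W.basis C" using W.finite_basis_exists by blast
  then have CW: "C \<subseteq> carrier W" by (simp add: W.basis_def)
  let ?F = "V.func_space C"
  have mF: "module K ?F" by (rule V.func_space_is_module)
  define t where "t = inv_into (carrier V) T"
  have t: "t c \<in> carrier V" "T (t c) = c" if "c \<in> C" for c
    unfolding t_def using that CW surj by (auto intro!: inv_into_into f_inv_into_f)
  define \<Lambda> where "\<Lambda> = (\<lambda>a. \<Oplus>\<^bsub>V\<^esub>c\<in>C. a c \<odot>\<^bsub>V\<^esub> t c)"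
  have F: "carrier ?F = C \<rightarrow>\<^sub>E carrier K" by (simp add: V.func_space_def)
  have \<Lambda>: "\<Lambda> \<in> module_hom K ?F V"
  proof -
    have "\<Lambda> (a \<oplus>\<^bsub>?F\<^esub> b) = \<Lambda> a \<oplus>\<^bsub>V\<^esub> \<Lambda> b" if "a \<in> carrier ?F" "b \<in> carrier ?F" for a b
    proof -
      have ab: "a c \<in> carrier K" "b c \<in> carrier K" if "c \<in> C" for c
        using that \<open>a \<in> carrier ?F\<close> \<open>b \<in> carrier ?F\<close> F by auto
      have "\<Lambda> (a \<oplus>\<^bsub>?F\<^esub> b) = (\<Oplus>\<^bsub>V\<^esub>c\<in>C. a c \<odot>\<^bsub>V\<^esub> t c \<oplus>\<^bsub>V\<^esub> b c \<odot>\<^bsub>V\<^esub> t c)"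
        unfolding \<Lambda>_def using ab t by (intro V.M.finsum_cong') (auto simp: V.func_space_def V.smult_l_distr)
      also have "\<dots> = \<Lambda> a \<oplus>\<^bsub>V\<^esub> \<Lambda> b"
        unfolding \<Lambda>_def using ab t by (intro V.M.finsum_addf) auto
      finally show ?thesis .
    qed
    moreover have "\<Lambda> (k \<odot>\<^bsub>?F\<^esub> a) = k \<odot>\<^bsub>V\<^esub> \<Lambda> a" if "k \<in> carrier K" "a \<in> carrier ?F" for k a
    proof -
      have a: "a c \<in> carrier K" if "c \<in> C" for c
        using that \<open>a \<in> carrier ?F\<close> F by auto
      have "\<Lambda> (k \<odot>\<^bsub>?F\<^esub> a) = (\<Oplus>\<^bsub>V\<^esub>c\<in>C. k \<odot>\<^bsub>V\<^esub> (a c \<odot>\<^bsub>V\<^esub> t c))"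
        unfolding \<Lambda>_def using a t that(1) by (intro V.M.finsum_cong') (auto simp: V.func_space_def V.smult_assoc1)
      also have "\<dots> = k \<odot>\<^bsub>V\<^esub> \<Lambda> a"
        unfolding \<Lambda>_def using a t that(1) C(1) by (intro V.finsum_smult_ldistr[symmetric]) auto
      finally show ?thesis .
    qed
    moreover have "\<Lambda> a \<in> carrier V" if "a \<in> carrier ?F" for a
      unfolding \<Lambda>_def using that t F by (intro V.M.finsum_closed) auto
    ultimately show ?thesis by (auto simp: module_hom_def)
  qed
  have T\<Lambda>: "T (\<Lambda> a) = W.lincomb a C" if "a \<in> carrier ?F" for a
  proof -
    have a: "a c \<in> carrier K" if "c \<in> C" for c
      using that \<open>a \<in> carrier ?F\<close> F by auto
    have "T (\<Lambda> a) = (\<Oplus>\<^bsub>W\<^esub>c\<in>C. T (a c \<odot>\<^bsub>V\<^esub> t c))"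
      unfolding \<Lambda>_def using a t C(1) by (intro module_hom_finsum[OF T V.module_axioms W.module_axioms]) auto
    also have "\<dots> = W.lincomb a C"
      unfolding W.lincomb_def using a t CW by (intro W.M.finsum_cong') (auto simp: module_hom_smult[OF T])
    finally show ?thesis .
  qed
  have lin: "(\<lambda>a. W.lincomb a C) \<in> module_hom K ?F W"
    using W.lincomb_is_mod_hom[OF C(1) CW] by (simp add: mod_hom_def mod_hom_axioms_def)
  have uniq: "\<exists>!a. a \<in> carrier ?F \<and> W.lincomb a C = w" if "w \<in> carrier W" for w
    using W.basis_criterion[OF C(1) CW] C(2) that by (simp add: F)
  have bij: "bij_betw (\<lambda>a. W.lincomb a C) (carrier ?F) (carrier W)"
    unfolding bij_betw_def
  proof
    show "inj_on (\<lambda>a. W.lincomb a C) (carrier ?F)"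
      using uniq module_hom_closed[OF lin] by (intro inj_onI) blast
    show "(\<lambda>a. W.lincomb a C) ` carrier ?F = carrier W"
      using uniq module_hom_closed[OF lin] by blast
  qed
  let ?g = "inv_into (carrier ?F) (\<lambda>a. W.lincomb a C)"
  have g: "?g \<in> module_hom K W ?F"
    by (rule module_hom_inv_into[OF lin bij mF W.module_axioms])
  show ?thesis
  proof (rule that)
    show "(\<lambda>w. \<Lambda> (?g w)) \<in> module_hom K W V" by (rule module_hom_compose[OF g \<Lambda>])
    show "T (\<Lambda> (?g w)) = w" if "w \<in> carrier W" for w
    proof -
      have "?g w \<in> carrier ?F" using module_hom_closed[OF g] that by auto
      moreover have "W.lincomb (?g w) C = w"
        using that bij by (auto simp: bij_betw_def intro: f_inv_into_f[where f = "\<lambda>a. W.lincomb a C"])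
      ultimately show ?thesis using T\<Lambda> by simp
    qed
  qed
qed

text \<open>Needed for \<open>restrict_rep V\<close> and \<open>project_rep V\<close>, whose module
  operations are those of \<open>V\<close> although the records, and for the projection also their
  types, are different.\<close>

lemma module_same_fields:
  assumes "module K M" "carrier N = carrier M" "zero N = zero M" "add N = add M" "smult N = smult M"
  shows "module K N"
proof -
  interpret module K M by fact
  show ?thesis
    by (rule module_criteria)
       (auto simp: assms(2-5) R.is_cring M.a_ac smult_assoc1 smult_l_distr smult_r_distr intro: M.r_neg bexI)
qed

lemma a_inv_same_fields:
  assumes "module K M" "carrier N = carrier M" "zero N = zero M" "add N = add M" "smult N = smult M" "x \<in> carrier M"
  shows "\<ominus>\<^bsub>N\<^esub> x = \<ominus>\<^bsub>M\<^esub> x"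
proof -
  interpret M: module K M by fact
  interpret N: module K N by (rule module_same_fields[OF assms(1-5)])
  show ?thesis by (rule N.M.minus_equality) (use assms in \<open>auto simp: M.M.l_neg\<close>)
qed

lemma no_two_torsion:
  assumes "vectorspace K M" "\<one>\<^bsub>K\<^esub> \<oplus>\<^bsub>K\<^esub> \<one>\<^bsub>K\<^esub> \<noteq> \<zero>\<^bsub>K\<^esub>" "x \<in> carrier M" "x \<oplus>\<^bsub>M\<^esub> x = \<zero>\<^bsub>M\<^esub>"
  shows "x = \<zero>\<^bsub>M\<^esub>"
proof -
  interpret vectorspace K M by fact
  let ?c = "\<one>\<^bsub>K\<^esub> \<oplus>\<^bsub>K\<^esub> \<one>\<^bsub>K\<^esub>"
  have c: "?c \<in> Units K" using assms(2) field_Units by auto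
  have "?c \<odot>\<^bsub>M\<^esub> x = \<zero>\<^bsub>M\<^esub>" using assms(3,4) by (simp add: smult_l_distr)
  then have "(inv\<^bsub>K\<^esub> ?c \<otimes>\<^bsub>K\<^esub> ?c) \<odot>\<^bsub>M\<^esub> x = \<zero>\<^bsub>M\<^esub>"
    using c assms(3) by (subst smult_assoc1) auto
  then show ?thesis using c assms(3) by simp
qed

lemma leibniz_pair_symmetricI:
  assumes "module K L" "module K V" and br: "bracket L \<in> bilinear_maps K L L L"
    and "\<And>x y z. \<lbrakk>x \<in> carrier L; y \<in> carrier L; z \<in> carrier L\<rbrakk> \<Longrightarrow>
      bracket L x (bracket L y z) = bracket L (bracket L x y) z \<oplus>\<^bsub>L\<^esub> bracket L y (bracket L x z)"
    and l: "lact V \<in> bilinear_maps K L V V"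
    and lb: "\<And>x y v. \<lbrakk>x \<in> carrier L; y \<in> carrier L; v \<in> carrier V\<rbrakk> \<Longrightarrow>
      lact V (bracket L x y) v = lact V x (lact V y v) \<ominus>\<^bsub>V\<^esub> lact V y (lact V x v)"
    and r: "\<And>x v. x \<in> carrier L \<Longrightarrow> v \<in> carrier V \<Longrightarrow> ract V x v = \<ominus>\<^bsub>V\<^esub> lact V x v"
    and "\<And>x. x \<in> carrier L \<Longrightarrow> x \<oplus>\<^bsub>L\<^esub> x = \<zero>\<^bsub>L\<^esub> \<Longrightarrow> x = \<zero>\<^bsub>L\<^esub>"
    and "\<And>v. v \<in> carrier V \<Longrightarrow> v \<oplus>\<^bsub>V\<^esub> v = \<zero>\<^bsub>V\<^esub> \<Longrightarrow> v = \<zero>\<^bsub>V\<^esub>"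
  shows "leibniz_pair K L V"
proof -
  interpret L: module K L by fact
  interpret V: module K V by fact
  have lc: "lact V x v \<in> carrier V" if "x \<in> carrier L" "v \<in> carrier V" for x v
    using bilinear_maps_closed[OF l that] .
  note lm = bilinear_maps_minus(1)[OF l assms(1,2,2)]
  note bc = bilinear_maps_closed[OF br]
  show ?thesis
  proof (intro leibniz_pair.intro leibniz_pair_axioms.intro)
    have "(\<lambda>v. \<ominus>\<^bsub>V\<^esub> lact V x v) \<in> module_hom K V V" if "x \<in> carrier L" for x
      using V.module_hom_signed[OF bilinear_mapsD(1)[OF l that], of 1] by (simp add: signed_def)
    then have 1: "ract V x \<in> module_hom K V V" if "x \<in> carrier L" for x
      using that r by (subst module_hom_cong[OF _ assms(2)]) auto
    have "(\<lambda>x. \<ominus>\<^bsub>V\<^esub> lact V x v) \<in> module_hom K L V" if "v \<in> carrier V" for v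
      using V.module_hom_signed[OF bilinear_mapsD(2)[OF l that], of 1] by (simp add: signed_def)
    then have 2: "(\<lambda>x. ract V x v) \<in> module_hom K L V" if "v \<in> carrier V" for v
      using that r by (subst module_hom_cong[OF _ assms(1)]) auto
    show "ract V \<in> bilinear_maps K L V V" using 1 2 by (simp add: bilinear_maps_def)
    show "ract V (bracket L x y) v = lact V x (ract V y v) \<ominus>\<^bsub>V\<^esub> ract V y (lact V x v)"
      if "x \<in> carrier L" "y \<in> carrier L" "v \<in> carrier V" for x y v
      using that lc bc by (simp add: r lm lb V.M.minus_eq V.M.minus_add)
    show "ract V y (lact V x v) = \<ominus>\<^bsub>V\<^esub> ract V y (ract V x v)"
      if "x \<in> carrier L" "y \<in> carrier L" "v \<in> carrier V" for x y v
      using that lc by (simp add: r lm)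
  qed (fact assms)+
qed

locale leibniz_alg = vectorspace K L
  for K :: "'k ring" and L :: "('k, 'g) leibniz" +
  assumes bracket_bilinear: "bracket L \<in> bilinear_maps K L L L"
    and leibniz: "\<lbrakk>x \<in> carrier L; y \<in> carrier L; z \<in> carrier L\<rbrakk> \<Longrightarrow>
      bracket L x (bracket L y z) = bracket L (bracket L x y) z \<oplus>\<^bsub>L\<^esub> bracket L y (bracket L x z)"
    and two: "\<one>\<^bsub>K\<^esub> \<oplus>\<^bsub>K\<^esub> \<one>\<^bsub>K\<^esub> \<noteq> \<zero>\<^bsub>K\<^esub>"
begin

abbreviation I :: "'g set" where "I \<equiv> leib_kernel K L"
abbreviation pr :: "'g \<Rightarrow> 'g set" where "pr \<equiv> lie_proj K L"
abbreviation Q :: "('k, 'g set) leibniz" where "Q \<equiv> canonical_lie K L"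
abbreviation sub :: "('k, 'g) leibniz" where "sub \<equiv> leib_sub K L"

lemmas bracket_closed [simp] = bilinear_maps_closed[OF bracket_bilinear]

lemmas bracket_add = bilinear_maps_add[OF bracket_bilinear]

lemmas bracket_smult = bilinear_maps_smult[OF bracket_bilinear]

lemmas bracket_zero [simp] = bilinear_maps_zero[OF bracket_bilinear module_axioms module_axioms module_axioms]

lemma squares_subset: "(\<lambda>x. bracket L x x) ` carrier L \<subseteq> carrier L"
  by auto

lemma kernel_submodule: "submodule K I L"
  unfolding leib_kernel_def by (rule span_is_submodule[OF squares_subset])

lemma kernel_subset: "I \<subseteq> carrier L" and kernel_zero [simp]: "\<zero>\<^bsub>L\<^esub> \<in> I"
  and kernel_add: "\<lbrakk>x \<in> I; y \<in> I\<rbrakk> \<Longrightarrow> x \<oplus>\<^bsub>L\<^esub> y \<in> I" and kernel_smult: "\<lbrakk>a \<in> carrier K; x \<in> I\<rbrakk> \<Longrightarrow> a \<odot>\<^bsub>L\<^esub> x \<in> I"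
  using kernel_submodule by (auto simp: submodule_def)

lemma kernel_carrier [simp]: "x \<in> I \<Longrightarrow> x \<in> carrier L"
  using kernel_subset by auto

lemma kernel_minus: "x \<in> I \<Longrightarrow> \<ominus>\<^bsub>L\<^esub> x \<in> I"
  using kernel_smult[of "\<ominus>\<^bsub>K\<^esub> \<one>\<^bsub>K\<^esub>" x] by (simp add: smult_l_minus)

lemma kernel_square: "x \<in> carrier L \<Longrightarrow> bracket L x x \<in> I"
  unfolding leib_kernel_def using in_own_span[OF squares_subset] by auto

text \<open>Serves as an induction principle for the kernel, with \<open>S\<close> the set of
  elements that have the desired property.\<close>

lemma kernel_induct_subset:
  assumes "submodule K S L" "\<And>x. x \<in> carrier L \<Longrightarrow> bracket L x x \<in> S"
  shows "I \<subseteq> S"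
  unfolding leib_kernel_def using assms by (intro span_is_subset) auto

text \<open>For a square this is the Leibniz identity with equal first arguments, [y, [y, x]] =
  [[y, y], x] + [y, [y, x]].\<close>

lemma kernel_bracket_left:
  assumes "s \<in> I" "x \<in> carrier L"
  shows "bracket L s x = \<zero>\<^bsub>L\<^esub>"
proof -
  let ?S = "{s \<in> carrier L. \<forall>x\<in>carrier L. bracket L s x = \<zero>\<^bsub>L\<^esub>}"
  have "submodule K ?S L"
    using module_axioms by (auto simp: submodule_def bracket_add bracket_smult)
  moreover have "bracket L y y \<in> ?S" if y: "y \<in> carrier L" for y
  proof -
    have "bracket L (bracket L y y) x = \<zero>\<^bsub>L\<^esub>" if x: "x \<in> carrier L" for x
    proof -
      let ?b = "bracket L y (bracket L y x)"
      have "\<zero>\<^bsub>L\<^esub> \<oplus>\<^bsub>L\<^esub> ?b = bracket L (bracket L y y) x \<oplus>\<^bsub>L\<^esub> ?b"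
        using leibniz[OF y y x] x y by simp
      then show ?thesis using x y by (subst (asm) M.add.right_cancel) auto
    qed
    then show ?thesis using y by simp
  qed
  ultimately show ?thesis using kernel_induct_subset[of ?S] assms by auto
qed

lemma kernel_bracket_right:
  assumes "s \<in> I" "x \<in> carrier L"
  shows "bracket L x s \<in> I"
proof -
  let ?S = "{s \<in> carrier L. \<forall>x\<in>carrier L. bracket L x s \<in> I}"
  have "submodule K ?S L"
    using module_axioms by (auto simp: submodule_def bracket_add bracket_smult kernel_add kernel_smult)
  moreover have "bracket L y y \<in> ?S" if y: "y \<in> carrier L" for y
  proof -
    have "bracket L x (bracket L y y) \<in> I" if x: "x \<in> carrier L" for x
    proof -
      \<comment> \<open>With \<open>a = [x, y]\<close>: \<open>[x, [y, y]] = [a, y] + [y, a] = [a + y, a + y] - [a, a] - [y, y]\<close>.\<close>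
      let ?a = "bracket L x y"
      have a: "?a \<in> carrier L" using x y by simp
      have "bracket L (?a \<oplus>\<^bsub>L\<^esub> y) (?a \<oplus>\<^bsub>L\<^esub> y) \<in> I" "\<ominus>\<^bsub>L\<^esub> bracket L ?a ?a \<in> I" "\<ominus>\<^bsub>L\<^esub> bracket L y y \<in> I"
        using a y by (auto intro: kernel_square kernel_minus)
      then have "bracket L (?a \<oplus>\<^bsub>L\<^esub> y) (?a \<oplus>\<^bsub>L\<^esub> y) \<oplus>\<^bsub>L\<^esub> (\<ominus>\<^bsub>L\<^esub> bracket L ?a ?a \<oplus>\<^bsub>L\<^esub> \<ominus>\<^bsub>L\<^esub> bracket L y y) \<in> I"
        by (intro kernel_add)
      moreover have "(p \<oplus>\<^bsub>L\<^esub> q) \<oplus>\<^bsub>L\<^esub> (r \<oplus>\<^bsub>L\<^esub> s) \<oplus>\<^bsub>L\<^esub> (\<ominus>\<^bsub>L\<^esub> p \<oplus>\<^bsub>L\<^esub> \<ominus>\<^bsub>L\<^esub> s) = r \<oplus>\<^bsub>L\<^esub> q"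
        if "p \<in> carrier L" "q \<in> carrier L" "r \<in> carrier L" "s \<in> carrier L" for p q r s
        using that by algebra
      ultimately have "bracket L ?a y \<oplus>\<^bsub>L\<^esub> bracket L y ?a \<in> I"
        using a y by (simp add: bracket_add)
      then show ?thesis using leibniz[OF x y y] by simp
    qed
    then show ?thesis using y by simp
  qed
  ultimately show ?thesis using kernel_induct_subset[of ?S] assms by auto
qed

lemma kernel_module: "module K sub"
  unfolding leib_sub_def by (rule submodule_is_module[OF kernel_submodule])

lemma sub_simps [simp]:
  "carrier sub = I" "zero sub = zero L" "add sub = add L" "smult sub = smult L" "bracket sub = bracket L"
  by (simp_all add: leib_sub_def)

lemma sub_bracket_bilinear: "bracket sub \<in> bilinear_maps K sub sub sub"
  by (auto simp: bilinear_maps_def module_hom_def bracket_add bracket_smult kernel_bracket_right)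

lemma mem_pr: "y \<in> pr x \<longleftrightarrow> (\<exists>i\<in>I. y = i \<oplus>\<^bsub>L\<^esub> x)"
  by (auto simp: lie_proj_def a_r_coset_def')

lemma pr_self: "x \<in> carrier L \<Longrightarrow> x \<in> pr x"
  by (auto simp: mem_pr intro!: bexI[of _ "\<zero>\<^bsub>L\<^esub>"])

lemma pr_shift:
  assumes "i \<in> I" "x \<in> carrier L"
  shows "pr (i \<oplus>\<^bsub>L\<^esub> x) = pr x"
proof (intro equalityI subsetI)
  fix y assume "y \<in> pr (i \<oplus>\<^bsub>L\<^esub> x)"
  then obtain j where j: "j \<in> I" "y = j \<oplus>\<^bsub>L\<^esub> (i \<oplus>\<^bsub>L\<^esub> x)" by (auto simp: mem_pr)
  then have "y = (j \<oplus>\<^bsub>L\<^esub> i) \<oplus>\<^bsub>L\<^esub> x" using assms by (simp add: M.a_assoc)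
  then show "y \<in> pr x" using kernel_add[OF j(1) assms(1)] by (auto simp: mem_pr)
next
  fix y assume "y \<in> pr x"
  then obtain j where j: "j \<in> I" "y = j \<oplus>\<^bsub>L\<^esub> x" by (auto simp: mem_pr)
  have "y = (j \<oplus>\<^bsub>L\<^esub> \<ominus>\<^bsub>L\<^esub> i) \<oplus>\<^bsub>L\<^esub> (i \<oplus>\<^bsub>L\<^esub> x)"
    using j assms by (simp add: M.a_assoc M.r_neg1)
  then show "y \<in> pr (i \<oplus>\<^bsub>L\<^esub> x)" using kernel_add[OF j(1) kernel_minus[OF assms(1)]] by (auto simp: mem_pr)
qed

lemma pr_eq_kernel_iff: "x \<in> carrier L \<Longrightarrow> pr x = I \<longleftrightarrow> x \<in> I"
proof
  assume "x \<in> carrier L" "pr x = I"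
  then show "x \<in> I" using pr_self by auto
next
  assume "x \<in> carrier L" "x \<in> I"
  then have "pr x = pr \<zero>\<^bsub>L\<^esub>" using pr_shift[of x "\<zero>\<^bsub>L\<^esub>"] by simp
  also have "\<dots> = I" by (auto simp: mem_pr)
  finally show "pr x = I" .
qed

text \<open>The operations of \<open>quotient_leibniz\<close> are unions over representatives. Such
  a union collapses to a single value as soon as that value does not depend on the
  representative.\<close>

lemma UN_pr:
  assumes "x \<in> carrier L" "\<And>i. i \<in> I \<Longrightarrow> f (i \<oplus>\<^bsub>L\<^esub> x) = f x"
  shows "(\<Union>y\<in>pr x. f y) = f x"
  using assms pr_self[OF assms(1)] by (fastforce simp: mem_pr)

lemma Q_carrier: "carrier Q = pr ` carrier L"
  by (auto simp: canonical_lie_def quotient_leibniz_def A_RCOSETS_def' lie_proj_def)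

lemma Q_zero: "\<zero>\<^bsub>Q\<^esub> = pr \<zero>\<^bsub>L\<^esub>"
  using pr_eq_kernel_iff[of "\<zero>\<^bsub>L\<^esub>"] by (simp add: canonical_lie_def quotient_leibniz_def)

lemma Q_add:
  assumes "x \<in> carrier L" "y \<in> carrier L"
  shows "pr x \<oplus>\<^bsub>Q\<^esub> pr y = pr (x \<oplus>\<^bsub>L\<^esub> y)"
proof -
  have "pr x \<oplus>\<^bsub>Q\<^esub> pr y = (\<Union>a\<in>pr x. \<Union>b\<in>pr y. {a \<oplus>\<^bsub>L\<^esub> b})"
    by (simp add: canonical_lie_def quotient_leibniz_def set_add_def')
  also have "\<dots> = pr (x \<oplus>\<^bsub>L\<^esub> y)"
  proof (intro equalityI subsetI)
    fix z assume "z \<in> (\<Union>a\<in>pr x. \<Union>b\<in>pr y. {a \<oplus>\<^bsub>L\<^esub> b})"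
    then obtain i j where ij: "i \<in> I" "j \<in> I" "z = (i \<oplus>\<^bsub>L\<^esub> x) \<oplus>\<^bsub>L\<^esub> (j \<oplus>\<^bsub>L\<^esub> y)" by (auto simp: mem_pr)
    then have "z = (i \<oplus>\<^bsub>L\<^esub> j) \<oplus>\<^bsub>L\<^esub> (x \<oplus>\<^bsub>L\<^esub> y)" using assms by (simp add: M.a_ac)
    then show "z \<in> pr (x \<oplus>\<^bsub>L\<^esub> y)" using kernel_add[OF ij(1,2)] by (auto simp: mem_pr)
  next
    fix z assume "z \<in> pr (x \<oplus>\<^bsub>L\<^esub> y)"
    then obtain i where i: "i \<in> I" "z = i \<oplus>\<^bsub>L\<^esub> (x \<oplus>\<^bsub>L\<^esub> y)" by (auto simp: mem_pr)
    then have "z = (i \<oplus>\<^bsub>L\<^esub> x) \<oplus>\<^bsub>L\<^esub> y" using assms by (simp add: M.a_assoc)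
    moreover have "i \<oplus>\<^bsub>L\<^esub> x \<in> pr x" using i by (auto simp: mem_pr)
    ultimately show "z \<in> (\<Union>a\<in>pr x. \<Union>b\<in>pr y. {a \<oplus>\<^bsub>L\<^esub> b})" using pr_self[OF assms(2)] by blast
  qed
  finally show ?thesis .
qed

lemma Q_smult:
  assumes "a \<in> carrier K" "x \<in> carrier L"
  shows "a \<odot>\<^bsub>Q\<^esub> pr x = pr (a \<odot>\<^bsub>L\<^esub> x)"
proof -
  have "a \<odot>\<^bsub>Q\<^esub> pr x = (\<Union>y\<in>pr x. pr (a \<odot>\<^bsub>L\<^esub> y))"
    by (simp add: canonical_lie_def quotient_leibniz_def lie_proj_def)
  also have "\<dots> = pr (a \<odot>\<^bsub>L\<^esub> x)"
    using assms by (intro UN_pr) (auto simp: smult_r_distr pr_shift kernel_smult)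
  finally show ?thesis .
qed

text \<open>The two arguments behave differently: another representative on the right changes the
  bracket by an element of the kernel, while on the left it changes nothing.\<close>

lemma Q_bracket:
  assumes "x \<in> carrier L" "y \<in> carrier L"
  shows "bracket Q (pr x) (pr y) = pr (bracket L x y)"
proof -
  have "bracket Q (pr x) (pr y) = (\<Union>a\<in>pr x. \<Union>b\<in>pr y. pr (bracket L a b))"
    by (simp add: canonical_lie_def quotient_leibniz_def lie_proj_def)
  also have "\<dots> = (\<Union>a\<in>pr x. pr (bracket L a y))"
  proof (rule SUP_cong[OF refl])
    fix a assume "a \<in> pr x"
    then have "a \<in> carrier L" using assms by (auto simp: mem_pr)
    then show "(\<Union>b\<in>pr y. pr (bracket L a b)) = pr (bracket L a y)"
      using assms by (intro UN_pr) (auto simp: bracket_add pr_shift kernel_bracket_right)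
  qed
  also have "\<dots> = pr (bracket L x y)"
    using assms by (intro UN_pr) (auto simp: bracket_add kernel_bracket_left)
  finally show ?thesis .
qed

lemma Q_cases:
  assumes "c \<in> carrier Q"
  obtains x where "c = pr x" "x \<in> carrier L"
  using assms Q_carrier by auto

lemma pr_closed [simp]: "x \<in> carrier L \<Longrightarrow> pr x \<in> carrier Q"
  by (simp add: Q_carrier)

lemma Q_module: "module K Q"
proof (rule module_criteria)
  show "\<forall>v\<in>carrier Q. \<exists>u\<in>carrier Q. v \<oplus>\<^bsub>Q\<^esub> u = \<zero>\<^bsub>Q\<^esub>"
  proof
    fix v assume "v \<in> carrier Q"
    then obtain x where "v = pr x" "x \<in> carrier L" by (rule Q_cases)
    then show "\<exists>u\<in>carrier Q. v \<oplus>\<^bsub>Q\<^esub> u = \<zero>\<^bsub>Q\<^esub>"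
      by (intro bexI[of _ "pr (\<ominus>\<^bsub>L\<^esub> x)"]) (auto simp: Q_add Q_zero M.r_neg)
  qed
qed (auto simp: R.is_cring Q_zero Q_add Q_smult M.a_ac smult_assoc1 smult_l_distr smult_r_distr elim!: Q_cases)

lemma Q_vectorspace: "vectorspace K Q"
  using Q_module field_axioms by (simp add: vectorspace_def)

lemma pr_hom: "pr \<in> module_hom K L Q"
  by (auto simp: module_hom_def Q_add Q_smult)

lemma Q_bracket_bilinear: "bracket Q \<in> bilinear_maps K Q Q Q"
  by (auto simp: bilinear_maps_def module_hom_def Q_add Q_smult Q_bracket bracket_add bracket_smult elim!: Q_cases)

lemma Q_leibniz:
  assumes "x \<in> carrier Q" "y \<in> carrier Q" "z \<in> carrier Q"
  shows "bracket Q x (bracket Q y z) = bracket Q (bracket Q x y) z \<oplus>\<^bsub>Q\<^esub> bracket Q y (bracket Q x z)"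
proof -
  obtain a b c where "x = pr a" "y = pr b" "z = pr c" "a \<in> carrier L" "b \<in> carrier L" "c \<in> carrier L"
    using assms by (auto elim!: Q_cases)
  then show ?thesis using leibniz[of a b c] by (simp add: Q_bracket Q_add)
qed

end

section \<open>The natural transformations\<close>

text \<open>All three functors send \<open>V\<close> to the controlling algebra of a fixed
  \<open>L'\<close> on \<open>T V\<close>, where \<open>T\<close> is the identity,
  \<open>restrict_rep\<close> or \<open>project_rep\<close> and does not alter morphisms.\<close>

lemma contravariant_functor_controlling:
  fixes K :: "'k ring" and L :: "('k, 'g) leibniz" and L' :: "('k, 'h) leibniz"
    and T :: "('k, 'g, 'v) repn \<Rightarrow> ('k, 'h, 'v) repn"
  assumes "field K"
    and pair: "\<And>V. symmetric_rep K L V \<Longrightarrow> leibniz_pair K L' (T V)"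
    and car: "\<And>V. carrier (T V) = carrier V"
    and hom: "\<And>V W \<phi>. \<lbrakk>symmetric_rep K L V; symmetric_rep K L W; \<phi> \<in> rep_hom K L W V\<rbrakk> \<Longrightarrow> \<phi> \<in> rep_hom K L' (T W) (T V)"
  shows "contravariant_functor K L (\<lambda>V. controlling_algebra K L' (T V)) (\<lambda>W V \<phi>. controlling_map (T W) \<phi>)"
proof -
  have tup: "tuples (T V) n = tuples V n" for V n by (simp add: tuples_def car)
  have map_tup: "map \<phi> ws \<in> tuples V n" if "\<phi> \<in> rep_hom K L W V" "ws \<in> tuples W n" for \<phi> and V W :: "('k, 'g, 'v) repn" and ws n
    using that by (intro tuples_map[of W]) (auto simp: rep_hom_def module_hom_def)
  have "controlling_map (T W) \<phi> \<in> graded_lie_hom K (controlling_algebra K L' (T V)) (controlling_algebra K L' (T W))"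
    if V: "symmetric_rep K L V" and W: "symmetric_rep K L W" and \<phi>: "\<phi> \<in> rep_hom K L W V" for V W \<phi>
  proof -
    note pV = pair[OF V] and pW = pair[OF W] and h = hom[OF V W \<phi>]
    interpret V: leibniz_pair K L' "T V" by (rule pV)
    interpret W: leibniz_pair K L' "T W" by (rule pW)
    have \<phi>': "\<phi> \<in> module_hom K (T W) (T V)" using h by (simp add: rep_hom_def)
    have id: "(\<lambda>x. x) \<in> module_hom K L' L'" by (simp add: module_hom_def)
    have m: "controlling_map (T W) \<phi> n \<in> module_hom K (hom_space K (T V) L' n) (hom_space K (T W) L' n)" for n
      using module_hom_transport[OF \<phi>' id V.V.module_axioms W.V.module_axioms V.L.module_axioms V.L.module_axioms, of n]
      by (simp add: controlling_map_def[abs_def])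
    have mc: "controlling_map (T W) \<phi> n x \<in> multilinear_maps K (T W) L' n" if "x \<in> multilinear_maps K (T V) L' n" for n x
      using module_hom_closed[OF m] that by auto
    have "controlling_map (T W) \<phi> (Suc p + Suc q) (derived_bracket L' (T V) (Suc p) (Suc q) x y) =
        derived_bracket L' (T W) (Suc p) (Suc q) (controlling_map (T W) \<phi> (Suc p) x) (controlling_map (T W) \<phi> (Suc q) y)"
      if x: "x \<in> multilinear_maps K (T V) L' (Suc p)" and y: "y \<in> multilinear_maps K (T V) L' (Suc q)" for p q x y
    proof (rule multilinear_maps_ext)
      show "controlling_map (T W) \<phi> (Suc p + Suc q) (derived_bracket L' (T V) (Suc p) (Suc q) x y)
          \<in> multilinear_maps K (T W) L' (Suc p + Suc q)"
        using V.derived_bracket_closed[OF x y] by (intro mc) simp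
      show "derived_bracket L' (T W) (Suc p) (Suc q) (controlling_map (T W) \<phi> (Suc p) x) (controlling_map (T W) \<phi> (Suc q) y)
          \<in> multilinear_maps K (T W) L' (Suc p + Suc q)"
        using W.derived_bracket_closed[OF mc[OF x] mc[OF y]] by simp
      fix ws assume ws: "ws \<in> tuples (T W) (Suc p + Suc q)"
      \<comment> \<open>Naturality is applied from \<open>W\<close> to \<open>V\<close> with the
        identity on \<open>L'\<close>: the pulled-back maps are the ones on the source side.\<close>
      have "derived_bracket L' (T W) (Suc p) (Suc q) (controlling_map (T W) \<phi> (Suc p) x) (controlling_map (T W) \<phi> (Suc q) y) ws =
          derived_bracket L' (T V) (Suc p) (Suc q) x y (map \<phi> ws)"
        by (rule derived_bracket_natural[OF pW pV id \<phi>'])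
           (use h mc[OF x] mc[OF y] x y ws in \<open>auto simp: rep_hom_def controlling_map_def\<close>)
      then show "controlling_map (T W) \<phi> (Suc p + Suc q) (derived_bracket L' (T V) (Suc p) (Suc q) x y) ws =
          derived_bracket L' (T W) (Suc p) (Suc q) (controlling_map (T W) \<phi> (Suc p) x) (controlling_map (T W) \<phi> (Suc q) y) ws"
        using ws by (simp add: controlling_map_def)
    qed
    then have "controlling_map (T W) \<phi> (m + n) (derived_bracket L' (T V) m n x y) =
        derived_bracket L' (T W) m n (controlling_map (T W) \<phi> m x) (controlling_map (T W) \<phi> n y)"
      if "m \<ge> 1" "n \<ge> 1" "x \<in> multilinear_maps K (T V) L' m" "y \<in> multilinear_maps K (T V) L' n" for m n x y
      using ge_1_Suc[OF that(1)] ge_1_Suc[OF that(2)] that(3,4) by blast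
    then show ?thesis using m by (simp add: graded_lie_hom_def)
  qed
  moreover have "controlling_map (T V) (\<lambda>v\<in>carrier V. v) n f = f"
    if V: "symmetric_rep K L V" and f: "f \<in> multilinear_maps K (T V) L' n" for V n f
  proof -
    have "map (\<lambda>v\<in>carrier V. v) vs = vs" if "vs \<in> tuples V n" for vs
      using that by (intro map_idI) (auto simp: tuples_def)
    then show ?thesis
      unfolding controlling_map_def using f by (intro restrict_eqI) (auto simp: tup multilinear_maps_iff)
  qed
  moreover have "controlling_map (T U) (compose (carrier U) \<phi> \<psi>) n f =
      controlling_map (T U) \<psi> n (controlling_map (T W) \<phi> n f)"
    if "\<psi> \<in> rep_hom K L U W" for U V W :: "('k, 'g, 'v) repn" and \<phi> \<psi> n f
  proof -
    have "map (compose (carrier U) \<phi> \<psi>) us = map \<phi> (map \<psi> us)" if "us \<in> tuples U n" for us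
      using that by (auto simp: tuples_def compose_def)
    then have "f (map (compose (carrier U) \<phi> \<psi>) us) = (\<lambda>ws\<in>tuples W n. f (map \<phi> ws)) (map \<psi> us)"
      if "us \<in> tuples U n" for us
      using map_tup[OF \<open>\<psi> \<in> rep_hom K L U W\<close> that] that by (simp del: map_map)
    then show ?thesis
      unfolding controlling_map_def tup by (intro restrict_ext)
  qed
  moreover have "graded_lie_algebra K (controlling_algebra K L' (T V))" if "symmetric_rep K L V" for V
    by (rule leibniz_pair.graded_lie_algebra_controlling[OF pair[OF that] assms(1)])
  ultimately show ?thesis
    unfolding contravariant_functor_def controlling_algebra_simps hom_space_simps(1) by blast
qed

text \<open>\<open>V'\<close> is only required to have the same carrier, addition and scaling as
  \<open>V\<close>, because restriction and projection produce a different record on the same vector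
  space.\<close>

lemma graded_lie_hom_postcompose:
  assumes "leibniz_pair K L V" "leibniz_pair K L' V'" and h: "h \<in> module_hom K L L'"
    and car: "carrier V' = carrier V" and add: "add V' = add V" and smult: "smult V' = smult V"
    and br: "\<And>x y. \<lbrakk>x \<in> carrier L; y \<in> carrier L\<rbrakk> \<Longrightarrow> h (bracket L x y) = bracket L' (h x) (h y)"
    and la: "\<And>x v. \<lbrakk>x \<in> carrier L; v \<in> carrier V\<rbrakk> \<Longrightarrow> lact V x v = lact V' (h x) v"
    and ra: "\<And>x v. \<lbrakk>x \<in> carrier L; v \<in> carrier V\<rbrakk> \<Longrightarrow> ract V x v = ract V' (h x) v"
  shows "(\<lambda>n f. \<lambda>vs\<in>tuples V n. h (f vs)) \<in> graded_lie_hom K (controlling_algebra K L V) (controlling_algebra K L' V')"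
    (is "?F \<in> _")
proof -
  interpret A: leibniz_pair K L V by fact
  interpret B: leibniz_pair K L' V' by fact
  have tup: "tuples V' n = tuples V n" for n by (simp add: tuples_def car)
  have id: "(\<lambda>v. v) \<in> module_hom K V V'" "(\<lambda>v. v) \<in> module_hom K V' V"
    by (auto simp: module_hom_def car add smult)
  have m: "?F n \<in> module_hom K (hom_space K V L n) (hom_space K V' L' n)" for n
    using module_hom_transport[OF id(2) h A.V.module_axioms B.V.module_axioms A.L.module_axioms B.L.module_axioms, of n]
    by (simp add: tup)
  have mc: "?F n x \<in> multilinear_maps K V' L' n" if "x \<in> multilinear_maps K V L n" for n x
    using module_hom_closed[OF m] that by auto
  have "?F (Suc p + Suc q) (derived_bracket L V (Suc p) (Suc q) x y) =
      derived_bracket L' V' (Suc p) (Suc q) (?F (Suc p) x) (?F (Suc q) y)"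
    if x: "x \<in> multilinear_maps K V L (Suc p)" and y: "y \<in> multilinear_maps K V L (Suc q)" for p q x y
  proof (rule multilinear_maps_ext)
    show "?F (Suc p + Suc q) (derived_bracket L V (Suc p) (Suc q) x y) \<in> multilinear_maps K V' L' (Suc p + Suc q)"
      using A.derived_bracket_closed[OF x y] by (intro mc) simp
    show "derived_bracket L' V' (Suc p) (Suc q) (?F (Suc p) x) (?F (Suc q) y) \<in> multilinear_maps K V' L' (Suc p + Suc q)"
      using B.derived_bracket_closed[OF mc[OF x] mc[OF y]] by simp
    fix vs assume vs: "vs \<in> tuples V' (Suc p + Suc q)"
    have "h (derived_bracket L V (Suc p) (Suc q) x y vs) =
        derived_bracket L' V' (Suc p) (Suc q) (?F (Suc p) x) (?F (Suc q) y) (map (\<lambda>v. v) vs)"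
      by (rule derived_bracket_natural[OF assms(1,2) h id(1)])
         (use br la ra mc[OF x] mc[OF y] x y vs in \<open>auto simp: tup\<close>)
    then show "?F (Suc p + Suc q) (derived_bracket L V (Suc p) (Suc q) x y) vs =
        derived_bracket L' V' (Suc p) (Suc q) (?F (Suc p) x) (?F (Suc q) y) vs"
      using vs by (simp add: tup)
  qed
  then have "?F (m + n) (derived_bracket L V m n x y) = derived_bracket L' V' m n (?F m x) (?F n y)"
    if "m \<ge> 1" "n \<ge> 1" "x \<in> multilinear_maps K V L m" "y \<in> multilinear_maps K V L n" for m n x y
    using ge_1_Suc[OF that(1)] ge_1_Suc[OF that(2)] that(3,4) by blast
  then show ?thesis using m by (simp add: graded_lie_hom_def)
qed

section \<open>The functors, \<open>alpha\<close> and \<open>beta\<close> on symmetric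
  representations\<close>

lemma restrict_rep_simps [simp]:
  "carrier (restrict_rep V) = carrier V" "zero (restrict_rep V) = zero V" "add (restrict_rep V) = add V"
  "smult (restrict_rep V) = smult V" "lact (restrict_rep V) = lact V" "ract (restrict_rep V) x v = \<ominus>\<^bsub>V\<^esub> lact V x v"
  by (simp_all add: restrict_rep_def leib_incl_def)

lemma project_rep_simps [simp]:
  "carrier (project_rep V) = carrier V" "zero (project_rep V) = zero V" "add (project_rep V) = add V"
  "smult (project_rep V) = smult V" "lact (project_rep V) = lie_act V" "ract (project_rep V) C v = \<ominus>\<^bsub>V\<^esub> lie_act V C v"
  by (simp_all add: project_rep_def)

lemma symmetric_repD:
  assumes "symmetric_rep K L V"
  shows "vectorspace K V" "lact V \<in> bilinear_maps K L V V" "ract V \<in> bilinear_maps K L V V"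
    and "\<lbrakk>x \<in> carrier L; y \<in> carrier L; v \<in> carrier V\<rbrakk> \<Longrightarrow>
      lact V (bracket L x y) v = lact V x (lact V y v) \<ominus>\<^bsub>V\<^esub> lact V y (lact V x v)"
    and "\<lbrakk>x \<in> carrier L; v \<in> carrier V\<rbrakk> \<Longrightarrow> ract V x v = \<ominus>\<^bsub>V\<^esub> lact V x v"
  using assms by (simp_all add: symmetric_rep_def leibniz_rep_def)

context leibniz_alg
begin

lemma pair:
  assumes "symmetric_rep K L V"
  shows "leibniz_pair K L V"
proof -
  note V = symmetric_repD[OF assms]
  have m: "module K V" using V(1) by (simp add: vectorspace_def)
  show ?thesis
    by (rule leibniz_pair_symmetricI[OF module_axioms m bracket_bilinear leibniz V(2,4,5)
          no_two_torsion[OF vectorspace_axioms two] no_two_torsion[OF V(1) two]])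
qed

lemma a_minus_same: "module K (V :: ('k, 'a, 'v) repn) \<Longrightarrow> v \<in> carrier V \<Longrightarrow>
    \<ominus>\<^bsub>restrict_rep V\<^esub> v = \<ominus>\<^bsub>V\<^esub> v" "module K V \<Longrightarrow> v \<in> carrier V \<Longrightarrow> \<ominus>\<^bsub>project_rep V\<^esub> v = \<ominus>\<^bsub>V\<^esub> v"
  by (rule a_inv_same_fields; simp)+

lemma restrict_pair:
  assumes "symmetric_rep K L V"
  shows "leibniz_pair K sub (restrict_rep V)"
proof -
  note V = symmetric_repD[OF assms]
  have m: "module K V" using V(1) by (simp add: vectorspace_def)
  interpret V: module K V by (rule m)
  note lc = bilinear_maps_closed[OF V(2)]
  show ?thesis
  proof (rule leibniz_pair_symmetricI)
    show "module K sub" by (rule kernel_module)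
    show "module K (restrict_rep V)" by (rule module_same_fields[OF m]) simp_all
    show "bracket sub \<in> bilinear_maps K sub sub sub" by (rule sub_bracket_bilinear)
    show "bracket sub x (bracket sub y z) = bracket sub (bracket sub x y) z \<oplus>\<^bsub>sub\<^esub> bracket sub y (bracket sub x z)"
      if "x \<in> carrier sub" "y \<in> carrier sub" "z \<in> carrier sub" for x y z
      using leibniz[of x y z] that by simp
    show "lact (restrict_rep V) \<in> bilinear_maps K sub (restrict_rep V) (restrict_rep V)"
      using bilinear_maps_add[OF V(2)] bilinear_maps_smult[OF V(2)] lc
      by (auto simp: bilinear_maps_def module_hom_def)
    show "lact (restrict_rep V) (bracket sub x y) v =
        lact (restrict_rep V) x (lact (restrict_rep V) y v) \<ominus>\<^bsub>restrict_rep V\<^esub> lact (restrict_rep V) y (lact (restrict_rep V) x v)"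
      if "x \<in> carrier sub" "y \<in> carrier sub" "v \<in> carrier (restrict_rep V)" for x y v
      using V(4)[of x y v] that lc by (simp add: a_minus_def a_minus_same[OF m])
    show "ract (restrict_rep V) x v = \<ominus>\<^bsub>restrict_rep V\<^esub> lact (restrict_rep V) x v"
      if "x \<in> carrier sub" "v \<in> carrier (restrict_rep V)" for x v
      using that lc by (simp add: a_minus_same[OF m])
    show "x = \<zero>\<^bsub>sub\<^esub>" if "x \<in> carrier sub" "x \<oplus>\<^bsub>sub\<^esub> x = \<zero>\<^bsub>sub\<^esub>" for x
      using no_two_torsion[OF vectorspace_axioms two, of x] that by simp
    show "v = \<zero>\<^bsub>restrict_rep V\<^esub>" if "v \<in> carrier (restrict_rep V)" "v \<oplus>\<^bsub>restrict_rep V\<^esub> v = \<zero>\<^bsub>restrict_rep V\<^esub>" for v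
      using no_two_torsion[OF V(1) two, of v] that by simp
  qed
qed

text \<open>A square acts as the commutator of an operator with itself.\<close>

lemma lact_kernel:
  assumes "symmetric_rep K L V" "s \<in> I" "v \<in> carrier V"
  shows "lact V s v = \<zero>\<^bsub>V\<^esub>"
proof -
  note V = symmetric_repD[OF assms(1)]
  have m: "module K V" using V(1) by (simp add: vectorspace_def)
  interpret V: module K V by (rule m)
  let ?S = "{s \<in> carrier L. lact V s v = \<zero>\<^bsub>V\<^esub>}"
  note lc = bilinear_maps_closed[OF V(2)]
  have "submodule K ?S L"
    using module_axioms assms(3) bilinear_maps_zero(2)[OF V(2) module_axioms m m]
    by (auto simp: submodule_def bilinear_maps_add[OF V(2)] bilinear_maps_smult[OF V(2)])
  moreover have "bracket L x x \<in> ?S" if "x \<in> carrier L" for x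
    using that assms(3) lc by (simp add: V(4) V.M.minus_eq V.M.r_neg)
  ultimately show ?thesis using kernel_induct_subset[of ?S] assms(2) by auto
qed

text \<open>The kernel acts by zero, so all elements of a coset act alike and the image under
  \<open>the_elem\<close> is a singleton.\<close>

lemma lie_act_pr:
  assumes V: "symmetric_rep K L V" and x: "x \<in> carrier L" and v: "v \<in> carrier V"
  shows "lie_act V (pr x) v = lact V x v"
proof -
  note l = symmetric_repD(2)[OF V]
  have "module K V" using symmetric_repD(1)[OF V] by (simp add: vectorspace_def)
  then interpret V: module K V .
  have "lact V y v = lact V x v" if "y \<in> pr x" for y
    using that x v bilinear_maps_closed[OF l] by (auto simp: mem_pr bilinear_maps_add[OF l] lact_kernel[OF V])
  then have "(\<lambda>y. lact V y v) ` pr x = (\<lambda>_. lact V x v) ` pr x"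
    by (rule image_cong[OF refl])
  also have "\<dots> = {lact V x v}"
    using pr_self[OF x] by auto
  finally have "(\<lambda>y. lact V y v) ` pr x = {lact V x v}" .
  then show ?thesis by (simp add: lie_act_def)
qed

lemma project_pair:
  assumes "symmetric_rep K L V"
  shows "leibniz_pair K Q (project_rep V)"
proof -
  note V = symmetric_repD[OF assms]
  have m: "module K V" using V(1) by (simp add: vectorspace_def)
  interpret V: module K V by (rule m)
  note lc = bilinear_maps_closed[OF V(2)] and la = lie_act_pr[OF assms]
  show ?thesis
  proof (rule leibniz_pair_symmetricI)
    show "module K Q" by (rule Q_module)
    show "module K (project_rep V)" by (rule module_same_fields[OF m]) simp_all
    show "bracket Q \<in> bilinear_maps K Q Q Q" by (rule Q_bracket_bilinear)
    show "bracket Q x (bracket Q y z) = bracket Q (bracket Q x y) z \<oplus>\<^bsub>Q\<^esub> bracket Q y (bracket Q x z)"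
      if "x \<in> carrier Q" "y \<in> carrier Q" "z \<in> carrier Q" for x y z
      by (rule Q_leibniz[OF that])
    show "lact (project_rep V) \<in> bilinear_maps K Q (project_rep V) (project_rep V)"
      using lc by (auto simp: bilinear_maps_def module_hom_def la Q_add Q_smult bilinear_maps_add[OF V(2)]
          bilinear_maps_smult[OF V(2)] elim!: Q_cases)
    show "lact (project_rep V) (bracket Q x y) v =
        lact (project_rep V) x (lact (project_rep V) y v) \<ominus>\<^bsub>project_rep V\<^esub> lact (project_rep V) y (lact (project_rep V) x v)"
      if xyv: "x \<in> carrier Q" "y \<in> carrier Q" "v \<in> carrier (project_rep V)" for x y v
    proof -
      obtain a b where "x = pr a" "y = pr b" "a \<in> carrier L" "b \<in> carrier L"
        using xyv(1,2) by (auto elim!: Q_cases)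
      then show ?thesis
        using V(4)[of a b v] xyv(3) lc by (simp add: a_minus_def a_minus_same[OF m] Q_bracket la)
    qed
    show "ract (project_rep V) x v = \<ominus>\<^bsub>project_rep V\<^esub> lact (project_rep V) x v"
      if "x \<in> carrier Q" "v \<in> carrier (project_rep V)" for x v
      using that lc by (auto simp: a_minus_same[OF m] la elim!: Q_cases)
    show "x = \<zero>\<^bsub>Q\<^esub>" if "x \<in> carrier Q" "x \<oplus>\<^bsub>Q\<^esub> x = \<zero>\<^bsub>Q\<^esub>" for x
      using no_two_torsion[OF Q_vectorspace two that] .
    show "v = \<zero>\<^bsub>project_rep V\<^esub>" if "v \<in> carrier (project_rep V)" "v \<oplus>\<^bsub>project_rep V\<^esub> v = \<zero>\<^bsub>project_rep V\<^esub>" for v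
      using no_two_torsion[OF V(1) two, of v] that by simp
  qed
qed

lemma rep_homD:
  assumes "\<phi> \<in> rep_hom K L W V"
  shows "\<phi> \<in> module_hom K W V" "\<phi> \<in> extensional (carrier W)" "w \<in> carrier W \<Longrightarrow> \<phi> w \<in> carrier V"
    "\<lbrakk>x \<in> carrier L; w \<in> carrier W\<rbrakk> \<Longrightarrow> \<phi> (lact W x w) = lact V x (\<phi> w)"
  using assms by (auto simp: rep_hom_def module_hom_def)

lemma functor_C: "contravariant_functor K L (controlling_algebra K L) C_map"
  using contravariant_functor_controlling[OF field_axioms pair, where T = "\<lambda>V. V"] by (simp add: C_map_def[abs_def])

lemma functor_C_leib: "contravariant_functor K L (C_leib_obj K L) C_leib_map"
  unfolding C_leib_obj_def[abs_def] C_leib_map_def[abs_def]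
proof (rule contravariant_functor_controlling[OF field_axioms restrict_pair])
  fix V W :: "('k, 'g, 'b) repn" and \<phi>
  assume V: "symmetric_rep K L V" and W: "symmetric_rep K L W" and \<phi>: "\<phi> \<in> rep_hom K L W V"
  note h = rep_homD[OF \<phi>]
  have "module K W" "module K V" using symmetric_repD(1)[OF W] symmetric_repD(1)[OF V] by (simp_all add: vectorspace_def)
  note mi = module_hom_signed_apply(2)[OF h(1) this]
  have "\<phi> \<in> module_hom K (restrict_rep W) (restrict_rep V)"
    using h(1) by (simp add: module_hom_def)
  then show "\<phi> \<in> rep_hom K sub (restrict_rep W) (restrict_rep V)"
    using h mi bilinear_maps_closed[OF symmetric_repD(2)[OF W]] by (auto simp: rep_hom_def)
qed simp_all

lemma functor_C_lie: "contravariant_functor K L (C_lie_obj K L) C_lie_map"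
  unfolding C_lie_obj_def[abs_def] C_lie_map_def[abs_def]
proof (rule contravariant_functor_controlling[OF field_axioms project_pair])
  fix V W :: "('k, 'g, 'b) repn" and \<phi>
  assume V: "symmetric_rep K L V" and W: "symmetric_rep K L W" and \<phi>: "\<phi> \<in> rep_hom K L W V"
  note h = rep_homD[OF \<phi>]
  have "module K W" "module K V" using symmetric_repD(1)[OF W] symmetric_repD(1)[OF V] by (simp_all add: vectorspace_def)
  note mi = module_hom_signed_apply(2)[OF h(1) this]
  have "\<phi> \<in> module_hom K (project_rep W) (project_rep V)"
    using h(1) by (simp add: module_hom_def)
  then show "\<phi> \<in> rep_hom K Q (project_rep W) (project_rep V)"
    using h mi bilinear_maps_closed[OF symmetric_repD(2)[OF W]]
    by (auto simp: rep_hom_def lie_act_pr[OF V] lie_act_pr[OF W] elim!: Q_cases)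
qed simp_all

lemma alpha_hom:
  assumes V: "symmetric_rep K L V"
  shows "alpha V \<in> graded_lie_hom K (C_leib_obj K L V) (controlling_algebra K L V)"
proof -
  have t: "tuples (restrict_rep V) n = tuples V n" for n by (simp add: tuples_def)
  have "leib_incl \<in> module_hom K sub L" by (simp add: module_hom_def leib_incl_def)
  from graded_lie_hom_postcompose[OF restrict_pair[OF V] pair[OF V] this]
  show ?thesis
    using symmetric_repD(5)[OF V]
    by (simp add: C_leib_obj_def alpha_def[abs_def] t leib_incl_def)
qed

lemma beta_hom:
  assumes V: "symmetric_rep K L V"
  shows "beta K L V \<in> graded_lie_hom K (controlling_algebra K L V) (C_lie_obj K L V)"
  using graded_lie_hom_postcompose[OF pair[OF V] project_pair[OF V] pr_hom] symmetric_repD(5)[OF V]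
  by (simp add: C_lie_obj_def beta_def[abs_def] lie_act_pr[OF V] Q_bracket)

lemma map_in_tuples: "\<phi> \<in> rep_hom K L W V \<Longrightarrow> ws \<in> tuples W n \<Longrightarrow> map \<phi> ws \<in> tuples V n"
  using rep_homD(3) by (intro tuples_map) auto

lemma tuples_same: "tuples (restrict_rep V) n = tuples V n" "tuples (project_rep V) n = tuples V n"
  by (simp_all add: tuples_def)

lemma alpha_natural: "natural_transformation K L (C_leib_obj K L) C_leib_map (controlling_algebra K L) C_map alpha"
  unfolding natural_transformation_def
proof (intro conjI allI impI ballI functor_C functor_C_leib alpha_hom)
  fix V W :: "('k, 'g, 'b) repn" and \<phi> n f
  assume "symmetric_rep K L V \<and> symmetric_rep K L W \<and> \<phi> \<in> rep_hom K L W V"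
  then show "alpha W n (C_leib_map W V \<phi> n f) = C_map W V \<phi> n (alpha V n f)"
    by (auto simp: alpha_def C_leib_map_def C_map_def controlling_map_def tuples_same map_in_tuples intro!: restrict_ext)
qed

lemma beta_natural: "natural_transformation K L (controlling_algebra K L) C_map (C_lie_obj K L) C_lie_map (beta K L)"
  unfolding natural_transformation_def
proof (intro conjI allI impI ballI functor_C functor_C_lie beta_hom)
  fix V W :: "('k, 'g, 'b) repn" and \<phi> n f
  assume "symmetric_rep K L V \<and> symmetric_rep K L W \<and> \<phi> \<in> rep_hom K L W V"
  then show "beta K L W n (C_map W V \<phi> n f) = C_lie_map W V \<phi> n (beta K L V n f)"
    by (auto simp: beta_def C_lie_map_def C_map_def controlling_map_def tuples_same map_in_tuples intro!: restrict_ext)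
qed

section \<open>Exactness of the sequence\<close>

lemma alpha_id: "f \<in> extensional (tuples V n) \<Longrightarrow> alpha V n f = f"
  unfolding alpha_def leib_incl_def by (rule restrict_eqI) auto

text \<open>The inclusion is the identity on elements, so this describes the image of
  \<open>alpha V n\<close>. Exactness in the middle then compares it with the maps that
  \<open>beta\<close> sends to zero.\<close>

lemma restrict_maps_iff:
  "f \<in> multilinear_maps K (restrict_rep V) sub n \<longleftrightarrow> f \<in> multilinear_maps K V L n \<and> (\<forall>vs\<in>tuples V n. f vs \<in> I)"
  (is "?l \<longleftrightarrow> ?r")
proof
  assume ?l
  moreover from this have "f vs \<in> I" if "vs \<in> tuples V n" for vs
    using multilinear_maps_closed[of f K "restrict_rep V" sub n vs] that by (simp add: tuples_same)
  ultimately show ?r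
    by (auto simp: multilinear_maps_iff multilinear_def tuples_same module_hom_def Pi_def)
next
  assume r: ?r
  have "(\<lambda>v. f (xs[i := v])) \<in> module_hom K (restrict_rep V) sub" if "xs \<in> tuples V n" "i < n" for xs i
  proof -
    have "xs[i := v] \<in> tuples V n" if "v \<in> carrier V" for v
      using that \<open>xs \<in> tuples V n\<close> by (auto simp: tuples_def dest: set_update_subset_insert[THEN subsetD])
    then show ?thesis using r that by (auto simp: multilinear_maps_iff multilinear_def module_hom_def Pi_def)
  qed
  then show ?l using r by (auto simp: multilinear_maps_iff multilinear_def tuples_same)
qed

lemma short_exact:
  assumes V: "symmetric_rep K L V" and fd: "fin_dim"
  shows "graded_lie_short_exact K (C_leib_obj K L V) (alpha V) (controlling_algebra K L V) (beta K L V) (C_lie_obj K L V)"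
proof -
  note g = leibniz_pair.graded_lie_algebra_controlling[OF _ field_axioms]
  have mV: "module K V" using symmetric_repD(1)[OF V] by (simp add: vectorspace_def)
  let ?A = "\<lambda>n. multilinear_maps K (restrict_rep V) sub n" and ?B = "\<lambda>n. multilinear_maps K V L n"
    and ?C = "\<lambda>n. multilinear_maps K (project_rep V) Q n"
  have aid: "alpha V n f = f" if "f \<in> ?A n" for n f
    using that by (intro alpha_id) (simp add: multilinear_maps_iff tuples_same)
  have inj: "inj_on (alpha V n) (?A n)" for n
    using aid by (auto intro: inj_onI)
  have beta_zero: "beta K L V n f = (\<lambda>vs\<in>tuples V n. \<zero>\<^bsub>Q\<^esub>) \<longleftrightarrow> (\<forall>vs\<in>tuples V n. f vs \<in> I)" if f: "f \<in> ?B n" for n f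
  proof -
    have "pr (f vs) = \<zero>\<^bsub>Q\<^esub> \<longleftrightarrow> f vs \<in> I" if "vs \<in> tuples V n" for vs
      using pr_eq_kernel_iff[of "f vs"] pr_eq_kernel_iff[of "\<zero>\<^bsub>L\<^esub>"] multilinear_maps_closed[OF f that] by (simp add: Q_zero)
    then show ?thesis
      unfolding beta_def by (auto simp: fun_eq_iff restrict_def)
  qed
  have exact: "alpha V n ` ?A n = {f \<in> ?B n. beta K L V n f = (\<lambda>vs\<in>tuples V n. \<zero>\<^bsub>Q\<^esub>)}" for n
  proof -
    have "alpha V n ` ?A n = (\<lambda>f. f) ` ?A n" by (rule image_cong[OF refl aid])
    then have eq: "alpha V n ` ?A n = ?A n" by simp
    show ?thesis
      unfolding eq by (auto simp: restrict_maps_iff beta_zero)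
  qed
  \<comment> \<open>Linearity of \<open>s\<close> keeps \<open>s (f vs)\<close> multilinear in
    \<open>vs\<close>, and this composite is the preimage of \<open>f\<close> under
    \<open>beta\<close>.\<close>
  obtain s where s: "s \<in> module_hom K Q L" "\<And>c. c \<in> carrier Q \<Longrightarrow> pr (s c) = c"
    using linear_section[OF vectorspace_axioms Q_vectorspace fd pr_hom] Q_carrier by metis
  have surj: "beta K L V n ` ?B n = ?C n" for n
  proof (intro equalityI subsetI)
    have "beta K L V n \<in> module_hom K (hom_space K V L n) (hom_space K (project_rep V) Q n)"
    proof -
      have "(\<lambda>v. v) \<in> module_hom K (project_rep V) V" by (simp add: module_hom_def)
      moreover have "module K (project_rep V)" by (rule module_same_fields[OF mV]) simp_all
      ultimately show ?thesis
        using module_hom_transport[of "\<lambda>v. v" K "project_rep V" V pr L Q n] pr_hom mV module_axioms Q_module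
        by (simp add: beta_def[abs_def] tuples_same)
    qed
    from module_hom_closed[OF this] show "f \<in> ?C n" if "f \<in> beta K L V n ` ?B n" for f
      using that by auto
    fix f assume f: "f \<in> ?C n"
    \<comment> \<open>The identity map in \<open>map\<close> is there to change the source from
      \<open>project_rep V\<close> to \<open>V\<close>, which are different records.\<close>
    have "multilinear K V L n (\<lambda>vs. s (f (map (\<lambda>v. v) vs)))"
      using f s(1) by (intro multilinear_compose[of K "project_rep V" Q]) (auto simp: multilinear_maps_iff module_hom_def)
    then have "restrict (\<lambda>vs. s (f vs)) (tuples V n) \<in> ?B n"
      using mV by (intro multilinear_mapsI) auto
    moreover have "beta K L V n (restrict (\<lambda>vs. s (f vs)) (tuples V n)) = f"
      unfolding beta_def using f s(2) multilinear_maps_closed[OF f]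
      by (intro restrict_eqI) (auto simp: multilinear_maps_iff tuples_same)
    ultimately show "f \<in> beta K L V n ` ?B n" by (metis imageI)
  qed
  show ?thesis
    unfolding graded_lie_short_exact_def
    using g[OF pair[OF V]] g[OF restrict_pair[OF V]] g[OF project_pair[OF V]] alpha_hom[OF V] beta_hom[OF V] inj exact surj
    by (simp add: C_leib_obj_def C_lie_obj_def tuples_same)
qed

end

theorem theorem3p5:
  fixes K :: "'k ring" and L :: "('k, 'g) leibniz"
  assumes "algebraically_closed K"
    and "\<forall>n::nat. n > 0 \<longrightarrow> [n] \<cdot>\<^bsub>K\<^esub> \<one>\<^bsub>K\<^esub> \<noteq> \<zero>\<^bsub>K\<^esub>"
    and "leibniz_algebra K L"
  shows
    "natural_transformation K L
       (C_leib_obj K L) C_leib_map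
       (controlling_algebra K L) C_map
       (alpha :: ('k, 'g, 'v) repn \<Rightarrow> _) \<and>
     natural_transformation K L
       (controlling_algebra K L) C_map
       (C_lie_obj K L) C_lie_map
       (beta K L :: ('k, 'g, 'v) repn \<Rightarrow> _) \<and>
     (\<forall>V :: ('k, 'g, 'v) repn. symmetric_rep K L V \<longrightarrow>
        graded_lie_short_exact K
          (C_leib_obj K L V) (alpha V) (controlling_algebra K L V) (beta K L V) (C_lie_obj K L V))"
proof -
  have vs: "vectorspace K L" and fd: "vectorspace.fin_dim K L"
    using assms(3) by (simp_all add: leibniz_algebra_def)
  interpret V: vectorspace K L by (rule vs)
  \<comment> \<open>Characteristic zero is applied with \<open>n = 2\<close>, to exclude 2-torsion
    for \<open>differential_square\<close>.\<close>
  have "[(2::nat)] \<cdot>\<^bsub>K\<^esub> \<one>\<^bsub>K\<^esub> = \<one>\<^bsub>K\<^esub> \<oplus>\<^bsub>K\<^esub> \<one>\<^bsub>K\<^esub>"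
    by (simp add: numeral_2_eq_2)
  then have two: "\<one>\<^bsub>K\<^esub> \<oplus>\<^bsub>K\<^esub> \<one>\<^bsub>K\<^esub> \<noteq> \<zero>\<^bsub>K\<^esub>"
    using assms(2)[rule_format, of 2] by simp
  interpret leibniz_alg K L
  proof unfold_locales
    show "bracket L \<in> bilinear_maps K L L L"
      using assms(3) by (simp only: leibniz_algebra_def)
    show "bracket L x (bracket L y z) = bracket L (bracket L x y) z \<oplus>\<^bsub>L\<^esub> bracket L y (bracket L x z)"
      if "x \<in> carrier L" "y \<in> carrier L" "z \<in> carrier L" for x y z
      using assms(3) that unfolding leibniz_algebra_def by blast
  qed (rule two)
  show ?thesis
    using alpha_natural beta_natural short_exact[OF _ fd] by blast
qed

end
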